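(* Let $n\ge 2$ and $m\ge 2$ be integers, and let $X$ be a finite group with $X=G\langle c\rangle$, where $G=\langle a,b\mid a^{4n}=b^2=1,\ a^b=a^{2n-1}\rangle$ is a semidihedral subgroup of order $8n$, $c$ has order $m$, and $G\cap\langle c\rangle=1$. Let $M$ be the subgroup of $X$ of the biggest order such that $\langle c\rangle\le M\subseteq\langle a\rangle\langle c\rangle$. Then: (i) if $n$ is odd, then $\langle a^4,c\rangle\le C_X(\langle c\rangle_X)$ and $|X:C_X(\langle c\rangle_X)|\le 8$; (ii) if $n$ is even, then $\langle a^2,c\rangle\le C_X(\langle c\rangle_X)$ and $|X:C_X(\langle c\rangle_X)|\le 4$; (iii) if $\langle c\rangle_X=1$, then $M_X\cap\langle a^4\rangle\lhd M_X$; (iv) in particular, if $\langle c\rangle_X=1$ and $M=\langle a\rangle\langle c\rangle$, then $\langle a^4\rangle\lhd X$.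
   Context: All groups are finite. $x^y=y^{-1}xy$. For subgroups $A,B$ of $X$, $AB=\{xy: x\in A,y\in B\}$ is the product set (not necessarily a subgroup). For a subgroup $S\le X$, the core is $S_X=\bigcap_{x\in X}S^x$. $C_X(S)$ is the centralizer of $S$ in $X$. *)

theory Defs
  imports "HOL-Algebra.Algebra"
begin

definition conj_by :: "('a, 'r) monoid_scheme \<Rightarrow> 'a \<Rightarrow> 'a \<Rightarrow> 'a" where
  "conj_by \<XX> x y = inv\<^bsub>\<XX>\<^esub> y \<otimes>\<^bsub>\<XX>\<^esub> x \<otimes>\<^bsub>\<XX>\<^esub> y"

definition subgroup_core :: "('a, 'r) monoid_scheme \<Rightarrow> 'a set \<Rightarrow> 'a set" where
  "subgroup_core \<XX> S = (\<Inter>x\<in>carrier \<XX>. (\<lambda>s. conj_by \<XX> s x) ` S)"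

definition centralizer :: "('a, 'r) monoid_scheme \<Rightarrow> 'a set \<Rightarrow> 'a set" where
  "centralizer \<XX> S = {x \<in> carrier \<XX>. \<forall>s\<in>S. x \<otimes>\<^bsub>\<XX>\<^esub> s = s \<otimes>\<^bsub>\<XX>\<^esub> x}"

definition subgroup_index :: "('a, 'r) monoid_scheme \<Rightarrow> 'a set \<Rightarrow> nat" where
  "subgroup_index \<XX> H = card (rcosets\<^bsub>\<XX>\<^esub> H)"

text \<open>The subgroup \<open>G\<close> of \<open>\<XX>\<close> is
  \<open>\<langle>a, b | a\<^sup>4\<^sup>n = b\<^sup>2 = 1, a\<^sup>b = a\<^sup>2\<^sup>n\<^sup>-\<^sup>1\<rangle>\<close>.
  The presented group has order \<open>8n\<close> (as \<open>(2n - 1)\<^sup>2 \<equiv> 1\<close> modulo \<open>4n\<close>), and every subgroup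
  generated by \<open>a, b\<close> satisfying the relations is a quotient of it.  Hence, for \<open>n > 0\<close>, order
  \<open>8n\<close> says exactly that the relations are defining relations.\<close>

definition semidihedral_subgroup ::
    "('a, 'r) monoid_scheme \<Rightarrow> nat \<Rightarrow> 'a set \<Rightarrow> 'a \<Rightarrow> 'a \<Rightarrow> bool" where
  "semidihedral_subgroup \<XX> n G a b \<longleftrightarrow>
     a \<in> carrier \<XX> \<and> b \<in> carrier \<XX> \<and> G = generate \<XX> {a, b} \<and>
     a [^]\<^bsub>\<XX>\<^esub> (4 * n) = \<one>\<^bsub>\<XX>\<^esub> \<and> b [^]\<^bsub>\<XX>\<^esub> (2::nat) = \<one>\<^bsub>\<XX>\<^esub> \<and>
     conj_by \<XX> a b = a [^]\<^bsub>\<XX>\<^esub> (2 * n - 1) \<and> card G = 8 * n"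

text \<open>The product \<open>A <#> B\<close> below is only a set, not a subgroup, in general.
  A subgroup of biggest order between \<open>\<langle>c\<rangle>\<close> and \<open>\<langle>a\<rangle>\<langle>c\<rangle>\<close> is unique: if \<open>M\<close>, \<open>N\<close> are subgroups
  with \<open>C \<subseteq> M, N \<subseteq> A <#> C\<close> and \<open>A\<close> abelian, then so is \<open>((M \<inter> A) <#> (N \<inter> A)) <#> C\<close>.\<close>

definition biggest_subgroup_between ::
    "('a, 'r) monoid_scheme \<Rightarrow> 'a set \<Rightarrow> 'a set \<Rightarrow> 'a set \<Rightarrow> bool" where
  "biggest_subgroup_between \<XX> L U M \<longleftrightarrow>
     subgroup M \<XX> \<and> L \<subseteq> M \<and> M \<subseteq> U \<and>
     (\<forall>N. subgroup N \<XX> \<and> L \<subseteq> N \<and> N \<subseteq> U \<longrightarrow> card N \<le> card M)"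

end

theory Submission
  imports Defs "HOL-Computational_Algebra.Polynomial"
begin

text \<open>
  Since \<open>Aut(\<langle>c\<rangle>\<^sub>X)\<close> is abelian, \<open>C\<^sub>X(\<langle>c\<rangle>\<^sub>X)\<close> contains \<open>c\<close> and \<open>[a, b] = a\<^sup>2\<^sup>n\<^sup>-\<^sup>2\<close>, and
  \<open>gcd(2n - 2, 4n)\<close> is 4 or 2; this gives (i) and (ii).  For (iii), \<open>M\<^sub>X\<langle>a\<rangle> = \<langle>a\<rangle>\<langle>c\<^sub>1\<rangle>\<close> with
  \<open>c\<^sub>1 \<in> \<langle>c\<rangle>\<close> is normalized by \<open>b\<close>, so (iii) and (iv) both follow once \<open>c\<close> normalizes \<open>\<langle>a\<^sup>4\<rangle>\<close> whenever
  \<open>L = \<langle>a\<rangle>\<langle>c\<rangle>\<close> is a group normalized by \<open>b\<close> and \<open>\<langle>c\<rangle>\<close> is core-free.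

  By Ito, \<open>L'\<close> is abelian.  As a module over \<open>\<int>[X]\<close>, with \<open>X\<close> acting as \<open>a\<close>, it is generated by
  \<open>[a, c]\<close>, so it is a finite commutative ring \<open>R\<close> generated by the action \<open>\<alpha>\<close> of \<open>a\<close>, and also by the
  action \<open>\<gamma>\<close> of \<open>c\<close>.  Writing elements of \<open>L\<close> as \<open>a\<^sup>ic\<^sup>k\<close> and as \<open>c\<^sup>ka\<^sup>i\<close> shows that
  \<open>\<gamma>\<close> is of the form \<open>1 + \<alpha> + \<dots> + \<alpha>\<^sup>i\<^sup>-\<^sup>1\<close>, that such sums exhaust \<open>(\<gamma> - 1)R\<close>, and the same with
  \<open>\<alpha>\<close> and \<open>\<gamma>\<close> exchanged.  Conjugation by \<open>b\<close> induces an automorphism \<open>\<beta>\<close> of \<open>R\<close> with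
  \<open>\<beta>(\<alpha>) = \<alpha>\<^sup>2\<^sup>n\<^sup>-\<^sup>1\<close>.  These conditions force \<open>\<alpha>\<^sup>4 = 1\<close>: after passing to a quotient in which \<open>\<alpha>\<^sup>4 - 1\<close>
  lies in every nonzero \<open>\<beta>\<close>-stable ideal, \<open>R\<close> behaves like a local ring; \<open>\<beta>\<close> is trivial
  modulo \<open>(\<alpha> - 1)(\<gamma> - 1)R\<close>, and the remaining case of residue characteristic 2 is contradictory.

  Hence \<open>[a\<^sup>4, c]\<close> commutes with \<open>a\<close>, and \<open>(a\<^sup>4)\<^sup>c = a\<^sup>4\<^sup>ke\<close> with \<open>e \<in> \<langle>c\<rangle>\<close> central in \<open>L\<close>.  Comparing
  \<open>c\<^sup>b = a\<^sup>sc\<^sup>l\<close> with \<open>c = (c\<^sup>b)\<^sup>b\<close> yields \<open>(c\<^sup>b)\<^sup>l\<^sup>-\<^sup>1 = c\<^sup>1\<^sup>-\<^sup>l\<close> up to a power of \<open>a\<^sup>2\<^sup>n\<close>, which together with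
  \<open>\<langle>e\<rangle> \<inter> \<langle>e\<^sup>b\<rangle> = 1\<close> forces \<open>e = 1\<close>.
\<close>

section \<open>Twisted rings\<close>

definition gsum :: "nat \<Rightarrow> 'r::comm_ring_1 \<Rightarrow> 'r" where
  "gsum t q = (\<Sum>k<t. q ^ k)"

lemma gsum_0 [simp]: "gsum 0 q = 0"
  and gsum_Suc: "gsum (Suc t) q = gsum t q + q ^ t"
  by (simp_all add: gsum_def)

lemma gsum_mult: "(q - 1) * gsum t q = q ^ t - 1"
  by (simp add: gsum_def power_diff_1_eq)

lemma gsum_Suc': "gsum (Suc t) q = 1 + q * gsum t q"
  unfolding gsum_def by (subst sum.lessThan_Suc_shift) (simp add: sum_distrib_left)

lemma gsum_double: "gsum (2 * t) q = (1 + q) * gsum t (q ^ 2)"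
  by (induction t) (simp_all add: gsum_Suc algebra_simps flip: power_mult)

text \<open>The coefficients are those of ((1 + g)^t - 1) / g. Induction on t avoids the division by
  g, which may be a zero divisor.\<close>

lemma gsum_expand:
  obtains s where "gsum t (1 + g) = of_nat t + of_nat (t choose 2) * g + of_nat (t choose 3) * g ^ 2 + g ^ 3 * s"
proof -
  have "\<exists>s. gsum t (1 + g) = of_nat t + of_nat (t choose 2) * g + of_nat (t choose 3) * g ^ 2 + g ^ 3 * s"
  proof (induction t)
    case 0
    show ?case by (auto intro: exI[of _ 0] simp: binomial_eq_0)
  next
    case (Suc t)
    then obtain s where s: "gsum t (1 + g) = of_nat t + of_nat (t choose 2) * g + of_nat (t choose 3) * g ^ 2 + g ^ 3 * s"
      by blast
    have c2: "Suc t choose 2 = t + (t choose 2)" and c3: "Suc t choose 3 = (t choose 2) + (t choose 3)"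
      by (simp_all add: numeral_2_eq_2 numeral_3_eq_3)
    have "gsum (Suc t) (1 + g) = of_nat (Suc t) + of_nat (Suc t choose 2) * g + of_nat (Suc t choose 3) * g ^ 2
        + g ^ 3 * (of_nat (t choose 3) + s + g * s)"
      unfolding gsum_Suc' s c2 c3 by (simp add: algebra_simps power2_eq_square power3_eq_cube)
    then show ?case by blast
  qed
  with that show ?thesis by blast
qed

lemma gsum_linear:
  obtains s where "gsum t (1 + g) = of_nat t + g * s"
proof -
  obtain s where "gsum t (1 + g) = of_nat t + of_nat (t choose 2) * g + of_nat (t choose 3) * g ^ 2 + g ^ 3 * s"
    using gsum_expand .
  then have "gsum t (1 + g) = of_nat t + g * (of_nat (t choose 2) + of_nat (t choose 3) * g + g ^ 2 * s)"
    by (simp add: algebra_simps power2_eq_square power3_eq_cube)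
  with that show ?thesis by blast
qed

section \<open>Congruence modulo an ideal\<close>

locale ring_ideal =
  fixes J :: "'r::comm_ring_1 set"
  assumes zero_J: "0 \<in> J"
    and add_J: "\<lbrakk>x \<in> J; y \<in> J\<rbrakk> \<Longrightarrow> x + y \<in> J"
    and mult_J: "x \<in> J \<Longrightarrow> r * x \<in> J"
begin

text \<open>The quotient ring is never formed as a type. Computing in a fixed ambient ring modulo
  \<open>J\<close> allows \<open>J\<close> to be enlarged later.\<close>

definition cg :: "'r \<Rightarrow> 'r \<Rightarrow> bool" (infix \<open>\<doteq>\<close> 50) where
  "x \<doteq> y \<longleftrightarrow> x - y \<in> J"

lemma mult_J': "x \<in> J \<Longrightarrow> x * r \<in> J"
  using mult_J[of x r] by (simp add: mult.commute)

lemma minus_J: "x \<in> J \<Longrightarrow> - x \<in> J"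
  using mult_J[of x "-1"] by simp

lemma diff_J: "\<lbrakk>x \<in> J; y \<in> J\<rbrakk> \<Longrightarrow> x - y \<in> J"
  using add_J[of x "- y"] minus_J by simp

lemma cg_refl [simp]: "x \<doteq> x"
  by (simp add: zero_J cg_def)

lemma cg_sym: "x \<doteq> y \<Longrightarrow> y \<doteq> x"
  using minus_J[of "x - y"] by (simp add: cg_def)

lemma cg_trans [trans]: "\<lbrakk>x \<doteq> y; y \<doteq> z\<rbrakk> \<Longrightarrow> x \<doteq> z"
  using add_J[of "x - y" "y - z"] by (simp add: cg_def)

lemma cg_eq_trans [trans]: "\<lbrakk>x \<doteq> y; y = z\<rbrakk> \<Longrightarrow> x \<doteq> z" "\<lbrakk>x = y; y \<doteq> z\<rbrakk> \<Longrightarrow> x \<doteq> z"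
  by simp_all

lemma cg_add: "\<lbrakk>x \<doteq> y; x' \<doteq> y'\<rbrakk> \<Longrightarrow> x + x' \<doteq> y + y'"
  using add_J[of "x - y" "x' - y'"] by (simp add: cg_def algebra_simps)

lemma cg_diff: "\<lbrakk>x \<doteq> y; x' \<doteq> y'\<rbrakk> \<Longrightarrow> x - x' \<doteq> y - y'"
  using diff_J[of "x - y" "x' - y'"] by (simp add: cg_def algebra_simps)

lemma cg_minus: "x \<doteq> y \<Longrightarrow> - x \<doteq> - y"
  using minus_J[of "x - y"] by (simp add: cg_def)

lemma cg_mult: "\<lbrakk>x \<doteq> y; x' \<doteq> y'\<rbrakk> \<Longrightarrow> x * x' \<doteq> y * y'"
  using add_J[OF mult_J'[of "x - y" x'] mult_J[of "x' - y'" y]] by (simp add: cg_def algebra_simps)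

lemma cg_power: "x \<doteq> y \<Longrightarrow> x ^ k \<doteq> y ^ k"
  by (induction k) (auto intro: cg_mult)

lemma cg_gsum: "x \<doteq> y \<Longrightarrow> gsum k x \<doteq> gsum k y"
  by (induction k) (auto simp: gsum_Suc intro!: cg_add cg_power)

lemma cg_multl: "x \<doteq> y \<Longrightarrow> r * x \<doteq> r * y"
  and cg_multr: "x \<doteq> y \<Longrightarrow> x * r \<doteq> y * r"
  by (simp_all add: cg_mult)

lemma cg_0 [simp]: "x \<doteq> 0 \<longleftrightarrow> x \<in> J"
  by (simp add: cg_def)

lemma cg_J: "x \<doteq> y \<Longrightarrow> x \<in> J \<longleftrightarrow> y \<in> J"
  using cg_trans[of x y 0] cg_trans[of y x 0] cg_sym[of x y] by auto

lemma unit_cancel: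
  assumes "u * x \<in> J" "u * u' \<doteq> 1"
  shows "x \<in> J"
proof -
  have "x = u' * (u * x) - (u * u' - 1) * x"
    by (simp add: algebra_simps)
  then show ?thesis
    using assms unfolding cg_def by (metis diff_J mult_J mult_J')
qed

text \<open>Iterating the hypothesis gives \<open>x \<doteq> q ^ k * x\<close> for every k.\<close>

lemma nilpotent_fix:
  assumes "x \<doteq> q * x" "q ^ N \<in> J"
  shows "x \<in> J"
proof -
  have "x \<doteq> q ^ k * x" for k
  proof (induction k)
    case (Suc k)
    have "x \<doteq> q ^ k * x" by (rule Suc)
    also have "q ^ k * x \<doteq> q ^ k * (q * x)" by (rule cg_multl[OF assms(1)])
    also have "\<dots> = q ^ Suc k * x" by (simp add: mult_ac)
    finally show ?case .
  qed simp
  from cg_J[OF this[of N]] show ?thesis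
    using assms(2) by (simp add: mult_J')
qed

lemma nilpotent_mult: "q ^ N \<in> J \<Longrightarrow> (r * q) ^ N \<in> J"
  by (simp add: power_mult_distrib mult_J)

text \<open>Descent on the powers of \<open>q2\<close>: once \<open>q2 * x\<close> vanishes, the
  relation reads \<open>x \<doteq> r1 * q1 * x\<close>, and the nilpotency of \<open>q1\<close>
  kills \<open>x\<close>.\<close>

lemma nilpotent_two:
  assumes "q1 ^ N1 \<in> J" "q2 ^ N2 \<in> J" "r1 * q1 + r2 * q2 \<doteq> 1"
  shows "1 \<in> J"
proof -
  have "k \<le> N2 \<Longrightarrow> q2 ^ (N2 - k) \<in> J" for k
  proof (induction k)
    case (Suc k)
    define x where "x = q2 ^ (N2 - Suc k)"
    have *: "q2 * x = q2 ^ (N2 - k)"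
      using Suc.prems by (simp add: x_def Suc_diff_Suc flip: power_Suc)
    with Suc have **: "q2 * x \<in> J" by simp
    have "x \<doteq> (r1 * q1 + r2 * q2) * x"
      using cg_multr[OF assms(3), of x] cg_sym by simp
    also have "(r1 * q1 + r2 * q2) * x = (r1 * q1) * x + r2 * (q2 * x)"
      by (simp add: algebra_simps)
    also have "\<dots> \<doteq> (r1 * q1) * x"
      using mult_J[OF **] by (simp add: cg_def)
    finally show ?case
      using nilpotent_fix[OF _ nilpotent_mult[OF assms(1)]] unfolding x_def by blast
  qed (use assms in simp)
  from this[of N2] show ?thesis by simp
qed

lemma one_minus_nilpotent_unit:
  assumes "q ^ N \<in> J" shows "\<exists>u. (1 - q) * u \<doteq> 1"
proof
  show "(1 - q) * gsum N q \<doteq> 1"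
    using gsum_mult[of q N] minus_J[OF assms] by (simp add: cg_def algebra_simps)
qed

text \<open>The subring Z + qR of R/J, pulled back to the ambient ring.\<close>

definition integers_plus :: "'r \<Rightarrow> 'r set" where
  "integers_plus q = {x. \<exists>m s. x \<doteq> of_int m + q * s}"

lemma integers_plusI: "x \<doteq> of_int m + q * s \<Longrightarrow> x \<in> integers_plus q"
  unfolding integers_plus_def by blast

lemma integers_plus_one: "1 \<in> integers_plus q"
  by (rule integers_plusI[of _ 1 _ 0]) simp

lemma integers_plus_self: "1 + q \<in> integers_plus q"
  by (rule integers_plusI[of _ 1 _ 1]) simp

lemma integers_plus_closed:
  assumes "x \<in> integers_plus q" "y \<in> integers_plus q"
  shows "x + y \<in> integers_plus q" "x * y \<in> integers_plus q" "- x \<in> integers_plus q"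
proof -
  obtain m s m' s' where *: "x \<doteq> of_int m + q * s" "y \<doteq> of_int m' + q * s'"
    using assms unfolding integers_plus_def by blast
  show "x + y \<in> integers_plus q"
    using cg_add[OF *] by (intro integers_plusI[of _ "m + m'" _ "s + s'"]) (simp add: algebra_simps)
  show "x * y \<in> integers_plus q"
    using cg_mult[OF *]
    by (intro integers_plusI[of _ "m * m'" _ "s * of_int m' + s' * of_int m + q * s * s'"]) (simp add: algebra_simps)
  show "- x \<in> integers_plus q"
    using cg_minus[OF *(1)] by (intro integers_plusI[of _ "- m" _ "- s"]) (simp add: algebra_simps)
qed

end

text \<open>\<open>periodic\<close> and \<open>torsion\<close> carry what is needed of the
  finiteness of R/J. Every assumption survives the replacement of \<open>J\<close> by a larger
  \<beta>-stable ideal, as the final maximality argument requires.\<close>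

locale twisted_ring = ring_ideal J for J :: "'r::comm_ring_1 set" +
  fixes \<alpha> \<gamma> :: 'r and \<beta> :: "'r \<Rightarrow> 'r" and n i j :: nat
  assumes generated: "\<And>S x. \<lbrakk>1 \<in> S; \<alpha> \<in> S; \<And>x y. \<lbrakk>x \<in> S; y \<in> S\<rbrakk> \<Longrightarrow> x + y \<in> S;
        \<And>x y. \<lbrakk>x \<in> S; y \<in> S\<rbrakk> \<Longrightarrow> x * y \<in> S; \<And>x. x \<in> S \<Longrightarrow> - x \<in> S\<rbrakk> \<Longrightarrow> x \<in> S"
    and periodic: "\<And>q. \<exists>k t. t > 0 \<and> q ^ (k + t) \<doteq> q ^ k"
    and torsion: "\<exists>m>0. of_nat m \<in> J"
    and n_pos: "n > 0"
    and order_alpha: "\<alpha> ^ (4 * n) \<doteq> 1"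
    and order_gamma: "\<exists>N>0. \<gamma> ^ N \<doteq> 1"
    and gamma_eq: "\<gamma> \<doteq> gsum i \<alpha>"
    and alpha_eq: "\<alpha> \<doteq> gsum j \<gamma>"
    and closed_gamma: "\<And>x. \<exists>t. (\<alpha> - 1) * x \<doteq> gsum t \<gamma>"
    and closed_alpha: "\<And>x. \<exists>t. (\<gamma> - 1) * x \<doteq> gsum t \<alpha>"
    and beta_add: "\<And>x y. \<beta> (x + y) = \<beta> x + \<beta> y"
    and beta_mult: "\<And>x y. \<beta> (x * y) = \<beta> x * \<beta> y"
    and beta_one: "\<beta> 1 = 1"
    and beta_J: "\<And>x. x \<in> J \<Longrightarrow> \<beta> x \<in> J"
    and beta_alpha: "\<beta> \<alpha> \<doteq> \<alpha> ^ (2 * n - 1)"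
begin

lemma beta_0: "\<beta> 0 = 0"
  using beta_add[of 0 0] by simp

lemma beta_minus: "\<beta> (- x) = - \<beta> x"
  using beta_add[of x "- x"] by (simp add: beta_0 eq_neg_iff_add_eq_0 add.commute)

lemma beta_diff: "\<beta> (x - y) = \<beta> x - \<beta> y"
  using beta_add[of x "- y"] by (simp add: beta_minus)

lemma beta_power: "\<beta> (x ^ k) = \<beta> x ^ k"
  by (induction k) (simp_all add: beta_one beta_mult)

lemma beta_of_nat: "\<beta> (of_nat k) = of_nat k"
  by (induction k) (simp_all add: beta_0 beta_one beta_add)

lemma beta_of_int: "\<beta> (of_int k) = of_int k"
  by (cases k) (simp_all add: beta_of_nat beta_minus beta_diff beta_one)

lemma beta_gsum: "\<beta> (gsum t x) = gsum t (\<beta> x)"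
  by (induction t) (simp_all add: gsum_Suc beta_0 beta_add beta_power)

lemma beta_cong: "x \<doteq> y \<Longrightarrow> \<beta> x \<doteq> \<beta> y"
  using beta_J[of "x - y"] by (simp add: beta_diff cg_def)

abbreviation (input) "a \<equiv> \<alpha> - 1"
abbreviation (input) "g \<equiv> \<gamma> - 1"
abbreviation (input) "l \<equiv> \<alpha> ^ 4 - 1"

lemma alpha_unit: "\<alpha> * \<alpha> ^ (4 * n - 1) \<doteq> 1"
  using order_alpha n_pos by (simp flip: power_Suc)

lemma gamma_unit: "\<exists>u. \<gamma> * u \<doteq> 1"
proof -
  obtain N where "N > 0" "\<gamma> ^ N \<doteq> 1" using order_gamma by blast
  then have "\<gamma> * \<gamma> ^ (N - 1) \<doteq> 1" by (simp flip: power_Suc)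
  then show ?thesis by blast
qed

lemma integer_plus_alpha: "\<exists>m s. x \<doteq> of_int m + a * s"
proof -
  have "x \<in> integers_plus a"
    by (rule generated[of "integers_plus a"])
      (use integers_plus_self[of a] in \<open>simp_all add: integers_plus_one integers_plus_closed\<close>)
  then show ?thesis unfolding integers_plus_def by blast
qed

text \<open>By \<open>alpha_eq\<close>, \<alpha> is congruent to a polynomial in \<gamma>, so
  \<gamma> generates too. Closure under congruence is required because that equation holds only
  modulo \<open>J\<close>.\<close>

lemma generated_gamma:
  assumes "1 \<in> S" "\<gamma> \<in> S" "\<And>x y. \<lbrakk>x \<in> S; y \<in> S\<rbrakk> \<Longrightarrow> x + y \<in> S"
    "\<And>x y. \<lbrakk>x \<in> S; y \<in> S\<rbrakk> \<Longrightarrow> x * y \<in> S" "\<And>x. x \<in> S \<Longrightarrow> - x \<in> S"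
    and J: "\<And>x y. \<lbrakk>x \<in> S; y \<doteq> x\<rbrakk> \<Longrightarrow> y \<in> S"
  shows "x \<in> S"
proof -
  have pow: "\<gamma> ^ k \<in> S" for k
    by (induction k) (auto intro: assms)
  have zero: "0 \<in> S" using assms(3)[OF assms(1) assms(5)[OF assms(1)]] by simp
  have "gsum k \<gamma> \<in> S" for k
    by (induction k) (auto simp: gsum_Suc zero intro: assms pow)
  then have "\<alpha> \<in> S" using J alpha_eq by blast
  then show ?thesis using generated[of S x] assms by blast
qed

lemma integer_plus_gamma: "\<exists>m s. x \<doteq> of_int m + g * s"
proof -
  have "x \<in> integers_plus g"
  proof (rule generated_gamma)
    show "\<gamma> \<in> integers_plus g" using integers_plus_self[of g] by simp
    show "y \<in> integers_plus g" if "z \<in> integers_plus g" "y \<doteq> z" for z y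
      using that cg_trans unfolding integers_plus_def by blast
  qed (simp_all add: integers_plus_one integers_plus_closed)
  then show ?thesis unfolding integers_plus_def by blast
qed

text \<open>If \<beta> fixes \<alpha> modulo \<open>I\<close>, then \<alpha>^(2n-1) = \<alpha>
  there. Squaring gives \<alpha>^(4n-2) = \<alpha>^2, and \<alpha>^(4n) = 1 turns this into
  \<alpha>^4 = 1. A factor \<alpha>^3 keeps the exponents natural.\<close>

lemma beta_trivial:
  assumes "ring_ideal I" "J \<subseteq> I" "\<beta> \<alpha> - \<alpha> \<in> I"
  shows "l \<in> I"
proof -
  interpret I: ring_ideal I by fact
  have JI: "I.cg x y" if "x \<doteq> y" for x y
    using that assms(2) by (auto simp: I.cg_def cg_def)
  have "I.cg (\<alpha> ^ (2 * n - 1)) \<alpha>"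
    using I.cg_trans[OF JI[OF cg_sym[OF beta_alpha]]] assms(3) by (simp add: I.cg_def)
  then have "I.cg (\<alpha> ^ 3 * (\<alpha> ^ (2 * n - 1)) ^ 2) (\<alpha> ^ 3 * \<alpha> ^ 2)"
    by (intro I.cg_multl I.cg_power)
  also have "\<alpha> ^ 3 * \<alpha> ^ 2 = \<alpha> * \<alpha> ^ 4"
    by (simp add: power_Suc[symmetric] flip: power_add)
  also have "\<alpha> ^ 3 * (\<alpha> ^ (2 * n - 1)) ^ 2 = \<alpha> * \<alpha> ^ (4 * n)"
  proof -
    have "3 + (2 * n - 1) * 2 = Suc (4 * n)" using n_pos by simp
    then show ?thesis by (metis power_add power_mult power_Suc)
  qed
  finally have "I.cg (\<alpha> * \<alpha> ^ (4 * n)) (\<alpha> * \<alpha> ^ 4)" .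
  moreover have "I.cg (\<alpha> * \<alpha> ^ (4 * n)) (\<alpha> * 1)"
    by (rule I.cg_multl[OF JI[OF order_alpha]])
  ultimately have "I.cg (\<alpha> * \<alpha> ^ 4) (\<alpha> * 1)"
    using I.cg_trans I.cg_sym by blast
  then have "\<alpha> * l \<in> I" by (simp add: I.cg_def algebra_simps)
  then show ?thesis using I.unit_cancel JI[OF alpha_unit] by blast
qed

text \<open>\<beta> fixes all integers, so it is the identity on a quotient of Z.\<close>

lemma integral_trivial:
  assumes "\<And>x. \<exists>m. x \<doteq> of_int m"
  shows "l \<in> J"
proof (rule beta_trivial)
  have "\<beta> x \<doteq> x" for x
  proof -
  obtain m where m: "x \<doteq> of_int m" using assms by blast
  have "\<beta> x \<doteq> of_int m" using beta_cong[OF m] by (simp add: beta_of_int)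
  with m show "\<beta> x \<doteq> x" using cg_trans cg_sym by blast
  qed
  then show "\<beta> \<alpha> - \<alpha> \<in> J" by (simp add: cg_def)
qed (simp_all add: ring_ideal_axioms)

end

section \<open>Minimal counterexamples\<close>

locale minimal_twisted_ring = twisted_ring +
  assumes minimal: "\<And>K. \<lbrakk>ring_ideal K; J \<subseteq> K; \<And>x. x \<in> K \<Longrightarrow> \<beta> x \<in> K; K \<noteq> J\<rbrakk> \<Longrightarrow> \<alpha> ^ 4 - 1 \<in> K"
    and l_notin: "\<alpha> ^ 4 - 1 \<notin> J"
begin

lemma one_notin: "1 \<notin> J"
  using l_notin mult_J[of 1 l] by auto

lemma beta_l: "\<exists>s. \<beta> l \<doteq> l * s"
proof -
  have "\<beta> l = \<beta> \<alpha> ^ 4 - 1" by (simp add: beta_diff beta_power beta_one)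
  also have "\<dots> \<doteq> (\<alpha> ^ (2 * n - 1)) ^ 4 - 1"
    by (intro cg_diff cg_power beta_alpha cg_refl)
  also have "(\<alpha> ^ (2 * n - 1)) ^ 4 - 1 = (\<alpha> ^ 4) ^ (2 * n - 1) - 1"
    by (simp add: mult.commute flip: power_mult)
  also have "\<dots> = l * gsum (2 * n - 1) (\<alpha> ^ 4)"
    by (simp add: gsum_mult)
  finally show ?thesis by blast
qed

text \<open>The ideal qR + J is \<beta>-stable and larger than \<open>J\<close>, so minimality puts
  \<open>l\<close> into it.\<close>

lemma principal:
  assumes "\<beta> q \<doteq> q * s" "q \<notin> J"
  shows "\<exists>r. l \<doteq> q * r"
proof -
  define K where "K = {x. \<exists>r. x \<doteq> q * r}"
  have "l \<in> K"
  proof (rule minimal)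
    show "ring_ideal K"
    proof
      have "0 \<doteq> q * 0" by simp
      then show "0 \<in> K" unfolding K_def by blast
      fix x r assume "x \<in> K"
      then obtain y where "x \<doteq> q * y" unfolding K_def by blast
      then have "r * x \<doteq> q * (r * y)"
        using cg_multl[of x "q * y" r] by (simp add: mult_ac)
      then show "r * x \<in> K" unfolding K_def by blast
    next
      fix x x' assume "x \<in> K" "x' \<in> K"
      then obtain y y' where "x \<doteq> q * y" "x' \<doteq> q * y'" unfolding K_def by blast
      then have "x + x' \<doteq> q * (y + y')"
        using cg_add by (simp add: distrib_left)
      then show "x + x' \<in> K" unfolding K_def by blast
    qed
    show "J \<subseteq> K"
    proof
      fix x assume "x \<in> J"
      then have "x \<doteq> q * 0" by simp
      then show "x \<in> K" unfolding K_def by blast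
    qed
    fix x assume "x \<in> K"
    then obtain y where "x \<doteq> q * y" unfolding K_def by blast
    then have "\<beta> x \<doteq> \<beta> q * \<beta> y" using beta_cong by (simp flip: beta_mult)
    also have "\<dots> \<doteq> (q * s) * \<beta> y" by (rule cg_multr[OF assms(1)])
    also have "\<dots> = q * (s * \<beta> y)" by (simp add: mult_ac)
    finally show "\<beta> x \<in> K" unfolding K_def by blast
  next
    have "q \<doteq> q * 1" by simp
    then have "q \<in> K" unfolding K_def by blast
    with assms show "K \<noteq> J" by blast
  qed
  then show ?thesis unfolding K_def by blast
qed

text \<open>The annihilator of \<open>\<alpha>\<^sup>4 - 1\<close> plays the part of the maximal ideal of a local ring.\<close>

lemma nilpotent_annihilates:
  assumes "\<beta> q \<doteq> q * s" "q ^ N \<in> J"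
  shows "q * l \<in> J"
proof (rule ccontr)
  assume *: "q * l \<notin> J"
  obtain s' where s': "\<beta> l \<doteq> l * s'" using beta_l by blast
  have "\<beta> (q * l) \<doteq> (q * s) * (l * s')"
    unfolding beta_mult by (rule cg_mult[OF assms(1) s'])
  also have "\<dots> = (q * l) * (s * s')" by (simp add: mult_ac)
  \<comment> \<open>\<open>q * l\<close> again generates a stable ideal, which therefore contains
    \<open>l\<close>. Then \<open>l\<close> is fixed by multiplication with the nilpotent
    \<open>r * q\<close>.\<close>
  finally obtain r where r: "l \<doteq> (q * l) * r" using principal * by blast
  also have "(q * l) * r = (r * q) * l" by (simp add: mult_ac)
  finally have "l \<in> J" using nilpotent_fix nilpotent_mult[OF assms(2)] by blast
  with l_notin show False by blast
qed

text \<open>From exponent \<open>k\<close> on the powers of \<open>q\<close> have period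
  \<open>t\<close>, so any exponent that is at least \<open>k\<close> and a multiple of
  \<open>t\<close> will do.\<close>

lemma idempotent_power: "\<exists>N>0. q ^ N * q ^ N \<doteq> q ^ N"
proof -
  obtain k t where t: "t > 0" and *: "q ^ (k + t) \<doteq> q ^ k" using periodic by blast
  have step: "q ^ (M + m * t) \<doteq> q ^ M" if "M \<ge> k" for M m
  proof (induction m)
    case (Suc m)
    have "q ^ (M + Suc m * t) = q ^ (M - k + m * t) * q ^ (k + t)"
      using that by (simp add: algebra_simps flip: power_add)
    also have "\<dots> \<doteq> q ^ (M - k + m * t) * q ^ k" by (rule cg_multl[OF *])
    also have "\<dots> = q ^ (M + m * t)"
      using that by (simp add: algebra_simps flip: power_add)
    also have "\<dots> \<doteq> q ^ M" by (rule Suc)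
    finally show ?case .
  qed simp
  define N where "N = (k + 1) * t"
  have "k + 1 \<le> N" using mult_le_mono2[of 1 t "k + 1"] t by (simp add: N_def)
  then have "q ^ (N + (k + 1) * t) \<doteq> q ^ N" using step[of N "k + 1"] by simp
  then have "q ^ N * q ^ N \<doteq> q ^ N" by (simp add: N_def power_add)
  with \<open>k + 1 \<le> N\<close> show ?thesis by (intro exI[of _ N]) auto
qed

text \<open>Otherwise some idempotent power e of \<open>q\<close> is nontrivial. Both eR and the
  annihilator of e are then nonzero and \<beta>-stable, hence contain \<open>l\<close>, so that l =
  e l = 0. The second hypothesis makes the annihilator stable.\<close>

lemma nilpotent_or_unit:
  assumes "\<beta> q \<doteq> q * s" "q \<doteq> \<beta> q * s'"
  shows "(\<exists>N. q ^ N \<in> J) \<or> (\<exists>u. q * u \<doteq> 1)"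
proof (rule ccontr)
  assume *: "\<not> ?thesis"
  obtain N where N: "N > 0" and idem: "q ^ N * q ^ N \<doteq> q ^ N" using idempotent_power by blast
  define e where "e = q ^ N"
  have idem: "e * e \<doteq> e" using idem by (simp add: e_def)
  have "\<beta> e \<doteq> e * s ^ N"
    using cg_power[OF assms(1), of N] by (simp add: e_def beta_power power_mult_distrib)
  with * obtain r where r: "l \<doteq> e * r" using principal e_def by metis
  have e': "e \<doteq> \<beta> e * s' ^ N"
    using cg_power[OF assms(2), of N] by (simp add: e_def beta_power power_mult_distrib)
  define K where "K = {x. e * x \<in> J}"
  have "l \<in> K"
  proof (rule minimal)
    show "ring_ideal K"
      by unfold_locales (auto simp: K_def zero_J distrib_left mult.left_commute intro: add_J mult_J)
    show "J \<subseteq> K" by (auto simp: K_def mult_J)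
    fix x assume "x \<in> K"
    then have "\<beta> e * \<beta> x \<in> J" using beta_J by (simp add: K_def flip: beta_mult)
    moreover have "e * \<beta> x \<doteq> (\<beta> e * s' ^ N) * \<beta> x" by (rule cg_multr[OF e'])
    ultimately show "\<beta> x \<in> K" unfolding K_def
      using cg_J mult_J[of "\<beta> e * \<beta> x" "s' ^ N"] by (simp add: mult_ac)
  next
    have "e - e * e \<in> J" using cg_sym[OF idem] unfolding cg_def .
    then have "1 - e \<in> K" unfolding K_def by (simp add: algebra_simps)
    moreover have "1 - e \<notin> J"
    proof
      assume "1 - e \<in> J"
      then have "q * q ^ (N - 1) \<doteq> 1"
        using N minus_J[of "1 - e"] by (simp add: e_def cg_def flip: power_Suc)
      with * show False by blast
    qed
    ultimately show "K \<noteq> J" by blast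
  qed
  then have "e * l \<in> J" by (simp add: K_def)
  moreover have "l \<doteq> e * l"
  proof -
    have "l \<doteq> e * r" by (rule r)
    also have "\<dots> \<doteq> (e * e) * r" by (rule cg_multr[OF cg_sym[OF idem]])
    also have "\<dots> = e * (e * r)" by (simp add: mult_ac)
    also have "\<dots> \<doteq> e * l" by (rule cg_multl[OF cg_sym[OF r]])
    finally show ?thesis .
  qed
  ultimately show False using cg_J l_notin by blast
qed

lemma of_nat_nilpotent_or_unit: "(\<exists>N. of_nat m ^ N \<in> J) \<or> (\<exists>u. of_nat m * u \<doteq> 1)"
  by (rule nilpotent_or_unit[of _ 1 1]) (simp_all add: beta_of_nat)

text \<open>A prime divisor of the characteristic is a zero divisor, hence not a unit, hence
  nilpotent.\<close>

lemma nilpotent_prime: "\<exists>p N. Factorial_Ring.prime (p::nat) \<and> of_nat p ^ N \<in> J"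
proof -
  define m where "m = (LEAST m. m > 0 \<and> of_nat m \<in> J)"
  have m: "m > 0 \<and> of_nat m \<in> J" unfolding m_def using torsion by (rule LeastI_ex)
  have least: "m \<le> k" if "k > 0" "of_nat k \<in> J" for k
    unfolding m_def using that by (simp add: Least_le)
  have "m \<noteq> 1" using m one_notin by auto
  then obtain p where p: "Factorial_Ring.prime p" "p dvd m" using prime_factor_nat by blast
  then obtain k where k: "m = p * k" by blast
  have "\<not> (\<exists>u. of_nat p * u \<doteq> 1)"
  proof
    assume "\<exists>u. of_nat p * u \<doteq> 1"
    then obtain u where "of_nat p * u \<doteq> 1" by blast
    moreover have "of_nat p * of_nat k \<in> J" using m k by simp
    ultimately have "of_nat k \<in> J" using unit_cancel by blast
    then have "m \<le> k" using least m k by simp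
    moreover have "k > 0" "p > 1" using m k p prime_gt_1_nat by auto
    ultimately show False using k by simp
  qed
  with of_nat_nilpotent_or_unit p show ?thesis by blast
qed

end

section \<open>The residue characteristic p\<close>

locale minimal_twisted_ring_p = minimal_twisted_ring +
  fixes p :: nat and Np :: nat
  assumes prime_p: "Factorial_Ring.prime p" and nilpotent_p: "of_nat p ^ Np \<in> J"
begin

lemma p_annihilates: "of_nat p * l \<in> J"
  by (rule nilpotent_annihilates[of _ 1, OF _ nilpotent_p]) (simp add: beta_of_nat)

text \<open>For m prime to p, Bezout would write 1 as a combination of the nilpotents q and
  p.\<close>

lemma int_dvd_p:
  assumes "of_int m \<doteq> q * s" "q ^ N \<in> J"
  shows "int p dvd m"
proof (rule ccontr)
  assume "\<not> int p dvd m"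
  then have "coprime (int p) m" using prime_p by (simp add: prime_imp_coprime)
  then obtain u v where uv: "u * m + v * int p = 1"
    using bezout_int[of m "int p"] by (auto simp: coprime_iff_gcd_eq_1 gcd.commute)
  have "of_int u * (q * s) + of_int v * of_nat p \<doteq> of_int u * of_int m + of_int v * of_nat p"
    by (intro cg_add cg_multl cg_sym[OF assms(1)] cg_refl)
  also have "\<dots> = of_int (u * m + v * int p)" by simp
  also have "\<dots> = 1" using uv by simp
  finally have "(of_int u * s) * q + of_int v * of_nat p \<doteq> 1" by (simp add: mult_ac)
  then have "1 \<in> J" by (rule nilpotent_two[OF assms(2) nilpotent_p])
  with one_notin show False by blast
qed

text \<open>Apply \<open>all\<close> to q itself. The expansion of the geometric sum shows that p
  divides t and then, as p is odd, that p divides t choose 2. Hence q lies in pR, so R = Z + p^k R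
  for every k. Thus R is a quotient of Z, and \<open>integral_trivial\<close> applies.\<close>

lemma integral:
  assumes q: "q ^ N \<in> J" and p: "odd p"
    and dec: "\<And>x. \<exists>m s. x \<doteq> of_int m + q * s"
    and all: "\<And>x. \<exists>t. x \<doteq> gsum t (1 + q)"
  shows False
proof -
  obtain t where "q \<doteq> gsum t (1 + q)" using all by blast
  moreover obtain s where "gsum t (1 + q) = of_nat t + of_nat (t choose 2) * q + of_nat (t choose 3) * q ^ 2 + q ^ 3 * s"
    using gsum_expand .
  moreover define r where "r = of_nat (t choose 3) + q * s"
  ultimately have t: "q \<doteq> of_nat t + of_nat (t choose 2) * q + q ^ 2 * r"
    by (simp add: algebra_simps power2_eq_square power3_eq_cube)
  have "of_int (int t) \<doteq> q * (1 - of_nat (t choose 2) - q * r)"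
    using cg_sym[OF t] by (simp add: cg_def algebra_simps power2_eq_square)
  then have "p dvd t" using int_dvd_p q by fastforce
  then obtain t' where t': "t = p * t'" by blast
  have "p dvd (t choose 2)"
  proof -
    have "even (t * (t - 1))" by (cases t) auto
    then have "2 * (t choose 2) = t * (t - 1)" by (simp add: choose_two)
    then have "p dvd 2 * (t choose 2)" using \<open>p dvd t\<close> by simp
    with p show ?thesis by (simp add: coprime_dvd_mult_right_iff)
  qed
  then obtain c where c: "t choose 2 = p * c" by blast
  obtain u where u: "(1 - q * r) * u \<doteq> 1"
    using one_minus_nilpotent_unit nilpotent_mult[OF q, of r] by (auto simp: mult.commute)
  have "(1 - q * r) * q \<doteq> of_nat p * (of_nat t' + of_nat c * q)"
    using t unfolding c unfolding t' by (simp add: cg_def algebra_simps power2_eq_square)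
  from cg_multl[OF this, of u] have *: "u * ((1 - q * r) * q) \<doteq> of_nat p * (u * (of_nat t' + of_nat c * q))"
    by (simp only: mult_ac)
  have "q = 1 * q" by simp
  also have "\<dots> \<doteq> ((1 - q * r) * u) * q" by (rule cg_multr[OF cg_sym[OF u]])
  also have "\<dots> = u * ((1 - q * r) * q)" by (simp add: mult_ac)
  also note *
  finally obtain w where w: "q \<doteq> of_nat p * w" by blast
  \<comment> \<open>Feeding \<open>dec\<close> into itself gains one factor p at a time, because q
    is a multiple of p.\<close>
  have "\<exists>m s. x \<doteq> of_int m + of_nat p ^ k * s" for x k
  proof (induction k)
    case 0
    have "x \<doteq> of_int 0 + of_nat p ^ 0 * x" by simp
    then show ?case by blast
  next
    case (Suc k)
    then obtain m s where 1: "x \<doteq> of_int m + of_nat p ^ k * s" by blast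
    obtain m' s' where 2: "s \<doteq> of_int m' + q * s'" using dec by blast
    note 1
    also have "of_int m + of_nat p ^ k * s \<doteq> of_int m + of_nat p ^ k * (of_int m' + q * s')"
      by (intro cg_add cg_multl 2 cg_refl)
    also have "\<dots> \<doteq> of_int m + of_nat p ^ k * (of_int m' + (of_nat p * w) * s')"
      by (intro cg_add cg_multl cg_multr w cg_refl)
    also have "\<dots> = of_int (m + int p ^ k * m') + of_nat p ^ Suc k * (w * s')"
      by (simp add: algebra_simps)
    finally show ?case by blast
  qed
  then have "\<exists>m. x \<doteq> of_int m" for x
  proof -
    obtain m s where "x \<doteq> of_int m + of_nat p ^ Np * s"
      using \<open>\<And>x k. \<exists>m s. x \<doteq> of_int m + of_nat p ^ k * s\<close> by blast
    also have "of_int m + of_nat p ^ Np * s \<doteq> of_int m + 0"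
      by (intro cg_add cg_refl) (simp add: mult_J' nilpotent_p)
    finally show ?thesis by auto
  qed
  then show False using integral_trivial l_notin by blast
qed

end

context ring_ideal
begin

text \<open>Certificates for congruences: the multipliers are supplied by hand, and only a ring
  identity remains to be checked.\<close>

lemma comb1: "\<lbrakk>x1 \<doteq> y1; x - y = r * (x1 - y1)\<rbrakk> \<Longrightarrow> x \<doteq> y"
  by (simp add: cg_def mult_J)

lemma comb2: "\<lbrakk>x1 \<doteq> y1; x2 \<doteq> y2; x - y = r * (x1 - y1) + s * (x2 - y2)\<rbrakk> \<Longrightarrow> x \<doteq> y"
  by (simp add: cg_def mult_J add_J)

lemma comb3: "\<lbrakk>x1 \<doteq> y1; x2 \<doteq> y2; x3 \<doteq> y3; x - y = r * (x1 - y1) + s * (x2 - y2) + t * (x3 - y3)\<rbrakk> \<Longrightarrow> x \<doteq> y"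
  by (simp add: cg_def mult_J add_J)

text \<open>With \<open>u'\<close> inverse to \<open>u\<close>, this reverses the order of
  summation.\<close>

lemma gsum_reverse:
  assumes "u * u' \<doteq> 1"
  shows "u ^ k * gsum k u' \<doteq> u * gsum k u"
proof (induction k)
  case (Suc k)
  have "(u * u') ^ k \<doteq> 1" using cg_power[OF assms, of k] by simp
  then have "u * (u ^ k * gsum k u') + u * (u * u') ^ k \<doteq> u * (u * gsum k u) + u * 1"
    by (intro cg_add cg_multl Suc)
  then show ?case
    by (simp add: gsum_Suc[of _ u'] gsum_Suc'[of _ u] algebra_simps)
qed simp

end

section \<open>Nilpotency of \<alpha> - 1 and \<gamma> - 1\<close>

context minimal_twisted_ring_p
begin

text \<open>If p divided m, the unit would lie in the ideal generated by the nilpotents q and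
  p.\<close>

lemma unit_not_dvd:
  assumes "x \<doteq> of_int m + q * s" "q ^ N \<in> J" "x * u \<doteq> 1"
  shows "\<not> int p dvd m"
proof
  assume "int p dvd m"
  then obtain k where k: "m = int p * k" by blast
  have "(s * u) * q + (of_int k * u) * of_nat p = (of_int m + q * s) * u"
    unfolding k by (simp add: algebra_simps)
  also have "\<dots> \<doteq> x * u" by (rule cg_multr[OF cg_sym[OF assms(1)]])
  also note assms(3)
  finally have "1 \<in> J" by (rule nilpotent_two[OF assms(2) nilpotent_p])
  with one_notin show False by blast
qed

text \<open>\<beta> \<alpha> is a power of \<alpha> and, since (2n - 1)^2 is 1 modulo 4n, \<alpha>
  is a power of \<beta> \<alpha>. So each of \<alpha> - 1 and \<beta> \<alpha> - 1 divides the
  other.\<close>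

lemma a_stable: "\<exists>s. \<beta> a \<doteq> a * s" "\<exists>s. a \<doteq> \<beta> a * s"
proof -
  have *: "\<beta> a \<doteq> \<alpha> ^ (2 * n - 1) - 1"
    unfolding beta_diff beta_one by (intro cg_diff beta_alpha cg_refl)
  also have "\<dots> = a * gsum (2 * n - 1) \<alpha>" by (simp add: gsum_mult)
  finally show "\<exists>s. \<beta> a \<doteq> a * s" by blast
  have "(2 * n - 1) * (2 * n - 1) = 1 + 4 * n * (n - 1)"
    using n_pos by (cases n) (simp_all add: algebra_simps)
  then have "(\<alpha> ^ (2 * n - 1)) ^ (2 * n - 1) = \<alpha> * (\<alpha> ^ (4 * n)) ^ (n - 1)"
    by (simp flip: power_mult power_add power_Suc)
  also have "\<dots> \<doteq> \<alpha> * 1 ^ (n - 1)"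
    by (intro cg_multl cg_power order_alpha)
  finally have "a \<doteq> (\<alpha> ^ (2 * n - 1)) ^ (2 * n - 1) - 1"
    by (intro cg_diff cg_refl) (simp add: cg_sym)
  also have "\<dots> = (\<alpha> ^ (2 * n - 1) - 1) * gsum (2 * n - 1) (\<alpha> ^ (2 * n - 1))"
    by (simp add: gsum_mult)
  also have "\<dots> \<doteq> \<beta> a * gsum (2 * n - 1) (\<alpha> ^ (2 * n - 1))"
    by (rule cg_multr[OF cg_sym[OF *]])
  finally show "\<exists>s. a \<doteq> \<beta> a * s" by blast
qed

text \<open>If \<alpha> - 1 were a unit, every element would be some \<open>gsum t \<gamma>\<close>.
  This makes \<gamma> - 1 nilpotent. As \<alpha> and \<alpha> - 1 are both units, p is then odd, and
  \<open>integral\<close> gives the contradiction.\<close>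

lemma a_not_unit:
  assumes "a * u \<doteq> 1" shows False
proof -
  have all: "\<exists>t. x \<doteq> gsum t \<gamma>" for x
  proof -
    obtain t where "a * (u * x) \<doteq> gsum t \<gamma>" using closed_gamma by blast
    moreover have "x \<doteq> a * (u * x)"
      using cg_multr[OF cg_sym[OF assms], of x] by (simp add: mult_ac)
    ultimately show ?thesis using cg_trans by blast
  qed
  obtain N where N: "N > 0" "g ^ N * g ^ N \<doteq> g ^ N" using idempotent_power by blast
  have g_nil: "g ^ N \<in> J"
  proof -
    \<comment> \<open>The element is chosen so that multiplication by g gives -g^N = \<gamma>^t - 1.
      As g^N is idempotent, \<gamma>^t then annihilates it.\<close>
    obtain t where t: "- (g ^ (N - 1)) \<doteq> gsum t \<gamma>" using all by blast
    have "g * - (g ^ (N - 1)) \<doteq> g * gsum t \<gamma>" by (rule cg_multl[OF t])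
    also have "\<dots> = \<gamma> ^ t - 1" by (rule gsum_mult)
    also have "g * - (g ^ (N - 1)) = - (g ^ N)"
      using N by (cases N) simp_all
    finally have *: "- (g ^ N) \<doteq> \<gamma> ^ t - 1" .
    have "\<gamma> ^ t * g ^ N \<doteq> 0"
      by (rule comb2[OF * N(2), where r = "- (g ^ N)" and s = "-1"]) (simp add: left_diff_distrib right_diff_distrib mult.commute)
    then have "\<gamma> ^ t * g ^ N \<in> J" by simp
    moreover obtain w where "\<gamma> * w \<doteq> 1" using gamma_unit by blast
    then have "\<gamma> ^ t * w ^ t \<doteq> 1" using cg_power[of "\<gamma> * w" 1 t] by (simp add: power_mult_distrib)
    ultimately show ?thesis using unit_cancel by blast
  qed
  obtain m s where m: "\<alpha> \<doteq> of_int m + g * s" using integer_plus_gamma by blast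
  then have "a \<doteq> of_int (m - 1) + g * s" by (simp add: cg_def algebra_simps)
  then have "\<not> int p dvd m - 1" using unit_not_dvd g_nil assms by blast
  moreover have "\<not> int p dvd m" using unit_not_dvd[OF m g_nil] alpha_unit by blast
  ultimately have "p \<noteq> 2" by (auto simp: even_diff)
  then have "odd p" using prime_p primes_dvd_imp_eq two_is_prime_nat by blast
  then show False using integral[OF g_nil _ integer_plus_gamma] all by simp
qed

lemma a_nilpotent: "\<exists>N. a ^ N \<in> J"
  using nilpotent_or_unit a_stable a_not_unit by metis

lemma a_annihilates: "a * l \<in> J"
  using nilpotent_annihilates a_stable(1) a_nilpotent by blast

definition comm_ideal :: "'a set" where
  "comm_ideal = {x. \<exists>s. x \<doteq> a * g * s}"

lemma ring_ideal_comm_ideal: "ring_ideal comm_ideal"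
proof
  have "0 \<doteq> a * g * 0" by simp
  then show "0 \<in> comm_ideal" unfolding comm_ideal_def by blast
  fix x r assume "x \<in> comm_ideal"
  then obtain s where "x \<doteq> a * g * s" unfolding comm_ideal_def by blast
  then have "r * x \<doteq> a * g * (r * s)"
    using cg_multl[of x "a * g * s" r] by (simp only: mult_ac)
  then show "r * x \<in> comm_ideal" unfolding comm_ideal_def by blast
next
  fix x y assume "x \<in> comm_ideal" "y \<in> comm_ideal"
  then obtain s t where "x \<doteq> a * g * s" "y \<doteq> a * g * t" unfolding comm_ideal_def by blast
  then have "x + y \<doteq> a * g * (s + t)"
    using cg_add by (simp only: distrib_left)
  then show "x + y \<in> comm_ideal" unfolding comm_ideal_def by blast
qed

lemma J_subset_comm_ideal: "J \<subseteq> comm_ideal"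
proof
  fix x assume "x \<in> J"
  then have "x \<doteq> a * g * 0" by simp
  then show "x \<in> comm_ideal" unfolding comm_ideal_def by blast
qed

lemma gamma_integer: "\<exists>s. \<gamma> \<doteq> of_int (int i) + a * s"
proof -
  obtain s where "gsum i (1 + a) = of_nat i + a * s" using gsum_linear .
  then have "gsum i \<alpha> = of_int (int i) + a * s" by simp
  with gamma_eq show ?thesis by metis
qed

lemma p_not_dvd_i: "\<not> p dvd i"
  using gamma_integer a_nilpotent gamma_unit unit_not_dvd by (metis int_dvd_int_iff)

text \<open>Since \<gamma> is \<open>gsum i \<alpha>\<close>, the difference is (\<alpha> -
  1)(\<gamma> - 1) modulo \<open>J\<close>.\<close>

lemma alpha_power_i: "\<alpha> ^ i - \<alpha> \<in> comm_ideal"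
proof -
  have "\<alpha> ^ i - \<alpha> = a * gsum i \<alpha> - a" by (simp add: gsum_mult)
  also have "\<dots> \<doteq> a * \<gamma> - a" by (intro cg_diff cg_multl cg_sym[OF gamma_eq] cg_refl)
  also have "\<dots> = a * g * 1" by (simp add: algebra_simps)
  finally show ?thesis unfolding comm_ideal_def by blast
qed

text \<open>First \<alpha>^(2n) = 1: the nilpotent z = \<alpha>^(2n) - 1 satisfies z(z + 2) = 0, and
  2 is invertible. So \<beta> inverts \<alpha>. As \<alpha>^i is \<alpha> modulo the ideal,
  reversing the sum \<open>gsum i\<close> returns \<gamma>.\<close>

lemma beta_gamma_odd_prime:
  assumes "odd p" shows "\<beta> \<gamma> - \<gamma> \<in> comm_ideal"
proof -
  define z where "z = \<alpha> ^ (2 * n) - 1"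
  have "z * (2 + z) = \<alpha> ^ (4 * n) - 1"
    unfolding z_def by (simp add: algebra_simps flip: power_add)
  then have z2: "z * (2 + z) \<doteq> 0" using order_alpha by (simp add: cg_def)
  \<comment> \<open>Modulo p^Np this is the inverse of 2.\<close>
  define h where "h = (p ^ Np + 1) div 2"
  have "2 * h = p ^ Np + 1" using assms by (simp add: h_def)
  then have h: "2 * of_nat h = (of_nat p ^ Np + 1 :: 'a)"
    by (metis of_nat_1 of_nat_add of_nat_mult of_nat_numeral of_nat_power)
  have "of_nat p ^ Np \<doteq> 0" using nilpotent_p by simp
  then have "z \<doteq> (- of_nat h * z) * z"
  proof (rule comb2[OF z2, where r = "of_nat h" and s = "- z"])
    have "of_nat h * (z * (2 + z) - 0) + - z * (of_nat p ^ Np - 0)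
        = (2 * of_nat h) * z + of_nat h * z * z - z * of_nat p ^ Np"
      by (simp add: algebra_simps)
    then show "z - - of_nat h * z * z = of_nat h * (z * (2 + z) - 0) + - z * (of_nat p ^ Np - 0)"
      unfolding h by (simp add: algebra_simps)
  qed
  moreover have "- of_nat h * z = (- of_nat h * gsum (2 * n) \<alpha>) * a"
    unfolding z_def using gsum_mult[of \<alpha> "2 * n"] by (simp add: mult_ac)
  ultimately have "z \<in> J"
    using a_nilpotent nilpotent_fix nilpotent_mult by metis
  then have z1: "\<alpha> ^ (2 * n) \<doteq> 1" by (simp add: z_def cg_def)
  define d where "d = \<alpha> ^ (2 * n - 1)"
  have "\<alpha> * d = \<alpha> ^ (2 * n)" unfolding d_def using n_pos by (simp flip: power_Suc)
  then have d: "\<alpha> * d \<doteq> 1" using z1 by simp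
  interpret I: ring_ideal comm_ideal by (rule ring_ideal_comm_ideal)
  have JI: "I.cg x y" if "x \<doteq> y" for x y
    using that J_subset_comm_ideal by (auto simp: I.cg_def cg_def)
  have "I.cg (\<alpha> * gsum i d) (\<alpha> ^ i * gsum i d)"
    using alpha_power_i by (intro I.cg_multr[OF I.cg_sym]) (simp add: I.cg_def)
  also have "I.cg (\<alpha> ^ i * gsum i d) (\<alpha> * gsum i \<alpha>)"
    by (rule JI[OF gsum_reverse[OF d]])
  also have "I.cg (\<alpha> * gsum i \<alpha>) (\<alpha> * \<gamma>)"
    by (intro JI cg_multl cg_sym[OF gamma_eq])
  finally have "\<alpha> * (gsum i d - \<gamma>) \<in> comm_ideal"
    by (simp add: I.cg_def right_diff_distrib)
  then have "I.cg (gsum i d) \<gamma>"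
    using I.unit_cancel[OF _ JI[OF d]] by (simp add: I.cg_def)
  moreover have "\<beta> \<gamma> \<doteq> gsum i d"
    using cg_trans[OF beta_cong[OF gamma_eq]] cg_gsum[OF beta_alpha] by (simp add: beta_gsum d_def)
  ultimately show ?thesis using JI I.cg_trans unfolding I.cg_def by blast
qed

text \<open>Here i = 2k + 1 and \<open>gsum i x\<close> is 1 + (x + x^2)
  \<open>gsum k (x ^ 2)\<close>. Modulo the ideal \<alpha>^(2k) = 1, so multiplication by \<alpha>^2
  fixes the inner sum G at x = \<alpha>. The inner sum at x = \<beta> \<alpha> equals G by reversal,
  and \<beta> \<alpha>, an odd power of \<alpha>, acts on G as \<alpha> does.\<close>

lemma beta_gamma_even_prime:
  assumes "p = 2" shows "\<beta> \<gamma> - \<gamma> \<in> comm_ideal"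
proof -
  have "odd i" using p_not_dvd_i assms by simp
  then obtain k where k: "i = Suc (2 * k)" by (auto elim: oddE)
  define G where "G = gsum k (\<alpha> ^ 2)"
  define d where "d = \<alpha> ^ (2 * n - 1)"
  interpret I: ring_ideal comm_ideal by (rule ring_ideal_comm_ideal)
  have JI: "I.cg x y" if "x \<doteq> y" for x y
    using that J_subset_comm_ideal by (auto simp: I.cg_def cg_def)
  have "\<alpha> ^ i - \<alpha> = \<alpha> * ((\<alpha> ^ 2) ^ k - 1)"
    unfolding k power_mult[symmetric] by (simp add: right_diff_distrib)
  then have "\<alpha> * ((\<alpha> ^ 2) ^ k - 1) \<in> comm_ideal"
    using alpha_power_i by simp
  then have uk: "I.cg ((\<alpha> ^ 2) ^ k) 1"
    using I.unit_cancel JI[OF alpha_unit] unfolding I.cg_def[of "(\<alpha> ^ 2) ^ k"] by blast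
  moreover have "\<alpha> ^ 2 * G - G = (\<alpha> ^ 2) ^ k - 1"
    using gsum_mult[of "\<alpha> ^ 2" k] by (simp add: G_def left_diff_distrib)
  ultimately have G: "I.cg (\<alpha> ^ 2 * G) G"
    by (simp add: I.cg_def)
  have Gm: "I.cg ((\<alpha> ^ 2) ^ m * G) G" for m
  proof (induction m)
    case (Suc m)
    have "(\<alpha> ^ 2) ^ Suc m * G = \<alpha> ^ 2 * ((\<alpha> ^ 2) ^ m * G)" by (simp add: mult_ac)
    also have "I.cg \<dots> (\<alpha> ^ 2 * G)" by (rule I.cg_multl[OF Suc])
    also note G
    finally show ?case .
  qed simp
  have "2 + (2 * n - 1) * 2 = 4 * n" using n_pos by simp
  then have "\<alpha> ^ 2 * d ^ 2 = \<alpha> ^ (4 * n)"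
    unfolding d_def power_mult[symmetric] power_add[symmetric] by simp
  then have d2: "\<alpha> ^ 2 * d ^ 2 \<doteq> 1" using order_alpha by simp
  have "I.cg (gsum k (d ^ 2)) ((\<alpha> ^ 2) ^ k * gsum k (d ^ 2))"
    using I.cg_multr[OF uk] I.cg_sym by fastforce
  also have "I.cg \<dots> (\<alpha> ^ 2 * G)"
    unfolding G_def by (rule JI[OF gsum_reverse[OF d2]])
  also note G
  finally have G': "I.cg (gsum k (d ^ 2)) G" .
  have odd_gsum: "gsum i x = 1 + (x + x ^ 2) * gsum k (x ^ 2)" for x :: 'a
    unfolding k gsum_Suc' gsum_double by (simp add: algebra_simps power2_eq_square)
  have dG: "I.cg (d * G) (\<alpha> * G)"
  proof -
    have "d = \<alpha> * (\<alpha> ^ 2) ^ (n - 1)"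
      unfolding d_def power_mult[symmetric] power_Suc[symmetric]
      using n_pos by (cases n) simp_all
    then have "d * G = \<alpha> * ((\<alpha> ^ 2) ^ (n - 1) * G)" by (simp add: mult_ac)
    also have "I.cg \<dots> (\<alpha> * G)" by (rule I.cg_multl[OF Gm])
    finally show ?thesis .
  qed
  have d2G: "I.cg (d ^ 2 * G) (\<alpha> ^ 2 * G)"
  proof -
    have "d ^ 2 * G = (\<alpha> ^ 2) ^ (2 * n - 1) * G"
      unfolding d_def by (simp add: mult.commute flip: power_mult)
    also note Gm
    also note I.cg_sym[OF G]
    finally show ?thesis .
  qed
  have "\<beta> \<gamma> \<doteq> gsum i d"
    using cg_trans[OF beta_cong[OF gamma_eq]] cg_gsum[OF beta_alpha] by (simp add: beta_gsum d_def)
  then have "I.cg (\<beta> \<gamma>) (gsum i d)" by (rule JI)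
  also have "I.cg (gsum i d) (1 + (d + d ^ 2) * G)"
    unfolding odd_gsum by (intro I.cg_add I.cg_multl G' I.cg_refl)
  also have "1 + (d + d ^ 2) * G = 1 + (d * G + d ^ 2 * G)" by (simp add: algebra_simps)
  also have "I.cg \<dots> (1 + (\<alpha> * G + \<alpha> ^ 2 * G))"
    by (intro I.cg_add I.cg_refl dG d2G)
  also have "\<dots> = gsum i \<alpha>" unfolding odd_gsum G_def by (simp add: algebra_simps)
  also have "I.cg (gsum i \<alpha>) \<gamma>" by (rule JI[OF cg_sym[OF gamma_eq]])
  finally show ?thesis by (simp add: I.cg_def)
qed

lemma beta_gamma: "\<beta> \<gamma> - \<gamma> \<in> comm_ideal"
proof (cases "p = 2")
  case False
  then have "odd p" using prime_p primes_dvd_imp_eq two_is_prime_nat by blast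
  then show ?thesis by (rule beta_gamma_odd_prime)
qed (rule beta_gamma_even_prime)

text \<open>The elements fixed modulo the ideal form a subring that contains the generator
  \<gamma>.\<close>

lemma beta_mod_comm_ideal: "\<beta> x - x \<in> comm_ideal"
proof -
  interpret I: ring_ideal comm_ideal by (rule ring_ideal_comm_ideal)
  have JI: "I.cg x y" if "x \<doteq> y" for x y
    using that J_subset_comm_ideal by (auto simp: I.cg_def cg_def)
  have "x \<in> {x. I.cg (\<beta> x) x}"
  proof (rule generated_gamma)
    show "\<gamma> \<in> {x. I.cg (\<beta> x) x}" using beta_gamma by (simp add: I.cg_def)
    fix x y assume "x \<in> {x. I.cg (\<beta> x) x}" "y \<doteq> x"
    then show "y \<in> {x. I.cg (\<beta> x) x}"
      using I.cg_trans[OF JI[OF beta_cong[of y x]]] I.cg_trans[OF _ I.cg_sym[OF JI[of y x]]] by blast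
  qed (auto simp: beta_one beta_add beta_mult beta_minus intro: I.cg_add I.cg_mult I.cg_minus)
  then show ?thesis by (simp add: I.cg_def)
qed

text \<open>\<beta> (\<gamma> - 1) is (\<gamma> - 1)(1 + (\<alpha> - 1)s), whose second factor is a
  unit because \<alpha> - 1 is nilpotent.\<close>

lemma g_stable: "\<exists>s. \<beta> g \<doteq> g * s" "\<exists>s. g \<doteq> \<beta> g * s"
proof -
  obtain s where s: "\<beta> \<gamma> - \<gamma> \<doteq> a * g * s"
    using beta_gamma unfolding comm_ideal_def by blast
  have *: "\<beta> g \<doteq> g * (1 + a * s)"
    using s by (simp add: beta_diff beta_one cg_def algebra_simps)
  then show "\<exists>s. \<beta> g \<doteq> g * s" by blast
  obtain N where "a ^ N \<in> J" using a_nilpotent by blast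
  then obtain u where u: "(1 - (- s * a)) * u \<doteq> 1"
    using one_minus_nilpotent_unit nilpotent_mult by metis
  have "g = g * 1" by simp
  also have "\<dots> \<doteq> g * ((1 - (- s * a)) * u)" by (rule cg_multl[OF cg_sym[OF u]])
  also have "\<dots> = (g * (1 + a * s)) * u" by (simp add: algebra_simps)
  also have "\<dots> \<doteq> \<beta> g * u" by (rule cg_multr[OF cg_sym[OF *]])
  finally show "\<exists>s. g \<doteq> \<beta> g * s" by blast
qed

text \<open>Modulo the nilpotent \<alpha> - 1, \<gamma> is the integer i. If \<gamma> - 1 were a
  unit, i and i - 1 would both be prime to p, so p would be odd and \<open>integral\<close> would
  apply.\<close>

lemma g_not_unit:
  assumes "g * u \<doteq> 1" shows False
proof -
  obtain N where N: "a ^ N \<in> J" using a_nilpotent by blast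
  have all: "\<exists>t. x \<doteq> gsum t \<alpha>" for x
  proof -
    obtain t where "g * (u * x) \<doteq> gsum t \<alpha>" using closed_alpha by blast
    moreover have "x \<doteq> g * (u * x)"
      using cg_multr[OF cg_sym[OF assms], of x] by (simp add: mult_ac)
    ultimately show ?thesis using cg_trans by blast
  qed
  obtain s where s: "\<gamma> \<doteq> of_int (int i) + a * s" using gamma_integer by blast
  then have "g \<doteq> of_int (int i - 1) + a * s" by (simp add: cg_def algebra_simps)
  then have "\<not> int p dvd int i - 1" using unit_not_dvd N assms by blast
  with p_not_dvd_i have "p \<noteq> 2" by (auto simp: even_diff)
  then have "odd p" using prime_p primes_dvd_imp_eq two_is_prime_nat by blast
  then show False using integral[OF N _ integer_plus_alpha] all by simp
qed

lemma g_nilpotent: "\<exists>N. g ^ N \<in> J"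
  using nilpotent_or_unit g_stable g_not_unit by metis

lemma g_annihilates: "g * l \<in> J"
  using nilpotent_annihilates g_stable(1) g_nilpotent by blast

lemma l_in_comm_ideal: "l \<in> comm_ideal"
  by (rule beta_trivial[OF ring_ideal_comm_ideal J_subset_comm_ideal beta_mod_comm_ideal])

text \<open>Expanding l in powers of a = \<alpha> - 1 and using that l lies in agR, 4a equals a
  times an element of the ideal (a, g). As l is a multiple of a, and a and g kill l, this gives 4l =
  0. With p l = 0 and p odd, l = 0.\<close>

lemma not_odd_prime: "p = 2"
proof (rule ccontr)
  assume "p \<noteq> 2"
  then have "odd p" using prime_p primes_dvd_imp_eq two_is_prime_nat by blast
  obtain s where s: "l \<doteq> a * g * s" using l_in_comm_ideal unfolding comm_ideal_def by blast
  define v where "v = 6 + 4 * a + a ^ 2"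
  have l: "l = a * (4 + a * v)"
    by (simp add: v_def algebra_simps power2_eq_square power4_eq_xxxx)
  have fa: "4 * a \<doteq> (s * g - v * a) * a"
    by (rule comb1[OF s, where r = 1]) (simp add: l algebra_simps)
  obtain r where r: "l \<doteq> a * r" using principal a_stable(1) a_nilpotent l_notin mult_J' l by metis
  have "4 * l \<doteq> 4 * (a * r)" by (rule cg_multl[OF r])
  also have "\<dots> = (4 * a) * r" by (simp add: mult_ac)
  also have "\<dots> \<doteq> ((s * g - v * a) * a) * r" by (rule cg_multr[OF fa])
  also have "\<dots> = (s * g - v * a) * (a * r)" by (simp add: mult_ac)
  also have "\<dots> \<doteq> (s * g - v * a) * l" by (rule cg_multl[OF cg_sym[OF r]])
  also have "\<dots> = s * (g * l) - v * (a * l)" by (simp add: algebra_simps)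
  also have "\<dots> \<doteq> 0" using diff_J[OF mult_J[OF g_annihilates] mult_J[OF a_annihilates]] by simp
  finally have 4: "4 * l \<in> J" by simp
  have "coprime (int p) 4"
    using \<open>odd p\<close> by (metis coprime_right_2_iff_odd coprime_power_right_iff even_of_nat numeral_Bit0 one_power2 power2_eq_square mult_2 numeral_2_eq_2 coprime_mult_right_iff mult.commute)
  then obtain c d where cd: "c * 4 + d * int p = 1"
    using bezout_int[of 4 "int p"] by (auto simp: coprime_iff_gcd_eq_1 gcd.commute)
  have "l = of_int (c * 4 + d * int p) * l" using cd by simp
  also have "\<dots> = of_int c * (4 * l) + of_int d * (of_nat p * l)" by (simp add: algebra_simps)
  also have "\<dots> \<doteq> 0" using add_J[OF mult_J[OF 4] mult_J[OF p_annihilates]] by simp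
  finally show False using l_notin by simp
qed

text \<open>2 kills \<open>l\<close> but \<open>l\<close> is not zero, so no odd integer kills
  it.\<close>

lemma annihilates_even:
  assumes "of_int m \<doteq> x" "x * l \<in> J"
  shows "even m"
proof (rule ccontr)
  assume "odd m"
  then obtain k where k: "m = 2 * k + 1" by (elim oddE)
  have "of_int m * l \<doteq> x * l" by (rule cg_multr[OF assms(1)])
  also have "\<dots> \<doteq> 0" using assms(2) by simp
  finally have 1: "of_int m * l \<in> J" by simp
  have "l = of_int m * l - of_int k * (of_nat p * l)"
    unfolding k not_odd_prime by (simp add: algebra_simps)
  then have "l \<in> J" using diff_J[OF 1 mult_J[OF p_annihilates]] by metis
  with l_notin show False by blast
qed

text \<open>A power of 2 vanishes, so odd integers are units modulo \<open>J\<close>.\<close>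

lemma odd_cancel:
  assumes "of_int m * x \<in> J" "odd m" shows "x \<in> J"
proof -
  have "coprime m (2 ^ Np)" using assms(2) by simp
  then obtain c d where cd: "c * m + d * 2 ^ Np = 1"
    using bezout_int[of m "2 ^ Np"] by (auto simp: coprime_iff_gcd_eq_1)
  have "x = of_int (c * m + d * 2 ^ Np) * x" using cd by simp
  also have "\<dots> = of_int c * (of_int m * x) + of_int d * (of_nat p ^ Np * x)"
    unfolding not_odd_prime by (simp add: algebra_simps)
  finally show ?thesis
    using add_J[OF mult_J[OF assms(1)] mult_J[OF mult_J'[OF nilpotent_p]]] by metis
qed

text \<open>Modulo q the sum is the integer t, so t annihilates \<open>l\<close>.\<close>

lemma even_if_annihilated:
  assumes "x \<doteq> gsum t (1 + q)" "x * l \<in> J" "q * l \<in> J" shows "even t"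
proof -
  obtain w where w: "gsum t (1 + q) = of_nat t + q * w" using gsum_linear .
  have "of_int (int t) \<doteq> x - w * q"
    by (rule comb1[OF assms(1), where r = "-1"]) (simp add: w)
  moreover have "(x - w * q) * l \<in> J"
    using diff_J[OF assms(2) mult_J[OF assms(3), of w]] by (simp only: left_diff_distrib mult.assoc)
  ultimately show ?thesis using annihilates_even by fastforce
qed

lemma even_if_closed_alpha:
  assumes "g * x \<doteq> gsum t \<alpha>" shows "even t"
proof (rule even_if_annihilated)
  show "g * x * l \<in> J" using mult_J[OF g_annihilates, of x] by (simp only: mult_ac)
qed (use assms a_annihilates in simp_all)

lemma even_if_closed_gamma:
  assumes "a * x \<doteq> gsum t \<gamma>" shows "even t"
proof (rule even_if_annihilated)
  show "a * x * l \<in> J" using mult_J[OF a_annihilates, of x] by (simp only: mult_ac)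
qed (use assms g_annihilates in simp_all)

section \<open>The contradiction in residue characteristic two\<close>

abbreviation (input) "v \<equiv> \<alpha> ^ 2 - 1"
abbreviation (input) "y \<equiv> \<alpha> + 1"

lemma two_l: "2 * l \<in> J"
  using p_annihilates not_odd_prime by simp

lemma v_l: "v * l \<in> J"
proof -
  have "v * l = y * (a * l)" by (simp add: algebra_simps power2_eq_square)
  then show ?thesis using mult_J a_annihilates by metis
qed

lemma y_l: "y * l \<in> J"
proof -
  have "y * l = a * l + 2 * l" by (simp add: algebra_simps)
  then show ?thesis using add_J a_annihilates two_l by metis
qed

text \<open>\<alpha>^8 - 1 = l^2 + 2l, where l^2 = 0 because l is a multiple of \<alpha> -
  1.\<close>

lemma alpha_8: "\<alpha> ^ 8 \<doteq> 1"
proof -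
  have "\<alpha> ^ 8 - 1 = (\<alpha> ^ 4 - 1) * (\<alpha> ^ 4 - 1) + 2 * l"
    by (simp add: algebra_simps flip: power_add)
  also have "\<dots> = gsum 4 \<alpha> * (a * l) + 2 * l"
    by (simp only: gsum_mult[of \<alpha> 4, symmetric] mult_ac)
  finally show ?thesis
    using add_J[OF mult_J[OF a_annihilates] two_l] unfolding cg_def by metis
qed

text \<open>By \<open>alpha_8\<close> only t modulo 4 matters, and \<alpha>^6 - 1 is v + l because v
  l = 0.\<close>

lemma alpha_powers:
  shows "even t \<Longrightarrow> \<alpha> ^ (2 * t) - 1 \<in> J \<or> \<alpha> ^ (2 * t) - 1 \<doteq> l"
    and "odd t \<Longrightarrow> \<alpha> ^ (2 * t) - 1 \<doteq> v \<or> \<alpha> ^ (2 * t) - 1 \<doteq> v + l"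
proof -
  have red: "\<alpha> ^ (8 * k + m) \<doteq> \<alpha> ^ m" for k m
    using cg_multr[OF cg_power[OF alpha_8, of k], of "\<alpha> ^ m"] by (simp add: power_add power_mult)
  have 6: "\<alpha> ^ 6 - 1 \<doteq> v + l"
    unfolding cg_def using v_l by (simp add: algebra_simps flip: power_add)
  define k where "k = t div 4"
  have t: "t = 4 * k + t mod 4" by (simp add: k_def)
  have *: "\<alpha> ^ (2 * t) - 1 \<doteq> \<alpha> ^ (2 * (t mod 4)) - 1"
    using red[of k "2 * (t mod 4)"] t by (metis cg_diff cg_refl distrib_left mult.assoc mult_2 numeral_Bit0 distrib_right)
  show "\<alpha> ^ (2 * t) - 1 \<in> J \<or> \<alpha> ^ (2 * t) - 1 \<doteq> l" if "even t"
  proof -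
    have "t mod 4 = 0 \<or> t mod 4 = 2" using that by presburger
    then show ?thesis using * by auto
  qed
  show "\<alpha> ^ (2 * t) - 1 \<doteq> v \<or> \<alpha> ^ (2 * t) - 1 \<doteq> v + l" if "odd t"
  proof -
    have "t mod 4 = 1 \<or> t mod 4 = 3" using that by presburger
    then show ?thesis using * cg_trans[OF _ 6] by auto
  qed
qed

lemma l_factor: "l = v * (v + 2)"
  by (simp add: algebra_simps flip: power_add)

text \<open>Multiply by v + 2: the left side becomes a l = 0, the right side l.\<close>

lemma av_not: "\<not> a * v \<doteq> v" "\<not> a * v \<doteq> v + l"
proof -
  have al: "a * v * (v + 2) \<doteq> 0"
    using a_annihilates unfolding l_factor by (simp add: mult_ac)
  show "\<not> a * v \<doteq> v"
  proof
    assume "a * v \<doteq> v"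
    then have "a * v * (v + 2) \<doteq> l" unfolding l_factor by (rule cg_multr)
    with al show False using l_notin cg_J by simp
  qed
  show "\<not> a * v \<doteq> v + l"
  proof
    assume "a * v \<doteq> v + l"
    then have "a * v * (v + 2) \<doteq> (v + l) * (v + 2)" by (rule cg_multr)
    also have "(v + l) * (v + 2) = v * (v + 2) + v * l + 2 * l"
    proof -
      have "(x + z) * (x + 2) = x * (x + 2) + x * z + 2 * z" for x z :: 'a
        by (simp add: algebra_simps)
      then show ?thesis .
    qed
    also have "\<dots> = l + v * l + 2 * l" by (simp only: l_factor[symmetric])
    also have "\<dots> \<doteq> l"
    proof -
      have "l + v * l + 2 * l - l = v * l + 2 * l" by simp
      then show ?thesis using add_J[OF v_l two_l] unfolding cg_def by metis
    qed
    finally show False using al l_notin cg_J by simp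
  qed
qed

text \<open>\<open>closed_alpha\<close> turns elements of agR into powers of \<alpha> minus 1; the
  exponent is even by \<open>even_if_closed_alpha\<close>.\<close>

lemma comm_ideal_power:
  obtains t where "a * (g * x) \<doteq> \<alpha> ^ (2 * t) - 1" "g * x \<doteq> gsum (2 * t) \<alpha>"
proof -
  obtain t where t: "g * x \<doteq> gsum t \<alpha>" using closed_alpha by blast
  then obtain k where k: "t = 2 * k" using even_if_closed_alpha by blast
  have "a * (g * x) \<doteq> a * gsum t \<alpha>" by (rule cg_multl[OF t])
  also have "\<dots> = \<alpha> ^ t - 1" by (rule gsum_mult)
  finally show ?thesis using that t k by blast
qed

lemma n_even: "even n"
proof (rule ccontr)
  assume "odd n"
  then obtain m where "n = 2 * m + 1" by (elim oddE)
  then have "4 * n = 8 * m + 4" by simp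
  then have "\<alpha> ^ (4 * n) = (\<alpha> ^ 8) ^ m * \<alpha> ^ 4" by (simp add: power_add power_mult)
  also have "\<dots> \<doteq> 1 ^ m * \<alpha> ^ 4" by (intro cg_multr cg_power alpha_8)
  also have "\<dots> = \<alpha> ^ 4" by simp
  finally have "\<alpha> ^ 4 \<doteq> 1" using order_alpha cg_sym cg_trans by blast
  with l_notin show False by (simp add: cg_def)
qed

lemma alpha_power_r: "\<alpha> ^ (2 * n - 2) - 1 \<doteq> v \<or> \<alpha> ^ (2 * n - 2) - 1 \<doteq> v + l"
proof -
  have "odd (n - 1)" using n_even n_pos by simp
  moreover have "2 * n - 2 = 2 * (n - 1)" by simp
  ultimately show ?thesis using alpha_powers(2) by metis
qed

lemma alpha_r: "\<alpha> ^ (2 * n - 1) = \<alpha> * \<alpha> ^ (2 * n - 2)"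
proof -
  have "2 * n - 1 = Suc (2 * n - 2)" using n_pos by simp
  then show ?thesis by (metis power_Suc)
qed

text \<open>Triviality of \<beta> modulo \<open>comm_ideal\<close> puts \<alpha>(\<alpha>^(2n-2) -
  1) there, which by \<open>alpha_power_r\<close> is \<alpha> times v or v + l.\<close>

lemma v_in_comm_ideal: "\<exists>s. v \<doteq> a * (g * s)"
proof -
  obtain s where "\<beta> \<alpha> - \<alpha> \<doteq> a * g * s"
    using beta_mod_comm_ideal unfolding comm_ideal_def by blast
  moreover have "\<alpha> ^ (2 * n - 1) - \<alpha> \<doteq> \<beta> \<alpha> - \<alpha>"
    by (intro cg_diff cg_sym[OF beta_alpha] cg_refl)
  ultimately have s: "\<alpha> * (\<alpha> ^ (2 * n - 2) - 1) \<doteq> a * (g * s)"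
    unfolding alpha_r by (metis cg_trans mult.assoc mult.right_neutral right_diff_distrib)
  have "\<exists>w. v \<doteq> (\<alpha> ^ (2 * n - 2) - 1) * w"
    using alpha_power_r
  proof
    assume "\<alpha> ^ (2 * n - 2) - 1 \<doteq> v"
    from cg_sym[OF this] show ?thesis by (metis mult.right_neutral)
  next
    assume *: "\<alpha> ^ (2 * n - 2) - 1 \<doteq> v + l"
    \<comment> \<open>In this case v is recovered as (v + l)(-\<alpha>^2), since v(1 + \<alpha>^2) =
      l and 2l = v l = 0.\<close>
    have "v - (v + l) * - (\<alpha> ^ 2) = 2 * l + v * l"
      by (simp add: algebra_simps flip: power_add)
    then have "v \<doteq> (v + l) * - (\<alpha> ^ 2)"
      using add_J[OF two_l v_l] unfolding cg_def by metis
    also have "\<dots> \<doteq> (\<alpha> ^ (2 * n - 2) - 1) * - (\<alpha> ^ 2)" by (rule cg_multr[OF cg_sym[OF *]])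
    finally show ?thesis by blast
  qed
  then obtain w where w: "v \<doteq> (\<alpha> ^ (2 * n - 2) - 1) * w" by blast
  define \<alpha>' where "\<alpha>' = \<alpha> ^ (4 * n - 1)"
  have "v \<doteq> (\<alpha> ^ (2 * n - 2) - 1) * w" by (rule w)
  also have "\<dots> = 1 * ((\<alpha> ^ (2 * n - 2) - 1) * w)" by simp
  also have "\<dots> \<doteq> (\<alpha> * \<alpha>') * ((\<alpha> ^ (2 * n - 2) - 1) * w)"
    unfolding \<alpha>'_def by (rule cg_multr[OF cg_sym[OF alpha_unit]])
  also have "\<dots> = (\<alpha> * (\<alpha> ^ (2 * n - 2) - 1)) * (w * \<alpha>')" by (simp add: mult_ac)
  also have "\<dots> \<doteq> (a * (g * s)) * (w * \<alpha>')" by (rule cg_multr[OF s])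
  also have "\<dots> = a * (g * (s * w * \<alpha>'))" by (simp add: mult_ac)
  finally show ?thesis by blast
qed

text \<open>\<open>gsum (2 * t) \<alpha>\<close> is y times \<open>gsum t (\<alpha> ^ 2)\<close>,
  and \<alpha>^2 = 1 + v with v^2 = 0.\<close>

lemma linear_in_y:
  assumes "v * v \<in> J" "x \<doteq> gsum (2 * t) \<alpha>"
  shows "\<exists>c. x \<doteq> of_nat t * y + of_nat c * (y * v)"
proof -
  define V where "V = v"
  obtain w where w: "gsum t (1 + V) = of_nat t + of_nat (t choose 2) * V + of_nat (t choose 3) * V ^ 2 + V ^ 3 * w"
    using gsum_expand .
  have "gsum (2 * t) \<alpha> = y * gsum t (1 + V)"
    unfolding gsum_double V_def by (simp add: add.commute)
  also have "\<dots> - (of_nat t * y + of_nat (t choose 2) * (y * V)) = (y * (of_nat (t choose 3) + V * w)) * (V * V)"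
    unfolding w by (simp add: algebra_simps power2_eq_square power3_eq_cube)
  finally have "gsum (2 * t) \<alpha> \<doteq> of_nat t * y + of_nat (t choose 2) * (y * v)"
    using mult_J[OF assms(1)] unfolding V_def by (metis cg_def)
  with assms(2) show ?thesis using cg_trans by blast
qed

lemma even_l: "even m \<Longrightarrow> of_int m * l \<in> J"
  using mult_J[OF two_l] by (auto elim!: evenE simp: mult_ac)

text \<open>One exponent t does both jobs: v = g(a s0) is \<open>gsum (2 * t) \<alpha>\<close>, and
  a v is \<alpha>^(2t) - 1. By \<open>av_not\<close> t is even, so a v is 0 or l.\<close>

lemma l_linear:
  obtains s0 t2 \<kappa> where "v \<doteq> a * (g * s0)" "v \<doteq> gsum (2 * t2) \<alpha>" "even t2" "a * v \<doteq> of_int \<kappa> * l"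
proof -
  obtain s0 where s0: "v \<doteq> a * (g * s0)" using v_in_comm_ideal by blast
  obtain t where t: "a * (g * (a * s0)) \<doteq> \<alpha> ^ (2 * t) - 1" "g * (a * s0) \<doteq> gsum (2 * t) \<alpha>"
    using comm_ideal_power .
  have "a * v \<doteq> a * (a * (g * s0))" by (rule cg_multl[OF s0])
  also have "\<dots> = a * (g * (a * s0))" by (simp add: mult_ac)
  also note t(1)
  finally have av: "a * v \<doteq> \<alpha> ^ (2 * t) - 1" .
  then have even: "even t" using av_not alpha_powers(2) cg_trans by blast
  then have "a * v \<doteq> of_int 0 * l \<or> a * v \<doteq> of_int 1 * l"
    using alpha_powers(1)[OF even] cg_trans[OF av] cg_J[OF av] by auto
  moreover have "v \<doteq> g * (a * s0)" using s0 by (simp only: mult.left_commute)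
  ultimately show ?thesis using that s0 even cg_trans[OF _ t(2)] by blast
qed

text \<open>The relevant elements are integer multiples of y = \<alpha> + 1: v = t0 y, g = t1 y and
  l = 2v = 4y. Applying \<beta> to such relations controls coefficients modulo 4. Expanding v = a y
  as a sum \<open>gsum t \<gamma>\<close> finally gives 4y = 0.\<close>

lemma contradiction: False
proof -
  obtain s0 t2 \<kappa>2 where s0: "v \<doteq> a * (g * s0)" and t2: "v \<doteq> gsum (2 * t2) \<alpha>" "even t2"
    and av: "a * v \<doteq> of_int \<kappa>2 * l"
    using l_linear .
  have vv: "v * v \<in> J"
  proof -
    have "v * v = y * (a * v)" by (simp add: algebra_simps power2_eq_square)
    also have "\<dots> \<doteq> y * (of_int \<kappa>2 * l)" by (rule cg_multl[OF av])
    also have "\<dots> = of_int \<kappa>2 * (y * l)" by (simp add: mult_ac)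
    also have "\<dots> \<doteq> 0" using mult_J[OF y_l] by simp
    finally show ?thesis by simp
  qed
  have l2v: "l \<doteq> 2 * v"
  proof -
    have "l - 2 * v = v * v" by (simp add: algebra_simps flip: power_add)
    then show ?thesis using vv by (simp add: cg_def)
  qed
  have v_mult: "4 dvd m" if "of_int m * v \<in> J" for m
  proof (rule ccontr)
    assume "\<not> 4 dvd m"
    show False
    proof (cases "even m")
      case False
      then have "2 * v \<in> J" using odd_cancel that mult_J by blast
      then show False using l2v cg_J l_notin by blast
    next
      case True
      then obtain m' where m': "m = 2 * m'" by (elim evenE)
      have "of_int m' * (2 * v) \<in> J" using that unfolding m' by (simp add: mult_ac)
      moreover have "odd m'" using \<open>\<not> 4 dvd m\<close> m' by auto
      ultimately have "2 * v \<in> J" using odd_cancel by blast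
      then show False using l2v cg_J l_notin by blast
    qed
  qed
  have l_mult: "even m" if "of_int m * l \<in> J" for m
    using odd_cancel that l_notin by blast
  have yv: "y * v \<doteq> of_int (\<kappa>2 + 1) * l"
  proof -
    have "y * v - of_int (\<kappa>2 + 1) * l = 1 * (a * v - of_int \<kappa>2 * l) + (- 1) * (l - 2 * v)"
      by (simp add: algebra_simps)
    then show ?thesis by (rule comb2[OF av l2v])
  qed
  obtain t0 where t0: "even t0" "v \<doteq> of_int t0 * y"
  proof -
    obtain c where "v \<doteq> of_nat t2 * y + of_nat c * (y * v)" using linear_in_y[OF vv t2(1)] by blast
    also have "of_nat t2 * y + of_nat c * (y * v) \<doteq> of_nat t2 * y + of_nat c * (of_int (\<kappa>2 + 1) * l)"
      by (intro cg_add cg_multl yv cg_refl)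
    also have "\<dots> = of_int (int t2) * y + of_int (int c * (\<kappa>2 + 1)) * l" by (simp add: mult_ac)
    finally have *: "v \<doteq> of_int (int t2) * y + of_int (int c * (\<kappa>2 + 1)) * l" .
    show ?thesis
    proof (cases "even (int c * (\<kappa>2 + 1))")
      case True
      then have "of_int (int c * (\<kappa>2 + 1)) * l \<doteq> 0" unfolding cg_0 by (rule even_l)
      then have "v \<doteq> of_int (int t2) * y + 0"
        using cg_trans[OF * cg_add[OF cg_refl]] by blast
      then show ?thesis using that[of "int t2"] t2(2) by simp
    next
      case False
      then obtain d where d: "int c * (\<kappa>2 + 1) = 2 * d + 1" by (elim oddE)
      \<comment> \<open>An odd multiple of l is l = 2v, so v = t2 y + 2v, and the sign of t2
        flips.\<close>
      have "v \<doteq> of_int (- int t2) * y"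
      proof (rule comb3[OF * l2v, where r = "-1" and s = "-1" and t = "- of_int d" and ?x3.0 = "2 * l" and ?y3.0 = 0])
        show "2 * l \<doteq> 0" using two_l by simp
      qed (unfold d, simp add: algebra_simps)
      then show ?thesis using that[of "- int t2"] t2(2) by simp
    qed
  qed
  obtain \<kappa>1 where \<kappa>1: "\<alpha> ^ (2 * n - 2) - 1 \<doteq> v + of_int \<kappa>1 * l"
  proof -
    from alpha_power_r have "\<alpha> ^ (2 * n - 2) - 1 \<doteq> v + of_int 0 * l \<or> \<alpha> ^ (2 * n - 2) - 1 \<doteq> v + of_int 1 * l"
      by simp
    with that show ?thesis by blast
  qed
  define \<kappa> where "\<kappa> = \<kappa>1 + \<kappa>2"
  have beta_y: "\<beta> y \<doteq> y + v + of_int \<kappa> * l"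
  proof -
    have "\<beta> y = \<beta> \<alpha> + 1" by (simp add: beta_add beta_one)
    also have "\<dots> \<doteq> \<alpha> ^ (2 * n - 1) + 1" by (intro cg_add beta_alpha cg_refl)
    also have "\<alpha> ^ (2 * n - 1) + 1 \<doteq> y + v + of_int \<kappa> * l"
    proof (rule comb3[OF \<kappa>1 av, where r = \<alpha> and s = 1 and t = "of_int \<kappa>1" and ?x3.0 = "a * l" and ?y3.0 = 0])
      show "a * l \<doteq> 0" using a_annihilates by simp
    qed (unfold alpha_r \<kappa>_def, simp add: algebra_simps)
    finally show ?thesis .
  qed
  have beta_v: "\<beta> v \<doteq> v + l"
  proof -
    have "\<beta> v = (\<beta> \<alpha>) ^ 2 - 1" by (simp add: beta_diff beta_power beta_one)
    also have "\<dots> \<doteq> (\<alpha> ^ (2 * n - 1)) ^ 2 - 1" by (intro cg_diff cg_power beta_alpha cg_refl)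
    also have "(\<alpha> ^ (2 * n - 1)) ^ 2 - 1 = \<alpha> ^ (2 * (2 * n - 1)) - 1" by (simp add: mult.commute flip: power_mult)
    finally have *: "\<beta> v \<doteq> \<alpha> ^ (2 * (2 * n - 1)) - 1" .
    have "odd (2 * n - 1)" using n_pos by simp
    then consider "\<alpha> ^ (2 * (2 * n - 1)) - 1 \<doteq> v" | "\<alpha> ^ (2 * (2 * n - 1)) - 1 \<doteq> v + l"
      using alpha_powers(2) by blast
    then show ?thesis
    proof cases
      case 1
      then have "\<alpha> ^ (2 * (2 * n - 1)) \<doteq> \<alpha> ^ 2" by (simp add: cg_def)
      then have "\<alpha> ^ 2 * \<alpha> ^ (2 * (2 * n - 1)) \<doteq> \<alpha> ^ 2 * \<alpha> ^ 2" by (rule cg_multl)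
      moreover have "2 + 2 * (2 * n - 1) = 4 * n" using n_pos by simp
      then have "\<alpha> ^ 2 * \<alpha> ^ (2 * (2 * n - 1)) = \<alpha> ^ (4 * n)" by (metis power_add)
      moreover have "\<alpha> ^ 2 * \<alpha> ^ 2 = \<alpha> ^ 4" by (simp flip: power_add)
      ultimately have "\<alpha> ^ 4 \<doteq> 1" using order_alpha cg_sym cg_trans by metis
      with l_notin show ?thesis by (simp add: cg_def)
    next
      case 2
      with * show ?thesis using cg_trans by blast
    qed
  qed
  have two_l0: "2 * l \<doteq> 0" using two_l by simp
  \<comment> \<open>Applying \<beta> to v = t0 y gives l = t0 v = (t0 / 2) l, so t0 / 2 is
    odd.\<close>
  obtain k where k: "t0 = 4 * k + 2"
  proof -
    obtain m0 where m0: "t0 = 2 * m0" using t0(1) by (elim evenE)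
    have "v + l \<doteq> \<beta> (of_int t0 * y)"
      using cg_trans[OF cg_sym[OF beta_v] beta_cong[OF t0(2)]] .
    also have "\<beta> (of_int t0 * y) = of_int t0 * \<beta> y" by (simp add: beta_mult beta_of_int)
    also have "\<dots> \<doteq> of_int t0 * (y + v + of_int \<kappa> * l)" by (rule cg_multl[OF beta_y])
    finally have 1: "v + l \<doteq> of_int t0 * (y + v + of_int \<kappa> * l)" .
    have "l \<doteq> of_int t0 * v"
      by (rule comb3[OF 1 t0(2) two_l0, where r = 1 and s = "-1" and t = "of_int (m0 * \<kappa>)"])
         (simp add: m0 algebra_simps)
    also have "of_int t0 * v \<doteq> of_int m0 * l"
      by (rule comb1[OF l2v, where r = "- of_int m0"]) (simp add: m0 algebra_simps)
    finally have 2: "l \<doteq> of_int m0 * l" .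
    have "odd m0"
    proof
      assume "even m0"
      then have "l \<in> J" using even_l cg_J[OF 2] by blast
      with l_notin show False by blast
    qed
    then obtain k where "m0 = 2 * k + 1" by (elim oddE)
    then show ?thesis using that[of k] m0 by simp
  qed
  have yv0: "y * v \<in> J"
  proof -
    have "l \<doteq> of_int t0 * v"
      by (rule comb2[OF l2v two_l0, where r = "of_int (2 * k + 1)" and s = "- of_int k"]) (simp add: k algebra_simps)
    moreover have "y * v \<doteq> y * (of_int t0 * y)" by (rule cg_multl[OF t0(2)])
    ultimately have "y * v \<doteq> l + 2 * v"
      by (rule comb3[OF _ _ t0(2), where r = "-1" and s = 1 and t = "-2"]) (simp add: algebra_simps power2_eq_square)
    then have "y * v \<doteq> 0"
      by (rule comb3[OF _ l2v two_l0, where r = 1 and s = "-1" and t = 1]) (simp add: algebra_simps)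
    then show ?thesis by simp
  qed
  have l_y: "l \<doteq> of_int (8 * k + 4) * y"
    by (rule comb2[OF l2v t0(2), where r = 1 and s = 2]) (simp add: k algebra_simps)
  have y8: "8 * y \<doteq> 0"
  proof -
    have "of_int (2 * k + 1) * (8 * y) \<doteq> 0"
      by (rule comb2[OF l_y two_l0, where r = "-2" and s = 1]) (simp add: algebra_simps)
    then show ?thesis using odd_cancel[of "2 * k + 1" "8 * y"] by simp
  qed
  have y4: "l \<doteq> 4 * y"
    by (rule comb2[OF l_y y8, where r = 1 and s = "of_int k"]) (simp add: algebra_simps)
  have yy: "y * y \<doteq> of_int (k + 1) * l"
    by (rule comb2[OF t0(2) y4, where r = 1 and s = "- of_int (k + 1)"]) (simp add: k algebra_simps power2_eq_square)
  \<comment> \<open>For an even coefficient, a g would be a multiple of l, and then v = a g s0 would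
    give l = 2v = 0.\<close>
  obtain t1 where t1: "odd t1" "g \<doteq> of_int t1 * y"
  proof -
    obtain t where t: "a * (g * 1) \<doteq> \<alpha> ^ (2 * t) - 1" "g * 1 \<doteq> gsum (2 * t) \<alpha>"
      using comm_ideal_power .
    obtain c where "g * 1 \<doteq> of_nat t * y + of_nat c * (y * v)" using linear_in_y[OF vv t(2)] by blast
    then have "g \<doteq> of_int (int t) * y"
      by (rule comb2[where r = 1 and s = "of_nat c" and ?x2.0 = "y * v" and ?y2.0 = 0]) (use yv0 in \<open>simp_all\<close>)
    moreover have "odd t"
    proof
      assume "even t"
      then have "a * (g * 1) \<doteq> 0 \<or> a * (g * 1) \<doteq> l"
        using alpha_powers(1)[of t] cg_trans[OF t(1)] cg_J[OF t(1)] by auto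
      then obtain d where d: "a * (g * 1) \<doteq> of_int d * l" by (metis mult_zero_left of_int_0 of_int_1 mult_1)
      have "l \<doteq> 0"
        by (rule comb3[OF s0 d two_l0, THEN cg_trans[rotated], where r1 = 2 and s1 = "2 * s0" and t1 = "of_int d * s0"])
           (use l2v in \<open>simp_all add: algebra_simps\<close>)
      with l_notin show False by simp
    qed
    ultimately show ?thesis using that[of "int t"] by simp
  qed
  have gg: "g * g \<doteq> of_int (t1 * t1 * (k + 1)) * l"
  proof -
    have "g * g \<doteq> (of_int t1 * y) * (of_int t1 * y)" by (rule cg_mult[OF t1(2) t1(2)])
    then show ?thesis
      by (rule comb2[OF _ yy, where r = 1 and s = "of_int (t1 * t1)"]) (simp add: algebra_simps)
  qed
  have ggg: "g * g * g \<doteq> 0"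
    by (rule comb2[OF gg, where r = g and s = "of_int (t1 * t1 * (k + 1))" and ?x2.0 = "g * l" and ?y2.0 = 0])
       (use g_annihilates in \<open>simp_all add: mult_ac right_diff_distrib left_diff_distrib\<close>)
  \<comment> \<open>Here a y = v. Since g^3 = 0, the expansion of this sum in g stops after the
    quadratic term.\<close>
  obtain t where t: "a * y \<doteq> gsum t \<gamma>" using closed_gamma by blast
  then obtain \<tau> where \<tau>: "t = 2 * \<tau>" using even_if_closed_gamma by blast
  define C where "C = int (t choose 2)"
  define D where "D = int (t choose 3) * (t1 * t1 * (k + 1))"
  obtain w where w: "gsum t (1 + g) = of_nat t + of_nat (t choose 2) * g + of_nat (t choose 3) * g ^ 2 + g ^ 3 * w"
    using gsum_expand .
  have exp: "v \<doteq> of_int (int t) + of_int C * g + of_int D * l"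
  proof (rule comb3[OF t gg ggg, where r = 1 and s = "of_nat (t choose 3)" and t = w])
    have "v = a * y" by (simp add: algebra_simps power2_eq_square)
    then show "v - (of_int (int t) + of_int C * g + of_int D * l) = 1 * (a * y - gsum t \<gamma>)
        + of_nat (t choose 3) * (g * g - of_int (t1 * t1 * (k + 1)) * l) + w * (g * g * g - 0)"
      using w by (simp add: C_def D_def power2_eq_square power3_eq_cube right_diff_distrib mult_ac)
  qed
  have beta_l: "\<beta> l \<doteq> l"
  proof -
    have "\<beta> l \<doteq> \<beta> (2 * v)" by (rule beta_cong[OF l2v])
    also have "\<beta> (2 * v) = \<beta> (of_nat 2) * \<beta> v" by (simp only: beta_mult of_nat_numeral)
    also have "\<dots> = 2 * \<beta> v" using beta_of_nat[of 2] by (simp only: of_nat_numeral)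
    also have "\<dots> \<doteq> 2 * (v + l)" by (rule cg_multl[OF beta_v])
    also have "\<dots> \<doteq> l" by (rule comb2[OF l2v two_l0, where r = "-1" and s = 1]) (simp add: algebra_simps)
    finally show ?thesis .
  qed
  have beta_g: "\<beta> g \<doteq> g + of_int t1 * v + of_int (t1 * \<kappa>) * l"
  proof -
    have "\<beta> g \<doteq> \<beta> (of_int t1 * y)" by (rule beta_cong[OF t1(2)])
    also have "\<dots> = of_int t1 * \<beta> y" by (simp add: beta_mult beta_of_int)
    also have "\<dots> \<doteq> of_int t1 * (y + v + of_int \<kappa> * l)" by (rule cg_multl[OF beta_y])
    also have "\<dots> \<doteq> g + of_int t1 * v + of_int (t1 * \<kappa>) * l"
      by (rule comb1[OF t1(2), where r = "-1"]) (simp add: algebra_simps)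
    finally show ?thesis .
  qed
  have "v + l \<doteq> \<beta> (of_int (int t) + of_int C * g + of_int D * l)"
    using cg_trans[OF cg_sym[OF beta_v] beta_cong[OF exp]] .
  also have "\<dots> = of_int (int t) + of_int C * \<beta> g + of_int D * \<beta> l"
    by (simp only: beta_mult beta_of_int beta_add)
  also have "\<dots> \<doteq> of_int (int t) + of_int C * (g + of_int t1 * v + of_int (t1 * \<kappa>) * l) + of_int D * l"
    by (intro cg_add cg_multl beta_g beta_l cg_refl)
  finally have *: "v + l \<doteq> of_int (int t) + of_int C * (g + of_int t1 * v + of_int (t1 * \<kappa>) * l) + of_int D * l" .
  \<comment> \<open>Subtracting \<open>exp\<close> from its image under \<beta> leaves 2v = C t1 (1
    + 2\<kappa>) v, so C is 2 modulo 4.\<close>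
  have "of_int (C * t1 * (1 + 2 * \<kappa>) - 2) * v \<doteq> 0"
    by (rule comb3[OF * exp l2v, where r = "-1" and s = 1 and t = "1 - of_int (C * t1 * \<kappa>)"]) (simp add: algebra_simps)
  then have dvd: "4 dvd C * t1 * (1 + 2 * \<kappa>) - 2" using v_mult by simp
  have "even C"
  proof (rule ccontr)
    assume "odd C"
    then have "odd (C * t1 * (1 + 2 * \<kappa>) - 2)" using t1(1) by simp
    with dvd show False by (meson dvd_trans even_numeral)
  qed
  moreover have "\<not> 4 dvd C"
  proof
    assume "4 dvd C"
    then have "4 dvd C * t1 * (1 + 2 * \<kappa>)" by (simp add: mult.assoc)
    from dvd_diff[OF this dvd] show False by simp
  qed
  moreover have "C = int \<tau> * (2 * int \<tau> - 1)"
    unfolding C_def \<tau> choose_two by (cases \<tau>) (simp_all add: algebra_simps)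
  ultimately have "even (int \<tau>)" "\<not> 4 dvd int \<tau>" by auto
  then obtain \<sigma> where "int \<tau> = 2 * \<sigma>" by (elim evenE)
  with \<open>\<not> 4 dvd int \<tau>\<close> have \<sigma>: "int \<tau> = 2 * \<sigma>" "odd \<sigma>" by presburger+
  obtain C' where C': "C = 2 * C'" using \<open>even C\<close> by (elim evenE)
  \<comment> \<open>After multiplication of \<open>exp\<close> by y every term vanishes except t y =
    4 \<sigma> y.\<close>
  have 1: "y * v \<doteq> y * (of_int (int t) + of_int C * g + of_int D * l)" by (rule cg_multl[OF exp])
  have yg: "y * g \<doteq> of_int (t1 * (k + 1)) * l"
    by (rule comb2[OF t1(2) yy, where r = y and s = "of_int t1"]) (simp add: algebra_simps)
  have "y * (of_int (int t) + of_int C * g + of_int D * l) \<doteq> 0"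
    using cg_J[OF 1] yv0 by (simp only: cg_0)
  then have "of_int (int t) * y + of_int C * (y * g) \<doteq> 0"
    by (rule comb2[where r = 1 and s = "- of_int D" and ?x2.0 = "y * l" and ?y2.0 = 0])
       (use y_l in \<open>simp_all add: algebra_simps\<close>)
  then have "of_int (int t) * y \<doteq> 0"
    by (rule comb3[OF _ yg two_l0, where r = 1 and s = "- of_int C" and t = "- of_int (C' * (t1 * (k + 1)))"])
       (simp add: C' algebra_simps)
  then have "of_int \<sigma> * (4 * y) \<in> J" unfolding \<tau> using \<sigma>(1) by (simp add: mult_ac)
  then have "4 * y \<in> J" using odd_cancel \<sigma>(2) by blast
  then show False using cg_J[OF y4] l_notin by blast
qed

end

lemma (in minimal_twisted_ring) contradiction: False
proof -
  obtain p N where "Factorial_Ring.prime (p::nat)" "of_nat p ^ N \<in> J" using nilpotent_prime by blast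
  then interpret minimal_twisted_ring_p J \<alpha> \<gamma> \<beta> n i j p N by unfold_locales
  show False by (rule contradiction)
qed

text \<open>Zorn's lemma reduces the claim to the case that \<open>\<alpha>\<^sup>4 - 1\<close> lies in every nonzero
  \<open>\<beta>\<close>-stable ideal, since all other assumptions pass to larger \<open>\<beta>\<close>-stable ideals.\<close>

theorem (in twisted_ring) alpha_4: "\<alpha> ^ 4 - 1 \<in> J"
proof (rule ccontr)
  assume l: "\<alpha> ^ 4 - 1 \<notin> J"
  define S where "S = {K. ring_ideal K \<and> J \<subseteq> K \<and> (\<forall>x\<in>K. \<beta> x \<in> K) \<and> \<alpha> ^ 4 - 1 \<notin> K}"
  have "J \<in> S" unfolding S_def using l ring_ideal_axioms beta_J by blast
  have "\<exists>M\<in>S. \<forall>L\<in>S. M \<subseteq> L \<longrightarrow> L = M"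
  proof (rule subset_Zorn_nonempty)
    show "S \<noteq> {}" using \<open>J \<in> S\<close> by blast
    fix C assume C: "C \<noteq> {}" "subset.chain S C"
    then have CS: "K \<in> S" if "K \<in> C" for K
      using that by (auto simp: subset_chain_def)
    show "\<Union>C \<in> S"
      unfolding S_def
    proof (intro CollectI conjI)
      show "ring_ideal (\<Union>C)"
      proof
        show "0 \<in> \<Union>C" using C(1) CS unfolding S_def ring_ideal_def by blast
        fix x r assume "x \<in> \<Union>C"
        then show "r * x \<in> \<Union>C" using CS unfolding S_def ring_ideal_def by blast
      next
        fix x z assume "x \<in> \<Union>C" "z \<in> \<Union>C"
        then obtain K K' where K: "K \<in> C" "K' \<in> C" "x \<in> K" "z \<in> K'" by blast
        then have "K \<subseteq> K' \<or> K' \<subseteq> K" using C(2) by (auto simp: subset_chain_def)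
        then show "x + z \<in> \<Union>C" using K CS unfolding S_def ring_ideal_def by blast
      qed
      show "J \<subseteq> \<Union>C" using C(1) CS unfolding S_def by blast
      show "\<forall>x\<in>\<Union>C. \<beta> x \<in> \<Union>C" using CS unfolding S_def by blast
      show "\<alpha> ^ 4 - 1 \<notin> \<Union>C" using CS unfolding S_def by blast
    qed
  qed
  then obtain K where K: "K \<in> S" and maxi: "\<And>L. \<lbrakk>L \<in> S; K \<subseteq> L\<rbrakk> \<Longrightarrow> L = K" by blast
  interpret K: ring_ideal K using K unfolding S_def by blast
  have JK: "K.cg x z" if "x \<doteq> z" for x z
    using that K unfolding S_def cg_def K.cg_def by blast
  interpret K: twisted_ring K \<alpha> \<gamma> \<beta> n i j
  proof
    show "\<exists>k t. t > 0 \<and> K.cg (q ^ (k + t)) (q ^ k)" for q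
      using periodic JK by blast
    show "\<exists>m>0. of_nat m \<in> K" using torsion K unfolding S_def by blast
    show "\<exists>N>0. K.cg (\<gamma> ^ N) 1" using order_gamma JK by blast
    show "\<exists>t. K.cg ((\<alpha> - 1) * x) (gsum t \<gamma>)" for x using closed_gamma JK by blast
    show "\<exists>t. K.cg ((\<gamma> - 1) * x) (gsum t \<alpha>)" for x using closed_alpha JK by blast
    show "\<beta> x \<in> K" if "x \<in> K" for x using that K unfolding S_def by blast
    show "n > 0" by (rule n_pos)
    show "\<beta> 1 = 1" by (rule beta_one)
    show "x \<in> S" if "1 \<in> S" "\<alpha> \<in> S" "\<And>x y. \<lbrakk>x \<in> S; y \<in> S\<rbrakk> \<Longrightarrow> x + y \<in> S"
      "\<And>x y. \<lbrakk>x \<in> S; y \<in> S\<rbrakk> \<Longrightarrow> x * y \<in> S" "\<And>x. x \<in> S \<Longrightarrow> - x \<in> S" for S x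
      using generated that by blast
  qed (rule JK order_alpha gamma_eq alpha_eq beta_alpha beta_add beta_mult)+
  interpret K: minimal_twisted_ring K \<alpha> \<gamma> \<beta> n i j
  proof
    show "\<alpha> ^ 4 - 1 \<notin> K" using K unfolding S_def by blast
    fix L assume "ring_ideal L" "K \<subseteq> L" "\<And>x. x \<in> L \<Longrightarrow> \<beta> x \<in> L" "L \<noteq> K"
    then show "\<alpha> ^ 4 - 1 \<in> L" using maxi[of L] K unfolding S_def by blast
  qed
  show False by (rule K.contradiction)
qed

section \<open>Products of two cyclic groups\<close>

context group
begin

abbreviation cj :: "'a \<Rightarrow> 'a \<Rightarrow> 'a" where
  "cj \<equiv> conj_by G"

definition cm :: "'a \<Rightarrow> 'a \<Rightarrow> 'a" where
  "cm x y = inv x \<otimes> inv y \<otimes> x \<otimes> y"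

lemma inv_cancel:
  "\<lbrakk>x \<in> carrier G; y \<in> carrier G\<rbrakk> \<Longrightarrow> inv x \<otimes> (x \<otimes> y) = y"
  "\<lbrakk>x \<in> carrier G; y \<in> carrier G\<rbrakk> \<Longrightarrow> x \<otimes> (inv x \<otimes> y) = y"
  by (simp_all flip: m_assoc)

lemmas group_simps = m_assoc inv_mult_group inv_cancel conj_by_def cm_def

lemma cj_closed [simp, intro]: "\<lbrakk>x \<in> carrier G; y \<in> carrier G\<rbrakk> \<Longrightarrow> cj x y \<in> carrier G"
  and cm_closed [simp, intro]: "\<lbrakk>x \<in> carrier G; y \<in> carrier G\<rbrakk> \<Longrightarrow> cm x y \<in> carrier G"
  by (simp_all add: conj_by_def cm_def)

lemma cj_one [simp]: "y \<in> carrier G \<Longrightarrow> cj \<one> y = \<one>"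
  and cj_by_one [simp]: "x \<in> carrier G \<Longrightarrow> cj x \<one> = x"
  by (simp_all add: conj_by_def)

lemma cj_mult: "\<lbrakk>x \<in> carrier G; y \<in> carrier G; z \<in> carrier G\<rbrakk> \<Longrightarrow> cj (x \<otimes> y) z = cj x z \<otimes> cj y z"
  and cj_cj: "\<lbrakk>x \<in> carrier G; y \<in> carrier G; z \<in> carrier G\<rbrakk> \<Longrightarrow> cj (cj x y) z = cj x (y \<otimes> z)"
  and cj_inv: "\<lbrakk>x \<in> carrier G; z \<in> carrier G\<rbrakk> \<Longrightarrow> cj (inv x) z = inv (cj x z)"
  by (simp_all add: group_simps)

lemma cj_pow: "\<lbrakk>x \<in> carrier G; z \<in> carrier G\<rbrakk> \<Longrightarrow> cj (x [^] (k::nat)) z = cj x z [^] k"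
proof (induction k)
  case (Suc k)
  then show ?case using cj_mult[of "x [^] k" x z] by simp
qed simp

lemma cj_int_pow: "\<lbrakk>x \<in> carrier G; z \<in> carrier G\<rbrakk> \<Longrightarrow> cj (x [^] (k::int)) z = cj x z [^] k"
  by (cases k) (simp_all only: int_pow_int int_pow_neg_int cj_pow cj_inv nat_pow_closed cj_closed)

lemma cj_eq_iff: "\<lbrakk>x \<in> carrier G; y \<in> carrier G\<rbrakk> \<Longrightarrow> cj x y = x \<longleftrightarrow> x \<otimes> y = y \<otimes> x"
  by (simp add: conj_by_def m_assoc inv_solve_left')

lemma cj_inj: "\<lbrakk>x \<in> carrier G; y \<in> carrier G; z \<in> carrier G; cj x z = cj y z\<rbrakk> \<Longrightarrow> x = y"
  by (simp add: conj_by_def)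

lemma cm_cj: "\<lbrakk>x \<in> carrier G; y \<in> carrier G; z \<in> carrier G\<rbrakk> \<Longrightarrow> cj (cm x y) z = cm (cj x z) (cj y z)"
  and cm_eq: "\<lbrakk>x \<in> carrier G; y \<in> carrier G\<rbrakk> \<Longrightarrow> cm x y = inv x \<otimes> cj x y"
  and cm_eq': "\<lbrakk>x \<in> carrier G; y \<in> carrier G\<rbrakk> \<Longrightarrow> cm x y = cj (inv y) x \<otimes> y"
  and cj_eq_cm: "\<lbrakk>x \<in> carrier G; y \<in> carrier G\<rbrakk> \<Longrightarrow> cj x y = x \<otimes> cm x y"
  and cm_mult_left: "\<lbrakk>x \<in> carrier G; y \<in> carrier G; z \<in> carrier G\<rbrakk> \<Longrightarrow> cm (x \<otimes> y) z = cj (cm x z) y \<otimes> cm y z"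
  and cm_mult_right: "\<lbrakk>x \<in> carrier G; y \<in> carrier G; z \<in> carrier G\<rbrakk> \<Longrightarrow> cm x (y \<otimes> z) = cm x z \<otimes> cj (cm x y) z"
  and inv_cm: "\<lbrakk>x \<in> carrier G; y \<in> carrier G\<rbrakk> \<Longrightarrow> inv (cm x y) = cm y x"
  by (simp_all add: group_simps)

lemma cm_one_iff: "\<lbrakk>x \<in> carrier G; y \<in> carrier G\<rbrakk> \<Longrightarrow> cm x y = \<one> \<longleftrightarrow> x \<otimes> y = y \<otimes> x"
  by (simp add: cm_eq inv_solve_left' cj_eq_iff)

lemma cm_pow_same: "x \<in> carrier G \<Longrightarrow> cm (x [^] (i::nat)) (x [^] (j::nat)) = \<one>"
  by (simp add: cm_one_iff nat_pow_comm)

text \<open>Finiteness lets exponents stay natural numbers.\<close>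

lemma inv_pow_nat:
  assumes "finite (carrier G)" "x \<in> carrier G"
  shows "\<exists>k. inv (x [^] (i::nat)) = x [^] (k::nat)"
proof -
  have "Coset.order G > 0" using assms(1) by (simp add: order_gt_0_iff_finite)
  then have "i * (Coset.order G - 1) + i = Coset.order G * i" by (cases "Coset.order G") simp_all
  then have "x [^] (i * (Coset.order G - 1)) \<otimes> x [^] i = x [^] (Coset.order G * i)"
    using assms by (simp add: nat_pow_mult)
  also have "\<dots> = (x [^] Coset.order G) [^] i" using assms(2) by (simp add: nat_pow_pow)
  also have "\<dots> = \<one>" using assms by (simp add: pow_order_eq_1)
  finally have "inv (x [^] i) = x [^] (i * (Coset.order G - 1))"
    using assms by (simp add: inv_equality)
  then show ?thesis by blast
qed

lemma generate_commute:
  assumes "S \<subseteq> carrier G" "y \<in> carrier G" "\<And>x. x \<in> S \<Longrightarrow> x \<otimes> y = y \<otimes> x" "z \<in> generate G S"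
  shows "z \<otimes> y = y \<otimes> z"
  using assms(4)
proof induction
  case (inv h)
  then have h: "h \<in> carrier G" "h \<otimes> y = y \<otimes> h" using assms by auto
  have "inv h \<otimes> y = inv h \<otimes> (y \<otimes> h) \<otimes> inv h" using h(1) assms(2) by (simp add: m_assoc)
  also have "\<dots> = y \<otimes> inv h" using h(1) assms(2) by (simp add: h(2)[symmetric] m_assoc inv_cancel)
  finally show ?case .
next
  case (eng h1 h2)
  then have "h1 \<in> carrier G" "h2 \<in> carrier G" using generate_in_carrier assms(1) by auto
  then have "h1 \<otimes> h2 \<otimes> y = h1 \<otimes> (y \<otimes> h2)" using eng assms(2) by (simp add: m_assoc)
  also have "\<dots> = y \<otimes> (h1 \<otimes> h2)"
    using eng assms(2) \<open>h1 \<in> carrier G\<close> \<open>h2 \<in> carrier G\<close> by (simp flip: m_assoc)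
  finally show ?case .
qed (use assms in auto)

end

text \<open>\<open>exchange\<close> puts \<langle>c\<rangle>\<langle>a\<rangle> inside
  \<langle>a\<rangle>\<langle>c\<rangle>, which makes the product a subgroup. The ambient group may
  be larger, leaving room for \<open>b\<close>.\<close>

locale cyclic_product = group G for G (structure) +
  fixes a c :: 'a
  assumes finite_G: "finite (carrier G)"
    and a_in [simp]: "a \<in> carrier G" and c_in [simp]: "c \<in> carrier G"
    and exchange: "\<And>(i::nat) (j::nat). \<exists>(i'::nat) (j'::nat). c [^] j \<otimes> a [^] i = a [^] i' \<otimes> c [^] j'"
begin

lemma exchange': "\<exists>(i'::nat) (j'::nat). a [^] (i::nat) \<otimes> c [^] (j::nat) = c [^] j' \<otimes> a [^] i'"
proof -
  obtain i1 j1 where *: "inv (a [^] i) = a [^] (i1::nat)" "inv (c [^] j) = c [^] (j1::nat)"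
    using inv_pow_nat finite_G a_in c_in by meson
  obtain i2 j2 where "c [^] j1 \<otimes> a [^] i1 = a [^] (i2::nat) \<otimes> c [^] (j2::nat)" using exchange by blast
  then have "inv (a [^] i \<otimes> c [^] j) = a [^] i2 \<otimes> c [^] j2" using * by (simp add: inv_mult_group)
  then have "a [^] i \<otimes> c [^] j = inv (c [^] j2) \<otimes> inv (a [^] i2)"
    by (metis a_in c_in inv_inv inv_mult_group m_closed nat_pow_closed)
  moreover obtain i3 j3 where "inv (a [^] i2) = a [^] (i3::nat)" "inv (c [^] j2) = c [^] (j3::nat)"
    using inv_pow_nat finite_G a_in c_in by meson
  ultimately show ?thesis by metis
qed

definition prods :: "'a set" where
  "prods = {a [^] i \<otimes> c [^] j | (i::nat) (j::nat). True}"

lemma prodsI: "a [^] (i::nat) \<otimes> c [^] (j::nat) \<in> prods"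
  unfolding prods_def by blast

lemma prodsE:
  assumes "x \<in> prods" obtains i j :: nat where "x = a [^] i \<otimes> c [^] j"
  using assms unfolding prods_def by blast

lemma prodsE':
  assumes "x \<in> prods" obtains i j :: nat where "x = c [^] j \<otimes> a [^] i"
  using assms exchange' unfolding prods_def by blast

lemma subgroup_prods: "subgroup prods G"
proof (rule subgroupI)
  show "prods \<subseteq> carrier G" unfolding prods_def by auto
  show "prods \<noteq> {}" unfolding prods_def by blast
  fix x assume "x \<in> prods"
  then obtain i j :: nat where "x = c [^] j \<otimes> a [^] i" by (rule prodsE')
  then have "inv x = inv (a [^] i) \<otimes> inv (c [^] j)" by (simp add: inv_mult_group)
  moreover obtain k l :: nat where "inv (a [^] i) = a [^] k" "inv (c [^] j) = c [^] l"
    using inv_pow_nat finite_G a_in c_in by meson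
  ultimately show "inv x \<in> prods" using prodsI by simp
next
  fix x y assume "x \<in> prods" "y \<in> prods"
  then obtain i j k l :: nat where *: "x = a [^] i \<otimes> c [^] j" "y = a [^] k \<otimes> c [^] l"
    using prodsE by metis
  obtain k' j' :: nat where "c [^] j \<otimes> a [^] k = a [^] k' \<otimes> c [^] j'" using exchange by blast
  then have "x \<otimes> y = a [^] i \<otimes> (a [^] k' \<otimes> c [^] j') \<otimes> c [^] l"
    unfolding * by (simp add: m_assoc) (simp flip: m_assoc)
  also have "\<dots> = (a [^] i \<otimes> a [^] k') \<otimes> (c [^] j' \<otimes> c [^] l)"
    by (simp add: m_assoc)
  also have "\<dots> = a [^] (i + k') \<otimes> c [^] (j' + l)" by (simp only: nat_pow_mult a_in c_in)
  finally show "x \<otimes> y \<in> prods" using prodsI by simp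
qed

lemma prods_in: "x \<in> prods \<Longrightarrow> x \<in> carrier G"
  using subgroup.mem_carrier[OF subgroup_prods] .

lemma a_pow_prods [simp]: "a [^] (i::nat) \<in> prods"
  using prodsI[of i 0] by simp

lemma c_pow_prods [simp]: "c [^] (j::nat) \<in> prods"
  using prodsI[of 0 j] by simp

lemma cm_a_prod: "cm (a [^] (i::nat)) (a [^] (k::nat) \<otimes> c [^] (j::nat)) = cm (a [^] i) (c [^] j)"
  by (simp add: cm_mult_right cm_pow_same)

lemma cm_c_prod: "cm (c [^] (k::nat) \<otimes> a [^] (i::nat)) (c [^] (j::nat)) = cm (a [^] i) (c [^] j)"
  by (simp add: cm_mult_left cm_pow_same)

text \<open>[a^i, c^j]^(a^k) = [a^i, c^j a^k] = [a^i, a^k' c^j'] = [a^i, c^j'].\<close>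

lemma cj_cm_a:
  assumes "c [^] (j::nat) \<otimes> a [^] (k::nat) = a [^] (k'::nat) \<otimes> c [^] (j'::nat)"
  shows "cj (cm (a [^] (i::nat)) (c [^] j)) (a [^] k) = cm (a [^] i) (c [^] j')"
proof -
  have "cj (cm (a [^] i) (c [^] j)) (a [^] k) = cm (a [^] i) (c [^] j \<otimes> a [^] k)"
    by (simp add: cm_mult_right cm_pow_same)
  then show ?thesis by (simp add: assms cm_a_prod)
qed

lemma cj_cm_c:
  assumes "a [^] (i::nat) \<otimes> c [^] (k::nat) = c [^] (k'::nat) \<otimes> a [^] (i'::nat)"
  shows "cj (cm (a [^] i) (c [^] (j::nat))) (c [^] k) = cm (a [^] i') (c [^] j)"
proof -
  have "cj (cm (a [^] i) (c [^] j)) (c [^] k) = cm (a [^] i \<otimes> c [^] k) (c [^] j)"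
    by (simp add: cm_mult_left cm_pow_same)
  then show ?thesis by (simp add: assms cm_c_prod)
qed

section \<open>Ito's theorem and the commutators [a^i, c^j]\<close>

definition comms :: "'a set" where
  "comms = {cm (a [^] i) (c [^] j) | (i::nat) (j::nat). True}"

lemma commsI: "cm (a [^] (i::nat)) (c [^] (j::nat)) \<in> comms"
  unfolding comms_def by blast

lemma comms_in: "comms \<subseteq> carrier G"
  unfolding comms_def by auto

lemma cj_comms_a: "u \<in> comms \<Longrightarrow> cj u (a [^] (k::nat)) \<in> comms"
proof -
  assume "u \<in> comms"
  then obtain i j :: nat where u: "u = cm (a [^] i) (c [^] j)" unfolding comms_def by blast
  obtain k' j' :: nat where "c [^] j \<otimes> a [^] k = a [^] k' \<otimes> c [^] j'" using exchange by blast
  then show ?thesis unfolding u by (simp only: cj_cm_a commsI)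
qed

lemma cj_comms_c: "u \<in> comms \<Longrightarrow> cj u (c [^] (k::nat)) \<in> comms"
proof -
  assume "u \<in> comms"
  then obtain i j :: nat where u: "u = cm (a [^] i) (c [^] j)" unfolding comms_def by blast
  obtain k' i' :: nat where "a [^] i \<otimes> c [^] k = c [^] k' \<otimes> a [^] i'" using exchange' by blast
  then show ?thesis unfolding u by (simp only: cj_cm_c commsI)
qed

text \<open>Ito's argument: \<open>a\<close> and \<open>c\<close> act on the commutators by commuting permutations.\<close>

lemma cj_comms_swap:
  assumes "u \<in> comms"
  shows "cj u (a [^] (k::nat) \<otimes> c [^] (m::nat)) = cj u (c [^] m \<otimes> a [^] k)"
proof -
  obtain i j :: nat where u: "u = cm (a [^] i) (c [^] j)" using assms unfolding comms_def by blast
  obtain k' j' :: nat where 1: "c [^] j \<otimes> a [^] k = a [^] k' \<otimes> c [^] j'" using exchange by blast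
  obtain m' i' :: nat where 2: "a [^] i \<otimes> c [^] m = c [^] m' \<otimes> a [^] i'" using exchange' by blast
  have "cj (cj u (a [^] k)) (c [^] m) = cj (cj u (c [^] m)) (a [^] k)"
    unfolding u by (simp only: cj_cm_a[OF 1] cj_cm_c[OF 2])
  then show ?thesis unfolding u by (simp add: cj_cj)
qed

text \<open>For v = [a^i, c^j] one has v c^(-j) a^(-i) = a^(-i) c^(-j). The products a^(-i) c^(-j)
  and c^(-j) a^(-i) act alike on \<open>u\<close>, so \<open>v\<close> acts trivially.\<close>

lemma comms_commute:
  assumes "u \<in> comms" "v \<in> comms" shows "u \<otimes> v = v \<otimes> u"
proof -
  obtain i j :: nat where v: "v = cm (a [^] i) (c [^] j)" using assms(2) unfolding comms_def by blast
  obtain k m :: nat where km: "inv (a [^] i) = a [^] k" "inv (c [^] j) = c [^] m"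
    using inv_pow_nat finite_G a_in c_in by meson
  have u: "u \<in> carrier G" using assms(1) comms_in by blast
  have "cj (cj u v) (c [^] m \<otimes> a [^] k) = cj u (v \<otimes> (c [^] m \<otimes> a [^] k))"
    using u by (simp add: cj_cj v)
  also have "v \<otimes> (c [^] m \<otimes> a [^] k) = a [^] k \<otimes> c [^] m"
    unfolding v by (simp add: cm_def m_assoc km[symmetric] inv_cancel)
  also have "cj u \<dots> = cj u (c [^] m \<otimes> a [^] k)" by (rule cj_comms_swap[OF assms(1)])
  finally have "cj u v = u" using u by (elim cj_inj[rotated 3]) (simp_all add: v)
  then show ?thesis using u by (simp add: cj_eq_iff v)
qed

text \<open>The derived subgroup of \<langle>a\<rangle>\<langle>c\<rangle>: by
  \<open>cm_V_prods\<close> below it contains all commutators.\<close>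

definition V :: "'a set" where
  "V = generate G comms"

lemma subgroup_V: "subgroup V G"
  unfolding V_def by (rule generate_is_subgroup[OF comms_in])

lemma V_in [simp]: "v \<in> V \<Longrightarrow> v \<in> carrier G"
  using subgroup.mem_carrier[OF subgroup_V] .

lemma V_one [simp]: "\<one> \<in> V" and V_mult [simp]: "\<lbrakk>u \<in> V; v \<in> V\<rbrakk> \<Longrightarrow> u \<otimes> v \<in> V"
  and V_inv [simp]: "u \<in> V \<Longrightarrow> inv u \<in> V"
  using subgroup_V by (simp_all add: subgroup.one_closed subgroup.m_closed subgroup.m_inv_closed)

lemma V_pow [simp]: "u \<in> V \<Longrightarrow> u [^] (k::nat) \<in> V" and V_int_pow [simp]: "u \<in> V \<Longrightarrow> u [^] (z::int) \<in> V"
proof -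
  show *: "u \<in> V \<Longrightarrow> u [^] k \<in> V" for k :: nat by (induction k) simp_all
  show "u \<in> V \<Longrightarrow> u [^] z \<in> V" by (cases z) (simp_all only: int_pow_int int_pow_neg_int V_in V_inv *)
qed

lemma comms_V: "cm (a [^] (i::nat)) (c [^] (j::nat)) \<in> V"
  unfolding V_def by (rule generate.incl[OF commsI])

lemma V_commute:
  assumes "u \<in> V" "v \<in> V" shows "u \<otimes> v = v \<otimes> u"
proof (rule generate_commute[OF comms_in _ _ assms(1)[unfolded V_def]])
  fix x assume "x \<in> comms"
  then have "v \<otimes> x = x \<otimes> v"
    using comms_in comms_commute by (intro generate_commute[OF comms_in _ _ assms(2)[unfolded V_def]]) auto
  then show "x \<otimes> v = v \<otimes> x" by simp
qed (use assms in simp)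

lemma V_prods: "V \<subseteq> prods"
proof -
  have "comms \<subseteq> prods"
    unfolding comms_def cm_def
    by (auto intro!: subgroup.m_closed[OF subgroup_prods] subgroup.m_inv_closed[OF subgroup_prods])
  then show ?thesis unfolding V_def by (rule generate_subgroup_incl[OF _ subgroup_prods])
qed

lemma cj_V_lift:
  assumes "x \<in> carrier G" "\<And>u. u \<in> comms \<Longrightarrow> cj u x \<in> V" "v \<in> V"
  shows "cj v x \<in> V"
  using assms(3) unfolding V_def
proof induction
  case (inv h)
  then show ?case using assms comms_in unfolding V_def[symmetric] by (auto simp: cj_inv subset_eq)
next
  case (eng h1 h2)
  then have "h1 \<in> carrier G" "h2 \<in> carrier G" using generate_in_carrier comms_in by auto
  with eng assms(1) show ?case unfolding V_def[symmetric] by (simp add: cj_mult)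
qed (use assms in \<open>auto simp flip: V_def\<close>)

lemma cj_V_a [simp]: "v \<in> V \<Longrightarrow> cj v a \<in> V" and cj_V_c [simp]: "v \<in> V \<Longrightarrow> cj v c \<in> V"
  using cj_V_lift[of a] cj_V_lift[of c] cj_comms_a[of _ 1] cj_comms_c[of _ 1] generate.incl[of _ comms G]
  by (auto simp: V_def)

lemma cj_V_swap: "v \<in> V \<Longrightarrow> cj (cj v a) c = cj (cj v c) a"
proof -
  assume "v \<in> V"
  then have "cj v (a \<otimes> c) = cj v (c \<otimes> a)"
    unfolding V_def
  proof induction
    case (incl h)
    then show ?case using cj_comms_swap[of h 1 1] by simp
  next
    case (inv h)
    then show ?case using cj_comms_swap[of h 1 1] comms_in by (auto simp: cj_inv subset_eq)
  next
    case (eng h1 h2)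
    then have "h1 \<in> carrier G" "h2 \<in> carrier G" using generate_in_carrier comms_in by auto
    with eng show ?case by (simp add: cj_mult)
  qed simp
  then show ?thesis using \<open>v \<in> V\<close> by (simp add: cj_cj)
qed

section \<open>The derived subgroup as a cyclic module over Z[X]\<close>

definition pact :: "int poly \<Rightarrow> 'a \<Rightarrow> 'a" where
  "pact p u = fold_coeffs (\<lambda>k r. u [^] k \<otimes> cj r a) p \<one>"

lemma pact_0 [simp]: "pact 0 u = \<one>"
  by (simp add: pact_def)

lemma pact_pCons [simp]: "u \<in> carrier G \<Longrightarrow> pact (pCons k p) u = u [^] k \<otimes> cj (pact p u) a"
  by (cases "k = 0 \<and> p = 0") (auto simp add: pact_def)

lemma pact_V [simp]: "u \<in> V \<Longrightarrow> pact p u \<in> V"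
  by (induction p) simp_all

lemma pact_one_right [simp]: "pact p \<one> = \<one>"
  by (induction p) simp_all

lemma V_swap4: "\<lbrakk>u \<in> V; v \<in> V; x \<in> V; z \<in> V\<rbrakk> \<Longrightarrow> (u \<otimes> v) \<otimes> (x \<otimes> z) = (u \<otimes> x) \<otimes> (v \<otimes> z)"
  using V_commute[of v x] by (simp add: m_assoc) (simp flip: m_assoc)

text \<open>As \<open>V\<close> is abelian, \<open>pact\<close> makes it a module over Z[X], written
  multiplicatively, with X acting as conjugation by \<open>a\<close>.\<close>

lemma pact_add: "u \<in> V \<Longrightarrow> pact (p + q) u = pact p u \<otimes> pact q u"
proof (induction p q rule: poly_induct2)
  case (pCons k p l q)
  then show ?case
    using V_swap4[of "u [^] k" "u [^] l" "cj (pact p u) a" "cj (pact q u) a"]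
    by (simp add: int_pow_mult cj_mult)
qed simp

lemma pact_minus: "u \<in> V \<Longrightarrow> pact (- p) u = inv (pact p u)"
  using pact_add[of u "- p" p] by (intro inv_equality[symmetric]) simp_all

lemma pact_int_pow: "u \<in> V \<Longrightarrow> pact p (u [^] (k::int)) = pact p u [^] k"
proof (induction p)
  case (pCons l p)
  then show ?case
    using int_pow_mult_distrib[of "u [^] l" "cj (pact p u) a" k] V_commute[of "u [^] l" "cj (pact p u) a"]
    by (simp add: cj_int_pow int_pow_pow mult.commute)
qed simp

lemma pact_smult: "u \<in> V \<Longrightarrow> pact (smult k p) u = pact p u [^] k"
proof (induction p)
  case (pCons l p)
  then show ?case
    using int_pow_mult_distrib[of "u [^] l" "cj (pact p u) a" k] V_commute[of "u [^] l" "cj (pact p u) a"]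
    by (simp add: cj_int_pow int_pow_pow mult.commute)
qed simp

lemma pact_mult: "u \<in> V \<Longrightarrow> pact (p * q) u = pact p (pact q u)"
proof (induction p)
  case (pCons k p)
  then show ?case by (simp add: pact_add pact_smult)
qed simp

lemma pact_mult': "u \<in> V \<Longrightarrow> pact (p * q) u = pact q (pact p u)"
  using pact_mult[of u q p] by (simp add: mult.commute)

lemma pact_one [simp]: "u \<in> V \<Longrightarrow> pact 1 u = u"
  by (simp add: one_pCons)

lemma pact_X_mult: "u \<in> V \<Longrightarrow> pact ([:0, 1:] * p) u = cj (pact p u) a"
  by (subst pact_mult) simp_all

lemma pact_X_pow: "u \<in> V \<Longrightarrow> pact ([:0, 1:] ^ k) u = cj u (a [^] k)"
proof (induction k)
  case (Suc k)
  have "pact ([:0, 1:] ^ Suc k) u = cj (pact ([:0, 1:] ^ k) u) a"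
    unfolding power_Suc using Suc.prems by (rule pact_X_mult)
  also have "\<dots> = cj u (a [^] Suc k)"
    using Suc by (simp add: cj_cj)
  finally show ?case .
qed simp

lemma cj_pact_c: "u \<in> V \<Longrightarrow> cj (pact p u) c = pact p (cj u c)"
proof (induction p)
  case (pCons k p)
  then show ?case using cj_V_swap[of "pact p u"] by (simp add: cj_mult cj_int_pow)
qed simp

text \<open>Induction with [a^(i+1), y] = [a^i, y]^a [a, y].\<close>

lemma cm_a_gsum:
  assumes "y \<in> carrier G" "cm a y \<in> V"
  shows "cm (a [^] (i::nat)) y = pact (gsum i [:0, 1:]) (cm a y)"
proof (induction i)
  case 0
  then show ?case using assms by (simp add: cm_def)
next
  case (Suc i)
  have "cm (a [^] Suc i) y = cj (cm (a [^] i) y) a \<otimes> cm a y"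
    using assms by (simp add: cm_mult_left)
  also have "\<dots> = cm a y \<otimes> cj (cm (a [^] i) y) a"
    using assms Suc by (intro V_commute) simp_all
  also have "\<dots> = pact (1 + [:0, 1:] * gsum i [:0, 1:]) (cm a y)"
    using assms Suc by (subst pact_add, simp, subst pact_X_mult) simp_all
  finally show ?case by (simp only: gsum_Suc')
qed

abbreviation w :: 'a where "w \<equiv> cm a c"

lemma w_V [simp]: "w \<in> V"
  using comms_V[of 1 1] by simp

text \<open>If a c = c^k a^i, conjugation by \<open>c\<close> sends w = [a, c] to [a^i, c], which is
  \<open>gsum i\<close> of X applied to \<open>w\<close>. So \<open>gam\<close> represents the
  action of \<open>c\<close>, whichever such i is chosen.\<close>

definition gam :: "int poly" where
  "gam = gsum (SOME i. \<exists>k. a \<otimes> c = c [^] (k::nat) \<otimes> a [^] i) [:0, 1:]"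

lemma cj_w_c: "cj w c = pact gam w"
proof -
  obtain k i :: nat where "a [^] (1::nat) \<otimes> c [^] (1::nat) = c [^] k \<otimes> a [^] i" using exchange' by blast
  then have "\<exists>i k. a \<otimes> c = c [^] (k::nat) \<otimes> a [^] (i::nat)" by auto
  from someI_ex[OF this] obtain k :: nat where
    "a [^] (1::nat) \<otimes> c [^] (1::nat) = c [^] k \<otimes> a [^] (SOME i::nat. \<exists>k. a \<otimes> c = c [^] (k::nat) \<otimes> a [^] i)"
    by auto
  from cj_cm_c[OF this, of 1] show ?thesis
    by (simp add: gam_def cm_a_gsum)
qed

lemma cj_pact_w_c: "cj (pact p w) c = pact (gam * p) w"
  by (simp add: cj_pact_c cj_w_c pact_mult')

lemma cm_c_gsum: "cm a (c [^] (j::nat)) = pact (gsum j gam) w"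
proof (induction j)
  case 0
  then show ?case by (simp add: cm_def)
next
  case (Suc j)
  have "cm a (c [^] Suc j) = w \<otimes> cj (cm a (c [^] j)) c"
    by (simp add: cm_mult_right)
  also have "\<dots> = pact (1 + gam * gsum j gam) w"
    using Suc by (simp add: pact_add cj_pact_w_c)
  finally show ?case by (simp only: gsum_Suc')
qed

text \<open>The commutator [a^i, c^j] is the product of \<open>gsum i\<close> of X and
  \<open>gsum j gam\<close>, applied to \<open>w\<close>.\<close>

lemma V_eq: assumes "v \<in> V" obtains p where "v = pact p w"
proof -
  have "comms \<subseteq> {pact p w | p. True}"
  proof
    fix x assume "x \<in> comms"
    then obtain i j :: nat where "x = cm (a [^] i) (c [^] j)" unfolding comms_def by blast
    also have "\<dots> = pact (gsum i [:0, 1:]) (cm a (c [^] j))"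
      using comms_V[of 1 j] by (simp add: cm_a_gsum)
    also have "\<dots> = pact (gsum i [:0, 1:] * gsum j gam) w"
      by (simp add: cm_c_gsum pact_mult del: pact_pCons)
    finally show "x \<in> {pact p w | p. True}" by blast
  qed
  moreover have "subgroup {pact p w | p. True} G"
  proof (rule subgroupI)
    show "{pact p w | p. True} \<subseteq> carrier G" by auto
    show "{pact p w | p. True} \<noteq> {}" by blast
    fix x assume "x \<in> {pact p w | p. True}"
    then obtain p where "x = pact p w" by blast
    then have "inv x = pact (- p) w" by (simp add: pact_minus)
    then show "inv x \<in> {pact p w | p. True}" by blast
  next
    fix x y assume "x \<in> {pact p w | p. True}" "y \<in> {pact p w | p. True}"
    then obtain p q where "x = pact p w" "y = pact q w" by blast
    then have "x \<otimes> y = pact (p + q) w" by (simp add: pact_add)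
    then show "x \<otimes> y \<in> {pact p w | p. True}" by blast
  qed
  ultimately have "V \<subseteq> {pact p w | p. True}"
    unfolding V_def by (rule generate_subgroup_incl)
  with assms that show ?thesis by blast
qed

lemma pact_gam: "v \<in> V \<Longrightarrow> pact gam v = cj v c"
  by (erule V_eq) (simp add: cj_pact_w_c pact_mult)

lemma pact_gam_pow: "v \<in> V \<Longrightarrow> pact (gam ^ k) v = cj v (c [^] k)"
proof (induction k)
  case (Suc k)
  then have "cj v (c [^] k) \<in> V" by (metis pact_V)
  with Suc show ?case by (simp add: pact_mult pact_gam cj_cj)
qed simp

text \<open>The annihilator of the module generator \<open>w\<close>, so that Z[X]/J is isomorphic
  to \<open>V\<close>.\<close>

definition J :: "int poly set" where
  "J = {p. pact p w = \<one>}"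

lemma diff_in_J: "p - q \<in> J \<longleftrightarrow> pact p w = pact q w"
proof -
  have "p - q \<in> J \<longleftrightarrow> pact p w \<otimes> inv (pact q w) = \<one>"
    using pact_add[of w p "- q"] by (simp add: J_def pact_minus)
  then show ?thesis by (simp add: inv_solve_right')
qed

sublocale ideal: ring_ideal J
proof
  show "0 \<in> J" by (simp add: J_def)
  show "x + y \<in> J" if "x \<in> J" "y \<in> J" for x y
    using that by (simp add: J_def pact_add)
  show "r * x \<in> J" if "x \<in> J" for r x
    using that by (simp add: J_def pact_mult)
qed

lemma cg_iff: "ideal.cg p q \<longleftrightarrow> pact p w = pact q w"
  by (simp add: ideal.cg_def diff_in_J)

lemma poly_generated:
  assumes "1 \<in> S" "[:0, 1:] \<in> S" "\<And>x y. \<lbrakk>x \<in> S; y \<in> S\<rbrakk> \<Longrightarrow> x + y \<in> S"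
    "\<And>x y. \<lbrakk>x \<in> S; y \<in> S\<rbrakk> \<Longrightarrow> x * y \<in> S" "\<And>x. x \<in> S \<Longrightarrow> - x \<in> S"
  shows "(p :: int poly) \<in> S"
proof -
  have zero: "0 \<in> S" using assms(3)[OF assms(1) assms(5)[OF assms(1)]] by simp
  have nat: "of_nat k \<in> S" for k
    by (induction k) (use zero assms in auto)
  have const: "[:k:] \<in> S" for k
    using nat[of "nat k"] assms(5)[OF nat[of "nat (- k)"]]
    by (cases "k \<ge> 0") (auto simp: of_nat_poly)
  show ?thesis
  proof (induction p)
    case (pCons k p)
    have "pCons k p = [:k:] + [:0, 1:] * p" by simp
    then show ?case using const pCons assms by metis
  qed (rule zero)
qed

lemma order_pos: "Coset.order G > 0"
  using finite_G by (simp add: order_gt_0_iff_finite)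

lemma cm_V_prods:
  assumes "x \<in> prods" "y \<in> prods" shows "cm x y \<in> V"
proof -
  have a: "cm (a [^] (i::nat)) y \<in> V" if "y \<in> prods" for i y
    using that by (elim prodsE) (simp add: cm_a_prod comms_V)
  have "cm (c [^] (j::nat)) (a [^] (i::nat)) \<in> V" for i j
    using V_inv[OF comms_V] by (simp add: inv_cm)
  then have c: "cm (c [^] (j::nat)) y \<in> V" if "y \<in> prods" for j y
    using that by (elim prodsE') (simp add: cm_mult_right cm_pow_same)
  obtain i j :: nat where x: "x = c [^] j \<otimes> a [^] i" using assms(1) by (rule prodsE')
  have "cj v (a [^] i) \<in> V" if "v \<in> V" for v
    using pact_V[OF that] pact_X_pow[OF that] by metis
  with a c assms(2) show ?thesis
    unfolding x by (simp add: cm_mult_left prods_in)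
qed

end

section \<open>The automorphism induced by b\<close>

locale twisted_cyclic_product = cyclic_product +
  fixes b :: 'a and n :: nat
  assumes b_in [simp]: "b \<in> carrier G" and b_square: "b \<otimes> b = \<one>"
    and n_pos: "n > 0" and a_order: "a [^] (4 * n) = \<one>"
    and cj_a_b: "cj a b = a [^] (2 * n - 1)"
    and cj_c_b: "cj c b \<in> prods"
begin

lemma cj_b_b: "x \<in> carrier G \<Longrightarrow> cj (cj x b) b = x"
  by (simp add: cj_cj b_square)

lemma cj_prods_b: "x \<in> prods \<Longrightarrow> cj x b \<in> prods"
proof (elim prodsE)
  fix i j :: nat assume x: "x = a [^] i \<otimes> c [^] j"
  have pow: "y [^] (k::nat) \<in> prods" if "y \<in> prods" for y k
    using that subgroup.m_closed[OF subgroup_prods] subgroup.one_closed[OF subgroup_prods]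
    by (induction k) auto
  have "cj x b = cj a b [^] i \<otimes> cj c b [^] j"
    by (simp add: x cj_mult cj_pow)
  then show "cj x b \<in> prods"
    using pow[OF cj_c_b] pow[OF a_pow_prods, of "2 * n - 1" i] subgroup.m_closed[OF subgroup_prods]
    by (simp add: cj_a_b)
qed

lemma cj_V_b [simp]: "v \<in> V \<Longrightarrow> cj v b \<in> V"
proof (rule cj_V_lift)
  fix u assume "u \<in> comms"
  then obtain i j :: nat where "u = cm (a [^] i) (c [^] j)" unfolding comms_def by blast
  then have "cj u b = cm (cj (a [^] i) b) (cj (c [^] j) b)" by (simp add: cm_cj)
  then show "cj u b \<in> V" by (simp add: cm_V_prods cj_prods_b)
qed simp_all

text \<open>Since a^b = a^(2n-1), conjugation by \<open>b\<close> is semilinear on \<open>V\<close>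
  over this ring endomorphism; see \<open>cj_pact_b\<close>.\<close>

definition bet :: "int poly \<Rightarrow> int poly" where
  "bet p = pcompose p ([:0, 1:] ^ (2 * n - 1))"

lemma cj_pact_b: "v \<in> V \<Longrightarrow> cj (pact p v) b = pact (bet p) (cj v b)"
proof (induction p)
  case (pCons k p)
  have "a \<otimes> b = b \<otimes> cj a b" by (simp add: group_simps)
  then have "cj (cj (pact p v) a) b = cj (pact p v) (b \<otimes> cj a b)"
    using pCons.prems by (simp add: cj_cj)
  also have "\<dots> = cj (cj (pact p v) b) (a [^] (2 * n - 1))"
    using pCons.prems by (simp add: cj_cj cj_a_b)
  finally have 1: "cj (cj (pact p v) a) b = pact ([:0, 1:] ^ (2 * n - 1) * bet p) (cj v b)"
    using pCons by (simp add: pact_mult pact_X_pow)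
  have "cj (pact (pCons k p) v) b = (cj v b) [^] k \<otimes> cj (cj (pact p v) a) b"
    using pCons.prems by (simp add: cj_mult cj_int_pow)
  also have "\<dots> = pact ([:k:] + [:0, 1:] ^ (2 * n - 1) * bet p) (cj v b)"
    unfolding 1 using pCons.prems by (subst pact_add) simp_all
  finally show ?case by (simp add: bet_def pcompose_pCons)
qed (simp add: bet_def)

text \<open>Let w^b be \<mu> applied to w. If p kills w, then \<open>bet p\<close> kills w^b; and
  since b^2 = 1, w is \<open>bet \<mu>\<close> applied to w^b.\<close>

lemma bet_J: "p \<in> J \<Longrightarrow> bet p \<in> J"
proof -
  assume p: "p \<in> J"
  obtain \<mu> where \<mu>: "cj w b = pact \<mu> w" using V_eq[OF cj_V_b[OF w_V]] .
  have "pact (bet p) (cj w b) = \<one>"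
    using p cj_pact_b[of w p] by (simp add: J_def)
  then have 1: "pact (bet p * \<mu>) w = \<one>" by (simp add: \<mu> pact_mult)
  have "w = cj (cj w b) b" by (simp add: cj_b_b)
  also have "\<dots> = pact (bet \<mu>) (pact \<mu> w)" by (simp add: \<mu> cj_pact_b)
  finally have "pact (bet p) w = pact (bet p * (bet \<mu> * \<mu>)) w"
    by (simp add: pact_mult)
  also have "bet p * (bet \<mu> * \<mu>) = bet \<mu> * (bet p * \<mu>)" by (simp add: mult_ac)
  also have "pact \<dots> w = \<one>" using 1 by (simp add: pact_mult)
  finally show ?thesis by (simp add: J_def)
qed

text \<open>Z[X] with the ideal \<open>J\<close> satisfies the axioms of
  \<open>twisted_ring\<close>, so X^4 acts trivially on \<open>w\<close> and hence on
  \<open>V\<close>.\<close>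

theorem cj_a_4: assumes "v \<in> V" shows "cj v (a [^] (4::nat)) = v"
proof -
  obtain k j :: nat where kj: "c [^] (1::nat) \<otimes> a [^] (1::nat) = a [^] k \<otimes> c [^] j" using exchange by blast
  interpret R: twisted_ring J "[:0, 1:]" gam bet n "SOME i. \<exists>k. a \<otimes> c = c [^] (k::nat) \<otimes> a [^] i" j
  proof
    show "p \<in> S" if "1 \<in> S" "[:0, 1:] \<in> S" "\<And>x y. \<lbrakk>x \<in> S; y \<in> S\<rbrakk> \<Longrightarrow> x + y \<in> S"
      "\<And>x y. \<lbrakk>x \<in> S; y \<in> S\<rbrakk> \<Longrightarrow> x * y \<in> S" "\<And>x. x \<in> S \<Longrightarrow> - x \<in> S" for S :: "int poly set" and p
      by (rule poly_generated[OF that])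
    show "\<exists>k t. t > 0 \<and> ideal.cg (q ^ (k + t)) (q ^ k)" for q
    proof -
      \<comment> \<open>Two powers of q must act equally on \<open>w\<close>, the group being
        finite.\<close>
      have "\<not> inj (\<lambda>k::nat. pact (q ^ k) w)"
      proof
        assume "inj (\<lambda>k::nat. pact (q ^ k) w)"
        then have "infinite (range (\<lambda>k::nat. pact (q ^ k) w))" using range_inj_infinite by blast
        moreover have "range (\<lambda>k::nat. pact (q ^ k) w) \<subseteq> carrier G" by auto
        ultimately show False using finite_G finite_subset by blast
      qed
      then obtain k k' where "k \<noteq> k'" "pact (q ^ k) w = pact (q ^ k') w" by (auto simp: inj_def)
      then obtain k k' where "k < k'" "pact (q ^ k') w = pact (q ^ k) w" by (metis linorder_neqE_nat)
      then show ?thesis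
        unfolding cg_iff by (intro exI[of _ k] exI[of _ "k' - k"]) simp
    qed
    show "\<exists>m>0. of_nat m \<in> J"
      using order_pos pow_order_eq_1[of w]
      by (intro exI[of _ "Coset.order G"]) (simp add: J_def of_nat_poly int_pow_int)
    show "n > 0" by (rule n_pos)
    show "ideal.cg ([:0, 1:] ^ (4 * n)) 1" by (simp add: cg_iff pact_X_pow a_order)
    show "\<exists>N>0. ideal.cg (gam ^ N) 1"
      using order_pos pow_order_eq_1[of c]
      by (intro exI[of _ "Coset.order G"]) (simp add: cg_iff pact_gam_pow)
    show "ideal.cg gam (gsum (SOME i. \<exists>k. a \<otimes> c = c [^] (k::nat) \<otimes> a [^] i) [:0, 1:])"
      by (simp add: gam_def cg_iff)
    show "ideal.cg [:0, 1:] (gsum j gam)"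
      using cj_cm_a[OF kj, of 1] by (simp add: cg_iff cm_c_gsum)
    show "\<exists>t. ideal.cg (([:0, 1:] - 1) * p) (gsum t gam)" for p
    proof -
      \<comment> \<open>(X - 1)p applied to w is the commutator [a, u]. Written as a^k c^t, u leaves
        only [a, c^t], a geometric sum in \<open>gam\<close>.\<close>
      define u where "u = inv (pact p w)"
      have u: "u \<in> V" by (simp add: u_def)
      then obtain k t :: nat where kt: "u = a [^] k \<otimes> c [^] t" using V_prods prodsE by blast
      have "cm a u = cj (pact p w) a \<otimes> inv (pact p w)"
        using cm_eq'[of a "inv (pact p w)"] by (simp add: u_def)
      also have "\<dots> = pact ([:0, 1:] * p - p) w"
        using pact_add[of w "[:0, 1:] * p" "- p"] by (simp add: pact_minus pact_X_mult)
      also have "[:0, 1:] * p - p = ([:0, 1:] - 1) * p" by (simp add: left_diff_distrib)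
      finally have "pact (([:0, 1:] - 1) * p) w = pact (gsum t gam) w"
        using cm_a_prod[of 1 k t] by (simp add: kt cm_c_gsum)
      then show ?thesis unfolding cg_iff by blast
    qed
    show "\<exists>t. ideal.cg ((gam - 1) * p) (gsum t [:0, 1:])" for p
    proof -
      \<comment> \<open>Dually, (gam - 1)p applied to w is the commutator of c^k a^t with
        \<open>c\<close>, which is [a^t, c].\<close>
      have "pact p w \<in> prods" using V_prods by auto
      then obtain k t :: nat where kt: "pact p w = c [^] k \<otimes> a [^] t" by (rule prodsE')
      have "cm (pact p w) c = cj (pact p w) c \<otimes> inv (pact p w)"
        using V_commute[of "inv (pact p w)" "cj (pact p w) c"] cm_eq[of "pact p w" c] by simp
      also have "\<dots> = pact (gam * p - p) w"
        using pact_add[of w "gam * p" "- p"] by (simp add: pact_minus cj_pact_w_c)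
      also have "gam * p - p = (gam - 1) * p" by (simp add: left_diff_distrib)
      finally have "pact ((gam - 1) * p) w = pact (gsum t [:0, 1:]) w"
        using cm_c_prod[of k t 1] by (simp add: kt cm_a_gsum)
      then show ?thesis unfolding cg_iff by blast
    qed
    show "bet (p + q) = bet p + bet q" "bet (p * q) = bet p * bet q" for p q
      by (simp_all add: bet_def pcompose_add pcompose_mult)
    show "bet 1 = 1" by (simp add: bet_def pcompose_1)
    show "bet p \<in> J" if "p \<in> J" for p using that by (rule bet_J)
    show "ideal.cg (bet [:0, 1:]) ([:0, 1:] ^ (2 * n - 1))"
      by (simp add: bet_def pcompose_pCons)
  qed
  obtain p where p: "v = pact p w" using V_eq[OF assms] .
  have "ideal.cg ([:0, 1:] ^ 4) 1" using R.alpha_4 by (simp add: ideal.cg_def)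
  then have "ideal.cg ([:0, 1:] ^ 4 * p) (1 * p)" by (rule ideal.cg_multr)
  then have "pact ([:0, 1:] ^ 4 * p) w = pact p w" by (simp add: cg_iff)
  then have "pact ([:0, 1:] ^ 4) (pact p w) = pact p w" using pact_mult[of w "[:0, 1:] ^ 4" p] by simp
  then show ?thesis unfolding p by (simp add: pact_X_pow)
qed

end

section \<open>The central part of the conjugate of a fourth power\<close>

text \<open>The conjugate of a^4 under \<open>c\<close> may involve e = c^j, centralized by
  \<open>a\<close>; the aim is e = 1. \<open>core_free\<close> is core-freeness of
  \<langle>c\<rangle> in the form that is applied. The bounds on k and l are normalizations that
  allow cancelling \<kappa> - 1 and forming l - 1.\<close>

locale central_twist = twisted_cyclic_product +
  fixes k l s j :: nat
  assumes ord_a: "ord a = 4 * n"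
    and disjoint: "\<And>i i'. a [^] (i::int) = c [^] (i'::int) \<Longrightarrow> a [^] i = \<one>"
    and core_free: "\<And>z. \<lbrakk>c [^] (z::int) \<otimes> a = a \<otimes> c [^] z; \<exists>z'::int. cj (c [^] z) b = c [^] z';
        cj (c [^] z) b \<otimes> a = a \<otimes> cj (c [^] z) b\<rbrakk> \<Longrightarrow> c [^] z = \<one>"
    and k_ge: "k \<ge> 2" and l_pos: "l \<ge> 1"
    and cj_x_c': "cj (a [^] (4::nat)) c = (a [^] (4::nat)) [^] k \<otimes> c [^] j"
    and e_a: "c [^] j \<otimes> a = a \<otimes> c [^] j"
    and d_eq: "cj c b = a [^] s \<otimes> c [^] l"
begin

definition x :: 'a where "x = a [^] (4::nat)"
definition e :: 'a where "e = c [^] j"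
definition f :: 'a where "f = cj e b"
definition d :: 'a where "d = cj c b"
definition \<tau> :: int where "\<tau> = int (ord e)"
definition \<kappa> :: int where "\<kappa> = int k ^ l"
definition u :: int where "u = int k - \<kappa>"

text \<open>Coordinates on \<langle>x\<rangle>\<langle>e\<rangle>, a direct product: by
  \<open>xe_eq\<close> the exponents count modulo n and \<tau>. Conjugations by \<open>b\<close> and
  \<open>c\<close> become linear maps on exponent pairs.\<close>

definition xe :: "int \<Rightarrow> int \<Rightarrow> 'a" where
  "xe A B = x [^] A \<otimes> e [^] B"

lemma x_in [simp]: "x \<in> carrier G" and e_in [simp]: "e \<in> carrier G"
  and f_in [simp]: "f \<in> carrier G" and d_in [simp]: "d \<in> carrier G"
  by (simp_all add: x_def e_def f_def d_def)

lemma xe_in [simp]: "xe A B \<in> carrier G"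
  by (simp add: xe_def)

lemma int_pow_commute: "\<lbrakk>g \<in> carrier G; h \<in> carrier G; g \<otimes> h = h \<otimes> g\<rbrakk> \<Longrightarrow> g [^] (i::int) \<otimes> h = h \<otimes> g [^] i"
proof -
  assume gh: "g \<in> carrier G" "h \<in> carrier G" "g \<otimes> h = h \<otimes> g"
  then have "cj g h = g" by (simp add: cj_eq_iff)
  then have "cj (g [^] i) h = g [^] i" using gh by (simp add: cj_int_pow)
  then show ?thesis using gh by (simp add: cj_eq_iff)
qed

lemma commute_int_pow: "\<lbrakk>g \<in> carrier G; h \<in> carrier G; g \<otimes> h = h \<otimes> g\<rbrakk> \<Longrightarrow> g \<otimes> h [^] (i::int) = h [^] i \<otimes> g"
  using int_pow_commute[of h g i] by simp

lemma commute_mult: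
  assumes "g \<in> carrier G" "h \<in> carrier G" "h' \<in> carrier G" "g \<otimes> h = h \<otimes> g" "g \<otimes> h' = h' \<otimes> g"
  shows "g \<otimes> (h \<otimes> h') = (h \<otimes> h') \<otimes> g"
proof -
  have "g \<otimes> (h \<otimes> h') = (g \<otimes> h) \<otimes> h'" using assms(1-3) by (simp only: m_assoc)
  also have "\<dots> = h \<otimes> (g \<otimes> h')" unfolding assms(4) using assms(1-3) by (simp only: m_assoc)
  also have "\<dots> = (h \<otimes> h') \<otimes> g" unfolding assms(5) using assms(1-3) by (simp only: m_assoc)
  finally show ?thesis .
qed

lemma e_prods: "z \<in> prods \<Longrightarrow> e \<otimes> z = z \<otimes> e"
proof -
  have "e \<otimes> a [^] i = a [^] i \<otimes> e" for i :: nat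
    using commute_int_pow[of e a "int i"] e_a by (simp add: e_def int_pow_int)
  moreover have "e \<otimes> c [^] i = c [^] i \<otimes> e" for i :: nat
    by (simp add: e_def nat_pow_comm)
  ultimately show "z \<in> prods \<Longrightarrow> e \<otimes> z = z \<otimes> e"
    by (elim prodsE) (simp add: commute_mult)
qed

lemma f_prods: "z \<in> prods \<Longrightarrow> f \<otimes> z = z \<otimes> f"
proof -
  assume z: "z \<in> prods"
  then have "e \<otimes> cj z b = cj z b \<otimes> e" by (simp add: e_prods cj_prods_b)
  then have "cj (e \<otimes> cj z b) b = cj (cj z b \<otimes> e) b" by simp
  then show ?thesis using z by (simp add: cj_mult prods_in cj_b_b f_def)
qed

lemma x_prods: "x \<in> prods"
  by (simp add: x_def)

lemma xe_mult: "xe A B \<otimes> xe A' B' = xe (A + A') (B + B')"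
proof -
  have "e [^] B \<otimes> x [^] A' = x [^] A' \<otimes> e [^] B"
    by (intro commute_int_pow int_pow_commute) (simp_all add: e_prods x_prods)
  then have "xe A B \<otimes> xe A' B' = x [^] A \<otimes> (x [^] A' \<otimes> e [^] B) \<otimes> e [^] B'"
    by (simp add: xe_def m_assoc) (simp flip: m_assoc)
  then show ?thesis by (simp add: xe_def int_pow_mult m_assoc)
qed

lemma xe_0 [simp]: "xe 0 0 = \<one>"
  by (simp add: xe_def)

lemma xe_inv: "inv (xe A B) = xe (- A) (- B)"
  by (rule inv_equality) (simp_all add: xe_mult)

lemma xe_nat_pow: "xe A B [^] (m::nat) = xe (int m * A) (int m * B)"
  by (induction m) (simp_all add: xe_mult algebra_simps)

lemma xe_pow: "xe A B [^] (m::int) = xe (m * A) (m * B)"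
  by (cases m) (simp_all only: int_pow_int int_pow_neg_int xe_nat_pow xe_inv xe_in minus_mult_left of_nat_mult)

lemma x_pow_xe: "x [^] A = xe A 0" and e_pow_xe: "e [^] B = xe 0 B"
  by (simp_all add: xe_def)

lemma x_xe: "x = xe 1 0" and e_xe: "e = xe 0 1"
  by (simp_all add: xe_def)

lemma x_pow_1: "x [^] (A::int) = \<one> \<longleftrightarrow> int n dvd A"
proof -
  have "ord x = n" using n_pos by (simp add: x_def ord_pow_gen ord_a)
  then show ?thesis by (simp add: int_pow_eq_id)
qed

lemma e_pow_1: "e [^] (B::int) = \<one> \<longleftrightarrow> \<tau> dvd B"
  by (simp add: int_pow_eq_id \<tau>_def)

lemma e_pow_c: "e [^] (B::int) = c [^] (int j * B)"
  using int_pow_pow[of c "int j" B] by (simp only: e_def int_pow_int c_in)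

lemma x_pow_a: "x [^] (B::int) = a [^] (4 * B)"
proof -
  have "x = a [^] (4::int)" unfolding x_def using int_pow_int[of G a 4] by simp
  then show ?thesis using int_pow_pow[OF a_in, of 4 B] by simp
qed

lemma xe_in_c: assumes "xe A B = c [^] (z::int)" shows "int n dvd A"
proof -
  have "x [^] A = c [^] z \<otimes> inv (e [^] B)"
    using assms by (simp add: inv_solve_right xe_def)
  also have "\<dots> = c [^] (z - int j * B)" by (simp add: e_pow_c int_pow_diff)
  finally show ?thesis using disjoint[of "4 * A"] by (simp only: x_pow_1[symmetric] x_pow_a)
qed

lemma xe_eq_1: "xe A B = \<one> \<longleftrightarrow> int n dvd A \<and> \<tau> dvd B"
proof
  assume *: "xe A B = \<one>"
  then have 1: "int n dvd A" using xe_in_c[of A B 0] by simp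
  then have "x [^] A = \<one>" by (simp add: x_pow_1)
  then have "e [^] B = \<one>" using * by (simp add: xe_def)
  with 1 show "int n dvd A \<and> \<tau> dvd B" by (simp add: e_pow_1)
next
  assume "int n dvd A \<and> \<tau> dvd B"
  then have "x [^] A = \<one>" "e [^] B = \<one>" by (simp_all only: x_pow_1 e_pow_1)
  then show "xe A B = \<one>" by (simp add: xe_def)
qed

lemma xe_eq: "xe A B = xe A' B' \<longleftrightarrow> int n dvd A - A' \<and> \<tau> dvd B - B'"
proof -
  have "xe A B = xe A' B' \<longleftrightarrow> xe A B \<otimes> inv (xe A' B') = \<one>"
    by (simp add: inv_solve_right')
  then show ?thesis by (simp add: xe_inv xe_mult xe_eq_1)
qed

lemma cj_x_c: "cj x c = xe (int k) 1"
  using cj_x_c' by (simp add: xe_def x_def e_def int_pow_int)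

lemma cj_prods_e: "z \<in> prods \<Longrightarrow> cj e z = e"
  by (simp add: cj_eq_iff e_prods prods_in)

lemma cj_xe_c: "cj (xe A B) c = xe (int k * A) (A + B)"
proof -
  have "cj (xe A B) c = (cj x c) [^] A \<otimes> (cj e c) [^] B"
    by (simp add: xe_def cj_mult cj_int_pow)
  also have "cj e c = e" using cj_prods_e[of c] c_pow_prods[of 1] by simp
  finally show ?thesis by (simp add: cj_x_c xe_pow e_pow_xe xe_mult mult.commute)
qed

text \<open>The i-th iterate of (A, B) to (kA, A + B).\<close>

lemma cj_xe_c_pow: "cj (xe A B) (c [^] (i::nat)) = xe (int k ^ i * A) (gsum i (int k) * A + B)"
proof (induction i)
  case (Suc i)
  have "cj (xe A B) (c [^] Suc i) = cj (cj (xe A B) (c [^] i)) c" by (simp add: cj_cj)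
  also have "\<dots> = xe (int k ^ Suc i * A) (gsum (Suc i) (int k) * A + B)"
    unfolding Suc cj_xe_c by (simp add: gsum_Suc algebra_simps)
  finally show ?case .
qed simp

lemma cj_xe_a_pow: "cj (xe A B) (a [^] (i::nat)) = xe A B"
proof -
  have "cj x (a [^] i) = x" by (simp add: x_def cj_eq_iff nat_pow_comm)
  then show ?thesis by (simp add: xe_def cj_mult cj_int_pow cj_prods_e)
qed

text \<open>4(2n - 1) = 8n - 4 is -4 modulo 4n.\<close>

lemma cj_x_b: "cj x b = inv x"
proof -
  have "4 * (2 * n - 1) + 4 = 4 * n * 2" using n_pos by simp
  then have "a [^] (4 * (2 * n - 1)) \<otimes> x = (a [^] (4 * n)) [^] (2::nat)"
    by (simp add: x_def nat_pow_mult nat_pow_pow)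
  also have "\<dots> = \<one>" by (simp add: a_order)
  finally have "inv x = a [^] (4 * (2 * n - 1))" by (intro inv_equality) simp_all
  moreover have "cj x b = a [^] (4 * (2 * n - 1))"
    by (simp add: x_def cj_pow cj_a_b nat_pow_pow mult.commute)
  ultimately show ?thesis by simp
qed

lemma cj_d: "z \<in> carrier G \<Longrightarrow> cj z d = cj (cj (cj z b) c) b"
proof -
  have "inv b = b" using b_square by (intro inv_equality) simp_all
  then have "d = b \<otimes> c \<otimes> b" by (simp add: d_def conj_by_def)
  then show "z \<in> carrier G \<Longrightarrow> cj z d = cj (cj (cj z b) c) b" by (simp add: cj_cj m_assoc)
qed

text \<open>Both e^i and its conjugate under \<open>b\<close> lie in \<langle>c\<rangle> and commute
  with \<open>a\<close>, so \<open>core_free\<close> applies. In effect \<langle>e\<rangle> meets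
  \<langle>f\<rangle> trivially.\<close>

lemma e_pow_trivial:
  assumes "cj (e [^] (i::int)) b = e [^] (i'::int)" shows "e [^] i = \<one>"
  unfolding e_pow_c
proof (rule core_free)
  have comm: "e [^] z \<otimes> a = a \<otimes> e [^] z" for z :: int
    using a_pow_prods[of 1] by (intro int_pow_commute) (simp_all add: e_prods)
  show "c [^] (int j * i) \<otimes> a = a \<otimes> c [^] (int j * i)"
    unfolding e_pow_c[symmetric] by (rule comm)
  show "\<exists>z'. cj (c [^] (int j * i)) b = c [^] (z'::int)"
    unfolding e_pow_c[symmetric] assms unfolding e_pow_c by blast
  show "cj (c [^] (int j * i)) b \<otimes> a = a \<otimes> cj (c [^] (int j * i)) b"
    unfolding e_pow_c[symmetric] assms by (rule comm)
qed

text \<open>Computing x^d once through d = b c b and once through d = a^s c^l gives f = x^u e^v.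
  Conjugating by \<open>b\<close> again must return e, which by \<open>e_pow_trivial\<close> forces
  e^v = e.\<close>

lemma f_eq: "f = xe u 1" and gsum_l: "\<tau> dvd gsum l (int k) + 1"
proof -
  define v where "v = - gsum l (int k)"
  have "cj (inv x) c = xe (- int k) (- 1)"
    by (simp add: cj_inv cj_x_c xe_inv)
  then have "cj x d = cj (xe (- int k) (- 1)) b" by (simp add: cj_d cj_x_b)
  also have "\<dots> = (inv x) [^] (- int k) \<otimes> f [^] (- 1 :: int)"
    by (simp only: xe_def cj_mult cj_int_pow cj_x_b f_def x_in e_in b_in int_pow_closed)
  also have "\<dots> = x [^] int k \<otimes> inv f"
    by (simp only: int_pow_inv int_pow_neg int_pow_1 inv_inv x_in f_in int_pow_closed)
  finally have 1: "cj x d = x [^] int k \<otimes> inv f" .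
  have "cj x d = cj (cj x (a [^] s)) (c [^] l)" by (simp add: d_def d_eq cj_cj)
  also have "\<dots> = xe \<kappa> (- v)"
    using cj_xe_a_pow[of 1 0] cj_xe_c_pow[of 1 0 l] by (simp add: x_xe[symmetric] \<kappa>_def v_def)
  finally have "x [^] int k \<otimes> inv f = xe \<kappa> (- v)" using 1 by simp
  then have "x [^] int k = xe \<kappa> (- v) \<otimes> f" by (simp add: inv_solve_right')
  then have "f = inv (xe \<kappa> (- v)) \<otimes> x [^] int k" by (simp add: inv_solve_left)
  then have f: "f = xe u v" by (simp add: xe_inv x_pow_xe xe_mult u_def)
  have "e = cj f b" by (simp add: f_def cj_b_b)
  also have "\<dots> = cj (xe u v) b" using f by simp
  also have "\<dots> = (inv x) [^] u \<otimes> f [^] v"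
    by (simp only: xe_def cj_mult cj_int_pow cj_x_b f_def x_in e_in b_in int_pow_closed)
  also have "\<dots> = x [^] (- u) \<otimes> f [^] v"
    by (simp only: int_pow_inv int_pow_neg x_in)
  also have "\<dots> = xe (u * (v - 1)) (v * v)"
    by (simp add: f xe_pow x_pow_xe xe_mult algebra_simps)
  finally have "xe 0 1 = xe (u * (v - 1)) (v * v)" by (simp add: e_xe[symmetric])
  then have 2: "int n dvd u * (v - 1)" unfolding xe_eq by simp
  have "cj (e [^] (v - 1)) b = xe 0 ((v - 1) * v)"
    using 2 by (simp add: cj_int_pow f_def[symmetric] f xe_pow xe_eq mult.commute)
  then have "e [^] (v - 1) = \<one>" unfolding e_pow_xe[symmetric] by (rule e_pow_trivial)
  then have "\<tau> dvd v - 1" by (simp add: e_pow_1)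
  then show "f = xe u 1" unfolding f xe_eq by simp
  show "\<tau> dvd gsum l (int k) + 1"
    using \<open>\<tau> dvd v - 1\<close> by (metis v_def dvd_minus_iff minus_diff_eq diff_minus_eq_add add.commute)
qed

lemma cj_xe_b: "cj (xe A B) b = xe (u * B - A) B"
proof -
  have "cj (xe A B) b = (inv x) [^] A \<otimes> f [^] B"
    by (simp add: xe_def cj_mult cj_int_pow cj_x_b f_def)
  also have "(inv x) [^] A = xe (- A) 0"
    by (simp add: int_pow_inv x_pow_xe xe_inv)
  finally show ?thesis by (simp add: f_eq xe_pow xe_mult mult.commute)
qed

text \<open>(e^i)^b = x^(u i) e^i lies in \<langle>e\<rangle> exactly when n divides u i; by
  \<open>e_pow_trivial\<close> that means e^i = 1.\<close>

lemma n_dvd_u_iff: "int n dvd u * i \<longleftrightarrow> \<tau> dvd i"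
proof
  have cje: "cj (e [^] i) b = xe (u * i) i" for i by (simp add: e_pow_xe cj_xe_b)
  show "\<tau> dvd i" if "int n dvd u * i"
  proof -
    have "cj (e [^] i) b = e [^] i" unfolding cje using that by (simp add: e_pow_xe xe_eq)
    then have "e [^] i = \<one>" by (rule e_pow_trivial)
    then show ?thesis by (simp add: e_pow_1)
  qed
  show "int n dvd u * i" if "\<tau> dvd i"
  proof -
    have "e [^] i = \<one>" using that by (simp add: e_pow_1)
    then have "xe (u * i) i = \<one>" using cje[of i] by simp
    then show ?thesis by (simp add: xe_eq_1)
  qed
qed

text \<open>x^u = f e^(-1) is centralized by \<open>c\<close>, whereas conjugation by
  \<open>c\<close> takes it to x^(k u) e^u.\<close>

lemma tau_u: "\<tau> dvd u" and tau_k: "\<tau> dvd int k - 1"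
proof -
  have "xe u 0 = f \<otimes> inv e" by (simp add: f_eq e_xe xe_inv xe_mult)
  moreover have "cj f c = f" using f_prods[of c] c_pow_prods[of 1] by (simp add: cj_eq_iff)
  moreover have "cj e c = e" using cj_prods_e[of c] c_pow_prods[of 1] by simp
  ultimately have "cj (xe u 0) c = xe u 0" by (simp add: cj_mult cj_inv)
  then have "int n dvd int k * u - u" "\<tau> dvd u" by (simp_all add: cj_xe_c xe_eq)
  then show "\<tau> dvd u" "\<tau> dvd int k - 1"
    using n_dvd_u_iff[of "int k - 1"] by (simp_all add: algebra_simps)
qed

lemma tau_pow_k: "\<tau> dvd int k ^ i - 1"
  using dvd_mult2[OF tau_k, of "gsum i (int k)"] by (simp only: gsum_mult)

lemma tau_gsum: "\<tau> dvd q - 1 \<Longrightarrow> \<tau> dvd gsum i q - int i"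
proof (induction i)
  case (Suc i)
  then have "\<tau> dvd gsum i q - int i" "\<tau> dvd q ^ i - 1"
    using dvd_mult2[OF Suc.prems, of "gsum i q"] by (simp_all only: gsum_mult)
  then have "\<tau> dvd (gsum i q - int i) + (q ^ i - 1)" by (rule dvd_add)
  then show ?case by (simp add: gsum_Suc algebra_simps)
qed simp

text \<open>As k is 1 modulo \<tau>, \<open>gsum l (int k)\<close> is l modulo \<tau>; compare with
  \<open>gsum_l\<close>.\<close>

lemma tau_l: "\<tau> dvd int l + 1"
proof -
  have "\<tau> dvd (gsum l (int k) + 1) - (gsum l (int k) - int l)"
    using gsum_l tau_gsum[OF tau_k] by (rule dvd_diff)
  then show ?thesis by (simp add: add.commute)
qed

text \<open>D is gcd(u, n) up to sign. By \<open>n_dvd_u_iff\<close> the cofactor of D in n has the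
  same multiples as \<tau>. Since \<tau> divides u = D u' and is prime to u', it divides D; so
  \<tau>^2 divides n.\<close>

lemma tau_square:
  obtains D u' where "int n = D * \<tau>" "u = D * u'" "coprime u' \<tau>" "\<tau> dvd D"
proof -
  have "gcd u (int n) \<noteq> 0" using n_pos by simp
  then obtain u' n' where *: "u = u' * gcd u (int n)" "int n = n' * gcd u (int n)" "coprime u' n'"
    using gcd_coprime_exists by blast
  define D where "D = gcd u (int n)"
  have D: "u = u' * D" "int n = n' * D" "D \<noteq> 0" using * n_pos by (simp_all add: D_def)
  have iff: "n' dvd i \<longleftrightarrow> \<tau> dvd i" for i
  proof -
    have "int n dvd u * i \<longleftrightarrow> n' * D dvd u' * i * D" by (simp add: D mult_ac)
    also have "\<dots> \<longleftrightarrow> n' dvd u' * i" using D(3) by simp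
    also have "\<dots> \<longleftrightarrow> n' dvd i" using *(3) by (simp add: coprime_commute coprime_dvd_mult_right_iff)
    finally show ?thesis using n_dvd_u_iff by simp
  qed
  have n'\<tau>: "\<tau> dvd n'" "n' dvd \<tau>" using iff[of n'] iff[of \<tau>] by simp_all
  then obtain t t' where t: "n' = \<tau> * t" "\<tau> = n' * t'" unfolding dvd_def by blast
  then have "n' * (t' * t) = n' * 1" by simp
  moreover have "n' \<noteq> 0" using D n_pos by auto
  ultimately have "t' * t = 1" by (metis mult_cancel_left)
  then have t1: "t * t = 1" by (auto simp: zmult_eq_1_iff)
  have c: "coprime u' \<tau>" using *(3) t(1) by simp
  have "int n = (t * D) * \<tau>" using D(2) t(1) by simp
  moreover have "u = (t * D) * (t * u')" 
  proof -
    have "(t * D) * (t * u') = (t * t) * (u' * D)" by (simp only: mult_ac)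
    then show ?thesis using D(1) t1 by simp
  qed
  moreover have "coprime (t * u') \<tau>"
  proof -
    have "t = 1 \<or> t = - 1" using \<open>t' * t = 1\<close> by (auto simp: zmult_eq_1_iff)
    then show ?thesis using c by auto
  qed
  moreover have "\<tau> dvd t * D"
  proof -
    have "coprime (t * u') \<tau>" by fact
    moreover have "\<tau> dvd (t * u') * (t * D)" using tau_u \<open>u = (t * D) * (t * u')\<close> by (simp only: mult.commute)
    ultimately show ?thesis by (simp only: coprime_commute coprime_dvd_mult_right_iff)
  qed
  ultimately show ?thesis using that by blast
qed

lemma c_pow_int: "c [^] (i::nat) = c [^] int i"
  by (simp only: int_pow_int)

lemma mult_eq_cj: "\<lbrakk>g \<in> carrier G; h \<in> carrier G\<rbrakk> \<Longrightarrow> g \<otimes> h = h \<otimes> cj g h"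
  by (simp add: group_simps)

lemma d_eq': "d = a [^] s \<otimes> c [^] l"
  by (simp add: d_def d_eq)

lemma cj_a_pow_b: "cj (a [^] s) b = inv (a [^] s \<otimes> a [^] (2 * n * s))"
proof -
  have "(2 * n - 1) * s + (s + 2 * n * s) = 4 * n * s"
    using n_pos by (cases n) (simp_all add: algebra_simps)
  then have "a [^] ((2 * n - 1) * s) \<otimes> (a [^] s \<otimes> a [^] (2 * n * s)) = (a [^] (4 * n)) [^] s"
    by (simp only: nat_pow_mult nat_pow_pow a_in)
  also have "\<dots> = \<one>" by (simp add: a_order)
  finally have "a [^] ((2 * n - 1) * s) = inv (a [^] s \<otimes> a [^] (2 * n * s))"
    by (intro inv_equality[symmetric]) simp_all
  then show ?thesis by (simp add: cj_pow cj_a_b nat_pow_pow)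
qed

text \<open>Conjugate d = a^s c^l by \<open>b\<close>, using d^b = c. The factor a^(2ns) measures
  the failure of \<open>b\<close> to invert a^s.\<close>

lemma d_pow_l: "d [^] l = a [^] s \<otimes> a [^] (2 * n * s) \<otimes> c"
proof -
  have "c = cj d b" by (simp add: d_def cj_b_b)
  also have "\<dots> = cj (a [^] s) b \<otimes> (cj c b) [^] l"
    unfolding d_eq' by (simp only: cj_mult cj_pow nat_pow_closed a_in c_in b_in)
  also have "\<dots> = inv (a [^] s \<otimes> a [^] (2 * n * s)) \<otimes> d [^] l"
    by (simp only: cj_a_pow_b d_def)
  finally show ?thesis by (subst (asm) inv_solve_left) simp_all
qed

lemma d_pow_l1: "d [^] (l - 1) = inv (c [^] l) \<otimes> a [^] (2 * n * s) \<otimes> c"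
proof -
  have "d \<otimes> d [^] (l - 1) = d [^] l" using l_pos by (simp flip: nat_pow_Suc2)
  then have "d [^] (l - 1) = inv d \<otimes> (a [^] s \<otimes> a [^] (2 * n * s) \<otimes> c)"
    unfolding d_pow_l[symmetric] by (intro inv_solve_left[THEN iffD2]) simp_all
  then show ?thesis unfolding d_eq' by (simp add: inv_mult_group m_assoc inv_cancel)
qed

lemma cj_x_pow_power: "int n dvd int k ^ i - 1" if "cj x (c [^] i) = x" for i
  using that cj_xe_c_pow[of 1 0 i] by (simp add: x_xe xe_eq)

lemma kappa_ge: "\<kappa> \<ge> 2"
proof -
  have "(2::int) ^ 1 \<le> 2 ^ l" using l_pos by (intro power_increasing) simp_all
  also have "\<dots> \<le> int k ^ l" using k_ge by (intro power_mono) simp_all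
  finally show ?thesis by (simp add: \<kappa>_def)
qed

text \<open>Now a^(2ns) = 1 and a^s is a power of x, so powers of d can be computed in coordinates.
  The values of d^(l-1) and d^j = f give congruences modulo n that combine to one modulo n^2.
  Dividing by D^2 leaves \<tau> | l, and \<tau> | l + 1 is known.\<close>

lemma tau_1_if_4_dvd:
  assumes "4 dvd s" shows "\<tau> = 1"
proof -
  obtain s' where s': "s = 4 * s'" using assms by blast
  have "2 * n * s = 4 * n * (2 * s')" by (simp add: s')
  then have "a [^] (2 * n * s) = (a [^] (4 * n)) [^] (2 * s')"
    by (simp only: nat_pow_pow a_in)
  then have "a [^] (2 * n * s) = \<one>" by (simp add: a_order)
  then have "d [^] (l - 1) = inv (c [^] l) \<otimes> c" using d_pow_l1 by simp
  also have "\<dots> = c [^] (- int l) \<otimes> c [^] (1::int)"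
    by (simp only: int_pow_neg_int int_pow_1 c_in)
  also have "\<dots> = c [^] (- int l + 1)" by (simp only: int_pow_mult c_in)
  also have "\<dots> = c [^] (1 - int l)" by simp
  finally have d1: "d [^] (l - 1) = c [^] (1 - int l)" .
  define s2 where "s2 = \<kappa> * int s'"
  define t2 where "t2 = gsum l (int k) * int s'"
  have ys: "a [^] s = xe (int s') 0"
    unfolding x_pow_xe[symmetric] by (simp add: x_def int_pow_int nat_pow_pow s')
  have cjy: "cj (a [^] s) (c [^] l) = xe s2 t2"
    unfolding ys cj_xe_c_pow by (simp add: s2_def t2_def \<kappa>_def)
  have d: "d = c [^] l \<otimes> xe s2 t2"
    unfolding d_eq' cjy[symmetric] by (rule mult_eq_cj) simp_all
  \<comment> \<open>Only the exponent of x is tracked.\<close>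
  have dpow: "\<exists>B. d [^] i = c [^] (l * i) \<otimes> xe (s2 * gsum i \<kappa>) B" for i :: nat
  proof (induction i)
    case 0
    have "d [^] (0::nat) = c [^] (l * 0) \<otimes> xe (s2 * gsum 0 \<kappa>) 0" by simp
    then show ?case by blast
  next
    case (Suc i)
    then obtain B where B: "d [^] i = c [^] (l * i) \<otimes> xe (s2 * gsum i \<kappa>) B" by blast
    have "xe (s2 * gsum i \<kappa>) B \<otimes> c [^] l = c [^] l \<otimes> cj (xe (s2 * gsum i \<kappa>) B) (c [^] l)"
      by (rule mult_eq_cj) simp_all
    then have "d [^] Suc i = c [^] (l * i) \<otimes> (c [^] l \<otimes> cj (xe (s2 * gsum i \<kappa>) B) (c [^] l)) \<otimes> xe s2 t2"
      unfolding nat_pow_Suc B using d by (simp add: m_assoc) (simp add: m_assoc[symmetric])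
    also have "\<dots> = c [^] (l * i + l) \<otimes> (cj (xe (s2 * gsum i \<kappa>) B) (c [^] l) \<otimes> xe s2 t2)"
      by (simp add: m_assoc flip: nat_pow_mult)
    also have "cj (xe (s2 * gsum i \<kappa>) B) (c [^] l) \<otimes> xe s2 t2
        = xe (s2 * gsum (Suc i) \<kappa>) (gsum l (int k) * (s2 * gsum i \<kappa>) + B + t2)"
      unfolding cj_xe_c_pow xe_mult by (simp add: gsum_Suc' \<kappa>_def algebra_simps)
    finally show ?case by (auto simp: add.commute)
  qed
  obtain B where "d [^] (l - 1) = c [^] (l * (l - 1)) \<otimes> xe (s2 * gsum (l - 1) \<kappa>) B" using dpow by blast
  then have "xe (s2 * gsum (l - 1) \<kappa>) B = inv (c [^] (l * (l - 1))) \<otimes> c [^] (1 - int l)"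
    unfolding d1 by (simp add: inv_solve_left)
  also have "\<dots> = c [^] (1 - int l - int (l * (l - 1)))"
    by (simp only: c_pow_int int_pow_neg[symmetric] int_pow_mult[symmetric] c_in) (simp add: algebra_simps)
  finally have 1: "int n dvd s2 * gsum (l - 1) \<kappa>" by (rule xe_in_c)
  have "f = d [^] j" by (simp add: f_def e_def d_def cj_pow)
  moreover obtain B' where "d [^] j = c [^] (l * j) \<otimes> xe (s2 * gsum j \<kappa>) B'" using dpow by blast
  moreover have "c [^] (l * j) = xe 0 (int l)"
    by (simp add: e_pow_xe[symmetric] e_pow_c c_pow_int mult.commute)
  ultimately have "xe u 1 = xe 0 (int l) \<otimes> xe (s2 * gsum j \<kappa>) B'" by (simp add: f_eq)
  then have "int n dvd u - s2 * gsum j \<kappa>" by (simp add: xe_mult xe_eq)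
  then have 2: "int n dvd s2 * gsum j \<kappa> - u" by (simp add: dvd_diff_commute)
  have "cj x e = x" using e_prods[OF x_prods] by (simp add: cj_eq_iff)
  then have "int n dvd int k ^ j - 1" by (intro cj_x_pow_power) (simp add: e_def)
  then have "int n dvd (int k ^ j - 1) * gsum l (int k ^ j)" by simp
  then have 3: "int n dvd \<kappa> ^ j - 1"
    unfolding gsum_mult \<kappa>_def by (simp add: mult.commute flip: power_mult)
  obtain n1 where n1: "s2 * gsum (l - 1) \<kappa> = int n * n1" using 1 by blast
  obtain n2 where n2: "\<kappa> ^ j - 1 = int n * n2" using 3 by blast
  obtain n3 where n3: "s2 * gsum j \<kappa> = u + int n * n3" using 2 by (metis dvd_def diff_eq_eq add.commute)
  \<comment> \<open>The factor \<kappa> - 1 turns a geometric sum into a power minus 1 and is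
    cancelled afterwards.\<close>
  have "(\<kappa> - 1) * ((\<kappa> ^ (l - 1) - 1) * (u + int n * n3)) = (\<kappa> - 1) * (int n * n1 * (int n * n2))"
  proof -
    have "(\<kappa> - 1) * ((\<kappa> ^ (l - 1) - 1) * (u + int n * n3))
        = (\<kappa> - 1) * (((\<kappa> - 1) * gsum (l - 1) \<kappa>) * (s2 * gsum j \<kappa>))" by (simp only: gsum_mult n3)
    also have "\<dots> = (\<kappa> - 1) * ((s2 * gsum (l - 1) \<kappa>) * ((\<kappa> - 1) * gsum j \<kappa>))" by (simp only: mult_ac)
    also have "\<dots> = (\<kappa> - 1) * (int n * n1 * (int n * n2))" by (simp only: gsum_mult n1 n2)
    finally show ?thesis .
  qed
  then have 4: "(\<kappa> ^ (l - 1) - 1) * (u + int n * n3) = int n * n1 * (int n * n2)"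
    using kappa_ge by simp
  \<comment> \<open>Since k k^(l-1) = \<kappa>, multiplying k^(l-1) - 1 by k gives -u; q is the
    remaining factor of \<kappa>^(l-1) - 1.\<close>
  define q where "q = gsum l (int k ^ (l - 1))"
  have "\<kappa> ^ (l - 1) = (int k ^ (l - 1)) ^ l" by (simp add: \<kappa>_def mult.commute flip: power_mult)
  then have "int k * (\<kappa> ^ (l - 1) - 1) = int k * ((int k ^ (l - 1) - 1) * q)"
    by (simp add: q_def gsum_mult)
  also have "\<dots> = (int k * int k ^ (l - 1) - int k) * q" by (simp add: algebra_simps)
  also have "int k * int k ^ (l - 1) = \<kappa>" unfolding \<kappa>_def using l_pos by (simp flip: power_Suc)
  finally have 5: "int k * (\<kappa> ^ (l - 1) - 1) = - u * q" by (simp add: u_def)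
  have 6: "- u * q * (u + int n * n3) = int k * (int n * n1 * (int n * n2))"
    unfolding 5[symmetric] 4[symmetric] by (simp only: mult.assoc)
  obtain D u' where D: "int n = D * \<tau>" "u = D * u'" "coprime u' \<tau>" "\<tau> dvd D" by (rule tau_square)
  have "D \<noteq> 0" using D(1) n_pos by auto
  define w' where "w' = - int k * n1 * \<tau> * n2"
  have "D * D * (u' * q * (u' + \<tau> * n3)) = D * D * (\<tau> * w')"
    using 6 unfolding D(1,2) w'_def by (simp add: algebra_simps)
  then have "u' * q * (u' + \<tau> * n3) = \<tau> * w'" using \<open>D \<noteq> 0\<close> by simp
  then have "\<tau> dvd u' * q * (u' + \<tau> * n3)" by simp
  then have "\<tau> dvd u' * q * (u' + \<tau> * n3) - \<tau> * (u' * q * n3)" by (intro dvd_diff) simp_all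
  then have "\<tau> dvd u' * (u' * q)" by (simp add: algebra_simps)
  then have "\<tau> dvd q" using D(3) by (simp add: coprime_commute coprime_dvd_mult_right_iff)
  moreover have "\<tau> dvd q - int l" unfolding q_def by (rule tau_gsum[OF tau_pow_k])
  ultimately have "\<tau> dvd q - (q - int l)" by (rule dvd_diff)
  then have "\<tau> dvd int l" by simp
  then have "\<tau> dvd (int l + 1) - int l" using tau_l by (intro dvd_diff)
  then have "is_unit \<tau>" by simp
  then show ?thesis by (simp add: \<tau>_def)
qed

end

section \<open>The trace 1 + X + X^2 + X^3 and the bound on \<tau>\<close>

context cyclic_product
begin

lemma pact_fixed:
  assumes "v \<in> V" "cj v a = v" shows "pact p v = v [^] poly p 1"
proof (induction p)
  case (pCons m p)
  then show ?case using assms by (simp add: cj_int_pow int_pow_mult)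
qed simp

lemma pact_gsum_4: "v \<in> V \<Longrightarrow> pact (gsum 4 q) v = v \<otimes> (pact q v \<otimes> (pact (q ^ 2) v \<otimes> pact (q ^ 3) v))"
proof -
  assume v: "v \<in> V"
  have "gsum 4 q = 1 + (q + (q ^ 2 + q ^ 3))" by (simp add: gsum_def eval_nat_numeral)
  then show ?thesis using v by (simp only: pact_add pact_one)
qed

end

context central_twist
begin

lemma cj_a_mod_4: "v \<in> V \<Longrightarrow> cj v (a [^] (4 * m + t :: nat)) = cj v (a [^] t)"
proof (induction m)
  case (Suc m)
  have "a [^] (4 * Suc m + t) = a [^] (4::nat) \<otimes> a [^] (4 * m + t)"
    by (simp add: nat_pow_mult add.assoc)
  then have "cj v (a [^] (4 * Suc m + t)) = cj (cj v (a [^] (4::nat))) (a [^] (4 * m + t))"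
    using Suc.prems by (simp add: cj_cj)
  then show ?case using Suc cj_a_4 by simp
qed simp

text \<open>X^4 acts trivially on \<open>V\<close>, and multiplication by the odd number 2n - 1
  permutes the residues modulo 4.\<close>

lemma pact_bet_gsum_4:
  assumes "v \<in> V" shows "pact (bet (gsum 4 [:0, 1:])) v = pact (gsum 4 [:0, 1:]) v"
proof -
  define r where "r = 2 * n - 1"
  define \<xi> :: "int poly" where "\<xi> = [:0, 1:]"
  have pow_xi: "pact (\<xi> ^ m) v = cj v (a [^] m)" for m
    using assms pact_X_pow by (simp add: \<xi>_def)
  have xi1: "pact \<xi> v = cj v (a [^] (1::nat))" using pow_xi[of 1] by simp
  have "bet (gsum 4 \<xi>) = gsum 4 (\<xi> ^ r)"
    by (simp add: bet_def gsum_def pcompose_add pcompose_1 pcompose_mult pcompose_pCons \<xi>_def r_def eval_nat_numeral)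
  then have L: "pact (bet (gsum 4 \<xi>)) v
      = v \<otimes> (cj v (a [^] r) \<otimes> (cj v (a [^] (r * 2)) \<otimes> cj v (a [^] (r * 3))))"
    using assms by (simp only: pact_gsum_4 pow_xi power_mult[symmetric])
  have R: "pact (gsum 4 \<xi>) v = v \<otimes> (cj v (a [^] (1::nat)) \<otimes> (cj v (a [^] (2::nat)) \<otimes> cj v (a [^] (3::nat))))"
    using assms by (simp only: pact_gsum_4 xi1 pow_xi)
  have V: "cj v (a [^] m) \<in> V" for m :: nat using pow_xi[of m] pact_V[OF assms, of "\<xi> ^ m"] by simp
  have "odd r" using n_pos by (simp add: r_def)
  then consider m where "r = 4 * m + 1" | m where "r = 4 * m + 3"
  proof -
    have "r mod 4 = 1 \<or> r mod 4 = 3" using \<open>odd r\<close> by presburger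
    moreover have "r = 4 * (r div 4) + r mod 4" by simp
    ultimately show ?thesis using that by metis
  qed
  then show ?thesis
  proof cases
    case (1 m)
    have "r * 2 = 4 * (2 * m) + 2" "r * 3 = 4 * (3 * m) + 3" using 1 by simp_all
    then show ?thesis unfolding \<xi>_def[symmetric] L R unfolding 1 by (simp only: cj_a_mod_4 assms)
  next
    case (2 m)
    have "r * 2 = 4 * (2 * m + 1) + 2" "r * 3 = 4 * (3 * m + 2) + 1" using 2 by simp_all
    then have "pact (bet (gsum 4 \<xi>)) v = v \<otimes> (cj v (a [^] (3::nat)) \<otimes> (cj v (a [^] (2::nat)) \<otimes> cj v (a [^] (1::nat))))"
      unfolding L unfolding 2 by (simp only: cj_a_mod_4 assms)
    moreover have "cj v (a [^] (3::nat)) \<otimes> (cj v (a [^] (2::nat)) \<otimes> cj v (a [^] (1::nat)))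
        = cj v (a [^] (1::nat)) \<otimes> (cj v (a [^] (2::nat)) \<otimes> cj v (a [^] (3::nat)))"
    proof -
      have 32: "cj v (a [^] (3::nat)) \<otimes> (cj v (a [^] (2::nat)) \<otimes> cj v (a [^] (1::nat)))
          = (cj v (a [^] (2::nat)) \<otimes> cj v (a [^] (1::nat))) \<otimes> cj v (a [^] (3::nat))"
        by (intro V_commute V_mult V)
      have 21: "cj v (a [^] (2::nat)) \<otimes> cj v (a [^] (1::nat)) = cj v (a [^] (1::nat)) \<otimes> cj v (a [^] (2::nat))"
        by (intro V_commute V)
      show ?thesis unfolding 32 unfolding 21 by (intro m_assoc V_in V)
    qed
    ultimately show ?thesis unfolding \<xi>_def[symmetric] R by simp
  qed
qed

text \<open>This is [x, c], the trace of \<open>w\<close>; it commutes with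
  \<open>a\<close>.\<close>

definition \<eta> :: 'a where "\<eta> = xe (int k - 1) 1"

lemma eta_cm: "cm x c = \<eta>"
  by (simp add: cm_eq cj_x_c \<eta>_def xe_mult x_xe[symmetric]) (simp add: x_xe xe_inv xe_mult)

lemma eta_V: "\<eta> \<in> V"
  using comms_V[of 4 1] eta_cm by (simp add: x_def)

lemma pact_gsum_4_w: "pact (gsum 4 [:0, 1:]) w = \<eta>"
  using cm_a_gsum[of c 4] eta_cm by (simp add: x_def)

lemma pact_eta: "pact p \<eta> = \<eta> [^] poly p 1"
  using cj_xe_a_pow[of "int k - 1" 1 1] by (intro pact_fixed[OF eta_V]) (simp add: \<eta>_def)

lemma poly_gsum_1: "poly (gsum i [:0, 1:]) (1::int) = int i"
  by (induction i) (simp_all add: gsum_Suc poly_power)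

abbreviation Y :: "int poly" where "Y \<equiv> gsum s [:0, 1:]"

lemma cm_as: "cm (a [^] s) (c [^] (m::nat)) = pact (Y * gsum m gam) w"
  using cm_a_gsum[of "c [^] m" s] comms_V[of 1 m] by (simp add: cm_c_gsum pact_mult)

text \<open>Q = [c, d] lies in \<open>V\<close> and is inverted by \<open>b\<close>, which swaps c
  and d. By \<open>pact_bet_gsum_4\<close> its trace is inverted too. That trace has e-exponent -s
  modulo \<tau>, and \<open>b\<close> preserves e-exponents.\<close>

lemma tau_2s: "\<tau> dvd 2 * int s"
proof -
  define Q where "Q = cm c d"
  have "Q = cj (inv (cm (a [^] s) c)) (c [^] l)"
    unfolding Q_def d_eq' by (simp add: cm_mult_right inv_cm) (simp add: cm_one_iff nat_pow_Suc2[symmetric])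
  also have "inv (cm (a [^] s) c) = pact (- Y) w"
    using cm_as[of 1] by (simp add: pact_minus gsum_def)
  also have "cj (pact (- Y) w) (c [^] l) = pact (gam ^ l) (pact (- Y) w)"
    by (simp only: pact_gam_pow pact_V w_V)
  finally have Q: "Q = pact (gam ^ l) (pact (- Y) w)" .
  then have QV: "Q \<in> V" by simp
  have "pact (gsum 4 [:0, 1:]) Q = pact (gam ^ l) (pact (- Y) (pact (gsum 4 [:0, 1:]) w))"
    unfolding Q by (simp only: pact_mult[symmetric] w_V mult_ac)
  also have "\<dots> = cj (pact (- Y) \<eta>) (c [^] l)"
    by (simp only: pact_gsum_4_w pact_gam_pow pact_V eta_V)
  also have "pact (- Y) \<eta> = xe (- int s * (int k - 1)) (- int s)"
    by (simp only: pact_eta poly_minus poly_gsum_1) (simp add: \<eta>_def xe_pow)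
  finally obtain A where A: "pact (gsum 4 [:0, 1:]) Q = xe A (gsum l (int k) * (- int s * (int k - 1)) + - int s)"
    using cj_xe_c_pow by metis
  define B where "B = gsum l (int k) * (- int s * (int k - 1)) + - int s"
  have "cj Q b = cm d c" by (simp add: Q_def cm_cj) (simp add: d_def cj_b_b)
  also have "\<dots> = Q [^] (- 1 :: int)" using QV by (simp add: Q_def inv_cm int_pow_neg)
  finally have cjQ: "cj Q b = Q [^] (- 1 :: int)" .
  have "cj (pact (gsum 4 [:0, 1:]) Q) b = pact (gsum 4 [:0, 1:]) (Q [^] (- 1 :: int))"
    using QV by (simp only: cj_pact_b cjQ pact_bet_gsum_4 V_int_pow)
  also have "\<dots> = pact (gsum 4 [:0, 1:]) Q [^] (- 1 :: int)" using QV by (rule pact_int_pow)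
  finally have "xe (u * B - A) B = xe (- A) (- B)"
    unfolding A B_def[symmetric] cj_xe_b xe_pow by simp
  then have "\<tau> dvd 2 * B" by (simp add: xe_eq)
  moreover have "\<tau> dvd 2 * (gsum l (int k) * (int s * (int k - 1)))" using tau_k by simp
  ultimately have "\<tau> dvd - (2 * B + 2 * (gsum l (int k) * (int s * (int k - 1))))"
    by (simp only: dvd_minus_iff dvd_add)
  then show ?thesis by (simp add: B_def algebra_simps)
qed

text \<open>Moving a^s past powers of \<open>c\<close> creates only inverses of commutators
  [a^s, c^m], which lie in the submodule YV.\<close>

lemma d_pow_mod: "\<exists>p. d [^] i = a [^] (s * i) \<otimes> c [^] (l * i) \<otimes> pact (Y * p) w" for i :: nat
proof (induction i)
  case 0
  have "d [^] (0::nat) = a [^] (s * 0) \<otimes> c [^] (l * 0) \<otimes> pact (Y * 0) w" by simp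
  then show ?case by blast
next
  case (Suc i)
  then obtain p where p: "d [^] i = a [^] (s * i) \<otimes> c [^] (l * i) \<otimes> pact (Y * p) w" by blast
  define v where "v = pact (Y * p) w"
  define v1 where "v1 = cm (c [^] (l * i)) (a [^] s)"
  have "v1 = inv (cm (a [^] s) (c [^] (l * i)))" by (simp add: v1_def inv_cm)
  then have v1: "v1 = pact (Y * - gsum (l * i) gam) w" by (simp add: cm_as pact_minus)
  have in_V: "v \<in> V" "v1 \<in> V" by (simp_all add: v_def v1)
  have 1: "v \<otimes> (a [^] s \<otimes> c [^] l) = a [^] s \<otimes> c [^] l \<otimes> cj v (a [^] s \<otimes> c [^] l)"
    using in_V by (intro mult_eq_cj) simp_all
  have 2: "c [^] (l * i) \<otimes> a [^] s = a [^] s \<otimes> c [^] (l * i) \<otimes> v1"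
    unfolding v1_def by (simp add: group_simps)
  have 3: "v1 \<otimes> c [^] l = c [^] l \<otimes> cj v1 (c [^] l)"
    using in_V by (intro mult_eq_cj) simp_all
  have 4: "cj v (a [^] s \<otimes> c [^] l) = pact (Y * (gam ^ l * [:0, 1:] ^ s * p)) w"
  proof -
    have e1: "pact ([:0, 1:] ^ s) v = cj v (a [^] s)" by (rule pact_X_pow[OF in_V(1)])
    have "pact (gam ^ l) (pact ([:0, 1:] ^ s) v) = cj (pact ([:0, 1:] ^ s) v) (c [^] l)"
      by (rule pact_gam_pow[OF pact_V[OF in_V(1)]])
    then have "cj v (a [^] s \<otimes> c [^] l) = pact (gam ^ l) (pact ([:0, 1:] ^ s) v)"
      unfolding e1 using in_V(1) by (simp add: cj_cj)
    then show ?thesis unfolding v_def by (simp only: pact_mult[symmetric] w_V mult_ac)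
  qed
  have 5: "cj v1 (c [^] l) = pact (Y * (gam ^ l * - gsum (l * i) gam)) w"
    using in_V(2) unfolding v1 by (simp only: pact_gam_pow[symmetric] pact_mult[symmetric] w_V mult_ac)
  define V1 where "V1 = cj v1 (c [^] l)"
  define V2 where "V2 = cj v (a [^] s \<otimes> c [^] l)"
  have in_G: "v \<in> carrier G" "v1 \<in> carrier G" "V1 \<in> carrier G" "V2 \<in> carrier G"
    using in_V by (simp_all add: V1_def V2_def)
  have "d [^] Suc i = a [^] (s * i) \<otimes> c [^] (l * i) \<otimes> (v \<otimes> (a [^] s \<otimes> c [^] l))"
    unfolding nat_pow_Suc p v_def[symmetric] using d_eq' in_G by (simp add: m_assoc)
  also have "\<dots> = a [^] (s * i) \<otimes> (c [^] (l * i) \<otimes> a [^] s) \<otimes> c [^] l \<otimes> V2"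
    unfolding 1 V2_def[symmetric] using in_G by (simp add: m_assoc)
  also have "\<dots> = a [^] (s * i) \<otimes> a [^] s \<otimes> c [^] (l * i) \<otimes> (v1 \<otimes> c [^] l) \<otimes> V2"
    unfolding 2 using in_G by (simp add: m_assoc)
  also have "\<dots> = (a [^] (s * i) \<otimes> a [^] s) \<otimes> (c [^] (l * i) \<otimes> c [^] l) \<otimes> (V1 \<otimes> V2)"
    unfolding 3 V1_def[symmetric] using in_G by (simp add: m_assoc)
  also have "V1 \<otimes> V2 = pact (Y * (gam ^ l * - gsum (l * i) gam) + Y * (gam ^ l * [:0, 1:] ^ s * p)) w"
    by (simp only: V1_def V2_def 4 5 pact_add w_V)
  finally have "d [^] Suc i = a [^] (s * Suc i) \<otimes> c [^] (l * Suc i)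
      \<otimes> pact (Y * (gam ^ l * - gsum (l * i) gam + gam ^ l * [:0, 1:] ^ s * p)) w"
    by (simp only: nat_pow_mult a_in c_in distrib_left mult_Suc_right add.commute)
  then show ?case by blast
qed

text \<open>f = d^j gives a^(sj) v = x^u e^(1-l) with v in YV, so v commutes with \<open>a\<close>
  and its trace is v^4. This has e-exponent 4(1 - l), but computed from \<eta> it is a multiple of
  s. With \<tau> | 2s and \<tau> | l + 1 only \<tau> | 16 remains.\<close>

lemma tau_16: "\<tau> dvd 16"
proof -
  obtain p where p: "d [^] j = a [^] (s * j) \<otimes> c [^] (l * j) \<otimes> pact (Y * p) w" using d_pow_mod by blast
  define v where "v = pact (Y * p) w"
  have vV: "v \<in> V" by (simp add: v_def)
  have "f = d [^] j" by (simp add: f_def e_def d_def cj_pow)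
  moreover have cl: "c [^] (l * j) = xe 0 (int l)"
    by (simp add: e_pow_xe[symmetric] e_pow_c c_pow_int mult.commute)
  ultimately have 1: "a [^] (s * j) \<otimes> (xe 0 (int l) \<otimes> v) = xe u 1"
    using p vV by (simp add: f_eq v_def m_assoc)
  have "xe 0 (int l) \<otimes> a [^] (s * j) = a [^] (s * j) \<otimes> xe 0 (int l)"
    unfolding e_pow_xe[symmetric] by (intro int_pow_commute) (simp_all add: e_prods)
  then have "xe 0 (int l) \<otimes> (a [^] (s * j) \<otimes> v) = xe u 1"
    unfolding 1[symmetric] using vV by (simp add: m_assoc[symmetric])
  then have "a [^] (s * j) \<otimes> v = inv (xe 0 (int l)) \<otimes> xe u 1"
    using vV by (simp add: inv_solve_left)
  then have av: "a [^] (s * j) \<otimes> v = xe u (1 - int l)" by (simp add: xe_inv xe_mult)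
  have axe: "a [^] i \<otimes> xe A B = xe A B \<otimes> a [^] i" for i :: nat and A B
    using cj_xe_a_pow[of A B i] by (simp add: cj_eq_iff)
  have va: "v \<otimes> a [^] i = a [^] i \<otimes> v" for i :: nat
  proof -
    have "a [^] (s * j) \<otimes> (v \<otimes> a [^] i) = xe u (1 - int l) \<otimes> a [^] i"
      using vV by (simp add: av[symmetric] m_assoc)
    also have "\<dots> = a [^] i \<otimes> (a [^] (s * j) \<otimes> v)" by (simp only: axe av)
    also have "\<dots> = a [^] (s * j) \<otimes> (a [^] i \<otimes> v)"
      using vV nat_pow_comm[OF a_in, of i "s * j"] by (simp add: m_assoc[symmetric])
    finally show ?thesis using vV by simp
  qed
  have "xe (int (s * j)) 0 \<otimes> v [^] (4::nat) = (a [^] (s * j)) [^] (4::nat) \<otimes> v [^] (4::nat)"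
    by (simp add: x_pow_xe[symmetric] x_def int_pow_int nat_pow_pow mult.commute del: of_nat_mult)
  also have "\<dots> = xe u (1 - int l) [^] (4::nat)"
    unfolding av[symmetric] using vV va by (subst pow_mult_distrib) simp_all
  finally have "v [^] (4::nat) = inv (xe (int (s * j)) 0) \<otimes> xe (4 * u) (4 * (1 - int l))"
    using vV by (simp add: inv_solve_left xe_nat_pow)
  then have v4: "v [^] (4::nat) = xe (4 * u - int (s * j)) (4 * (1 - int l))"
    by (simp add: xe_inv xe_mult algebra_simps)
  have "pact (gsum 4 [:0, 1:]) v = v [^] (4::nat)"
  proof -
    have "cj v a = v" using va[of 1] vV by (simp add: cj_eq_iff)
    then show ?thesis using poly_gsum_1[of 4] int_pow_int[of G v 4] vV by (simp add: pact_fixed)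
  qed
  moreover have "pact (gsum 4 [:0, 1:]) v = pact p (pact Y (pact (gsum 4 [:0, 1:]) w))"
    unfolding v_def by (simp only: pact_mult[symmetric] w_V mult_ac)
  moreover have "pact p (pact Y \<eta>) = xe (poly p 1 * (int s * (int k - 1))) (poly p 1 * int s)"
    by (simp only: pact_eta pact_int_pow eta_V poly_gsum_1) (simp add: \<eta>_def xe_pow mult_ac)
  ultimately have "xe (4 * u - int (s * j)) (4 * (1 - int l)) = xe (poly p 1 * (int s * (int k - 1))) (poly p 1 * int s)"
    using v4 by (simp only: pact_gsum_4_w)
  then have "\<tau> dvd 4 * (1 - int l) - poly p 1 * int s" by (simp only: xe_eq)
  from dvd_add[OF dvd_add[OF dvd_mult[OF this, of 2] dvd_mult[OF tau_2s, of "poly p 1"]] dvd_mult[OF tau_l, of 8]]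
  have "\<tau> dvd 2 * (4 * (1 - int l) - poly p 1 * int s) + poly p 1 * (2 * int s) + 8 * (int l + 1)" .
  then show ?thesis by (simp add: algebra_simps)
qed

text \<open>An odd \<tau> is 1 by \<open>tau_16\<close>. If \<tau> is even and 4 does not divide s,
  then a^(2n) is centralized by \<open>c\<close>. Hence c^(l-1) commutes with a^s, which makes
  \<tau> divide an odd number.\<close>

lemma tau_1: "\<tau> = 1"
proof (cases "even \<tau>")
  case False
  then have "coprime \<tau> 2" by simp
  then have "coprime \<tau> (2 ^ 4)" by (simp only: coprime_power_right_iff simp_thms)
  moreover have "\<tau> dvd 2 ^ 4" using tau_16 by simp
  ultimately have "is_unit \<tau>" by (simp only: coprime_absorb_left)
  then show ?thesis by (simp add: \<tau>_def)
next
  case True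
  show ?thesis
  proof (cases "4 dvd s")
    case True
    then show ?thesis by (rule tau_1_if_4_dvd)
  next
    case False
    obtain D u' where D: "int n = D * \<tau>" "\<tau> dvd D" by (rule tau_square)
    obtain t where t: "\<tau> = 2 * t" using \<open>even \<tau>\<close> by (elim evenE)
    have "int n = 2 * (t * D)" using D(1) t by simp
    then have "even n" by presburger
    then obtain h where h: "n = 2 * h" by (elim evenE)
    then have h': "int h = t * D" using \<open>int n = 2 * (t * D)\<close> by simp
    then have "\<tau> dvd int h" using D(2) by simp
    moreover have "even (int k - 1)" using \<open>even \<tau>\<close> tau_k by (rule dvd_trans)
    then have "2 * int h dvd (int k - 1) * int h" by (simp add: mult_dvd_mono)
    then have "int n dvd int k * int h - int h" by (simp add: h algebra_simps)
    ultimately have "cj (xe (int h) 0) c = xe (int h) 0" by (simp add: cj_xe_c xe_eq)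
    moreover have "a [^] (2 * n) = xe (int h) 0"
      by (simp add: x_pow_xe[symmetric] x_def int_pow_int nat_pow_pow h)
    ultimately have "a [^] (2 * n) \<otimes> c = c \<otimes> a [^] (2 * n)" by (simp add: cj_eq_iff)
    then have \<omega>c: "a [^] (2 * n * s) \<otimes> c = c \<otimes> a [^] (2 * n * s)"
      using int_pow_commute[of "a [^] (2 * n)" c "int s"] by (simp add: int_pow_int nat_pow_pow)
    define \<omega> where "\<omega> = a [^] (2 * n * s)"
    define z where "z = c [^] (l - 1)"
    have in_G: "\<omega> \<in> carrier G" "z \<in> carrier G" by (simp_all add: \<omega>_def z_def)
    have \<omega>cpow: "\<omega> \<otimes> c [^] i = c [^] i \<otimes> \<omega>" for i :: nat
      using commute_int_pow[of \<omega> c "int i"] \<omega>c by (simp add: \<omega>_def int_pow_int)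
    have \<omega>d: "\<omega> \<otimes> d = d \<otimes> \<omega>"
      unfolding d_eq' using \<omega>cpow by (intro commute_mult) (simp_all add: \<omega>_def nat_pow_comm)
    have "c [^] l = c \<otimes> z" using l_pos by (simp add: z_def flip: nat_pow_Suc2)
    then have "d [^] (l - 1) = inv z \<otimes> (inv c \<otimes> (\<omega> \<otimes> c))"
      using in_G d_pow_l1 by (simp add: inv_mult_group m_assoc \<omega>_def)
    also have "\<dots> = inv z \<otimes> \<omega>" using in_G \<omega>cpow[of 1] by (simp add: inv_cancel)
    finally have "z = \<omega> \<otimes> inv (d [^] (l - 1))"
      using in_G by (simp add: inv_mult_group m_assoc[symmetric])
    moreover have "d \<otimes> inv (d [^] (l - 1)) = inv (d [^] (l - 1)) \<otimes> d"
      using commute_int_pow[of d d "- int (l - 1)"] by (simp add: int_pow_neg_int)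
    ultimately have "d \<otimes> z = z \<otimes> d"
      using \<omega>d in_G by (simp add: commute_mult)
    then have "a [^] s \<otimes> (c [^] l \<otimes> z) = z \<otimes> (a [^] s \<otimes> c [^] l)"
      using in_G by (simp add: d_eq' m_assoc)
    moreover have "c [^] l \<otimes> z = z \<otimes> c [^] l" by (simp add: z_def nat_pow_comm)
    ultimately have "(a [^] s \<otimes> z) \<otimes> c [^] l = (z \<otimes> a [^] s) \<otimes> c [^] l"
      using in_G by (simp add: m_assoc)
    then have az: "a [^] s \<otimes> z = z \<otimes> a [^] s" using in_G by simp
    obtain s1 where s1: "odd s1" "s = s1 \<or> s = 2 * s1"
    proof (cases "even s")
      case True
      then obtain s1 where "s = 2 * s1" by (elim evenE)
      with \<open>\<not> 4 dvd s\<close> show ?thesis using that[of s1] by auto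
    qed (use that in blast)
    have "x [^] s1 \<otimes> z = z \<otimes> x [^] s1"
    proof -
      have "\<exists>m::nat. x [^] s1 = (a [^] s) [^] m"
        using s1(2)
      proof
        assume "s = s1"
        then show ?thesis by (intro exI[of _ 4]) (simp add: x_def nat_pow_pow mult.commute)
      next
        assume "s = 2 * s1"
        then show ?thesis by (intro exI[of _ 2]) (simp add: x_def nat_pow_pow mult.commute)
      qed
      then obtain m :: nat where "x [^] s1 = (a [^] s) [^] m" by blast
      then show ?thesis using int_pow_commute[of "a [^] s" z "int m"] az in_G by (simp add: int_pow_int)
    qed
    then have "cj (xe (int s1) 0) z = xe (int s1) 0"
      using in_G by (simp add: cj_eq_iff x_pow_xe[symmetric] int_pow_int)
    then have "int n dvd int k ^ (l - 1) * int s1 - int s1"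
      unfolding z_def cj_xe_c_pow xe_eq by simp
    \<comment> \<open>Multiplication by -k turns k^(l-1) - 1 into u, so that
      \<open>n_dvd_u_iff\<close> applies.\<close>
    then have "int n dvd - int k * (int k ^ (l - 1) * int s1 - int s1)" by (rule dvd_mult)
    also have "- int k * (int k ^ (l - 1) * int s1 - int s1) = (int k - int k * int k ^ (l - 1)) * int s1"
      by (simp add: algebra_simps)
    also have "int k * int k ^ (l - 1) = \<kappa>" unfolding \<kappa>_def using l_pos by (simp flip: power_Suc)
    finally have "\<tau> dvd int s1" using n_dvd_u_iff by (simp add: u_def)
    then have "even (int s1)" using \<open>even \<tau>\<close> dvd_trans by blast
    with s1(1) show ?thesis by simp
  qed
qed

theorem e_trivial: "c [^] j = \<one>"
  using e_pow_1[of 1] tau_1 by (simp add: e_def)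

end

section \<open>Products of a semidihedral and a cyclic group\<close>

text \<open>[a^4, c] is the trace of \<open>w\<close> and hence fixed by \<open>a\<close>. Writing
  it as a^i c^j makes c^j commute with \<open>a\<close>, and \<open>central_twist\<close> removes
  c^j.\<close>

lemma (in group) fourth_power_normalized:
  assumes "cyclic_product G a c" "b \<in> carrier G" "b \<otimes> b = \<one>" "n > 0" "cj a b = a [^] (2 * n - 1)"
    and ord_a: "ord a = 4 * n"
    and cb: "cj c b \<in> cyclic_product.prods G a c"
    and disjoint: "\<And>i i'. a [^] (i::int) = c [^] (i'::int) \<Longrightarrow> a [^] i = \<one>"
    and core_free: "\<And>z. \<lbrakk>c [^] (z::int) \<otimes> a = a \<otimes> c [^] z; \<exists>z'::int. cj (c [^] z) b = c [^] z';
        cj (c [^] z) b \<otimes> a = a \<otimes> cj (c [^] z) b\<rbrakk> \<Longrightarrow> c [^] z = \<one>"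
  shows "\<exists>k::nat. cj (a [^] (4::nat)) c = (a [^] (4::nat)) [^] k"
proof -
  interpret cyclic_product G a c by fact
  have a_order: "a [^] (4 * n) = \<one>" using pow_ord_eq_1[OF a_in] by (simp add: ord_a)
  interpret twisted_cyclic_product G a c b n
    using assms a_order by unfold_locales
  define x where "x = a [^] (4::nat)"
  then have x_eq: "x = a [^] (4::nat)" .
  have x_in: "x \<in> carrier G" by (simp add: x_def)
  have x_n: "x [^] n = \<one>" using a_order by (simp add: x_def nat_pow_pow)
  define t where "t = pact (gsum 4 [:0, 1:]) w"
  have t: "t = cm x c" using cm_a_gsum[of c 4] by (simp add: t_def x_def)
  have tV: "t \<in> V" by (simp add: t_def)
  \<comment> \<open>1 + X + ... + X^4 applied to \<open>w\<close> is split off at either end, and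
    X^4 acts trivially.\<close>
  have "w \<otimes> cj t a = pact (1 + [:0, 1:] * gsum 4 [:0, 1:]) w"
    unfolding t_def by (simp only: pact_add pact_X_mult pact_one w_V)
  also have "1 + [:0, 1:] * gsum 4 [:0, 1:] = gsum 4 [:0, 1:] + [:0, 1 :: int:] ^ 4"
    by (simp only: gsum_Suc[symmetric] gsum_Suc'[symmetric])
  also have "pact \<dots> w = w \<otimes> t"
    using cj_a_4[OF w_V] tV V_commute[OF w_V tV]
    by (simp only: pact_add pact_X_pow t_def[symmetric] w_V)
  finally have ta: "cj t a = t" using tV by simp
  have "t \<in> prods" using tV V_prods by blast
  then obtain i j :: nat where ij: "t = a [^] i \<otimes> c [^] j" by (rule prodsE)
  have ca: "c [^] j \<otimes> a = a \<otimes> c [^] j"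
  proof -
    have "t \<otimes> a = a \<otimes> t" using ta tV by (simp add: cj_eq_iff)
    then have "a [^] i \<otimes> (c [^] j \<otimes> a) = a [^] i \<otimes> (a \<otimes> c [^] j)"
      unfolding ij using nat_pow_comm[OF a_in, of i 1] by (simp add: m_assoc[symmetric])
    then show ?thesis by simp
  qed
  have "cj x c = x \<otimes> t" unfolding t by (rule cj_eq_cm) (simp_all add: x_in)
  then have xc: "cj x c = a [^] (4 + i) \<otimes> c [^] j"
    unfolding ij x_def by (simp add: nat_pow_mult[symmetric] m_assoc)
  have "cj a (c [^] j) = a" using ca by (simp add: cj_eq_iff)
  then have "cj (a [^] (4 + i)) (c [^] j) = a [^] (4 + i)" by (simp add: cj_pow)
  then have comm: "a [^] (4 + i) \<otimes> c [^] j = c [^] j \<otimes> a [^] (4 + i)" by (simp add: cj_eq_iff)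
  \<comment> \<open>The n-th power of x^c is trivial, which puts a power of \<open>a\<close> into
    \<langle>c\<rangle>; by \<open>disjoint\<close> it is 1, whence 4 divides i.\<close>
  have "\<one> = cj (x [^] n) c" by (simp add: x_n)
  also have "\<dots> = (a [^] (4 + i) \<otimes> c [^] j) [^] n"
    using x_in by (simp add: cj_pow xc)
  also have "\<dots> = (a [^] (4 + i)) [^] n \<otimes> (c [^] j) [^] n"
    by (rule pow_mult_distrib[OF comm]) simp_all
  finally have "(a [^] (4 + i)) [^] n \<otimes> (c [^] j) [^] n = \<one>" by (rule sym)
  then have "(a [^] (4 + i)) [^] n = inv ((c [^] j) [^] n)"
    by (intro inv_equality[symmetric]) simp_all
  then have ac: "a [^] int ((4 + i) * n) = c [^] (- int (j * n))"
    by (simp only: int_pow_int int_pow_neg_int nat_pow_pow a_in c_in)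
  have "a [^] int ((4 + i) * n) = \<one>" by (rule disjoint[OF ac])
  then have "a [^] ((4 + i) * n) = \<one>" by (simp only: int_pow_int)
  then have "4 * n dvd (4 + i) * n" by (simp add: pow_eq_id ord_a)
  then have "4 dvd 4 + i" using n_pos by simp
  then obtain k0 where k0: "4 + i = 4 * k0" by blast
  \<comment> \<open>As x^n = 1, adding 2n does not change the power; it ensures that k is at least
    2.\<close>
  define k where "k = k0 + 2 * n"
  have xk: "x [^] k = a [^] (4 + i)"
  proof -
    have "x [^] k = x [^] k0 \<otimes> (x [^] n) [^] (2::nat)"
      using x_in by (simp add: k_def nat_pow_mult nat_pow_pow mult.commute)
    also have "\<dots> = a [^] (4 + i)" unfolding k0 using x_in x_n by (simp add: x_def nat_pow_pow)
    finally show ?thesis .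
  qed
  obtain s l0 :: nat where sl: "cj c b = a [^] s \<otimes> c [^] l0" using cb by (rule prodsE)
  \<comment> \<open>Adding the group order makes l positive.\<close>
  define l where "l = l0 + Coset.order G"
  have "c [^] l = c [^] l0" using pow_order_eq_1[OF c_in] by (simp add: l_def flip: nat_pow_mult)
  interpret central_twist G a c b n k l s j
  proof
    show "ord a = 4 * n" by (rule ord_a)
    show "k \<ge> 2" using n_pos by (simp add: k_def)
    show "l \<ge> 1" using order_pos by (simp add: l_def)
    show "cj (a [^] (4::nat)) c = (a [^] (4::nat)) [^] k \<otimes> c [^] j"
      using xc xk by (simp add: x_def)
    show "c [^] j \<otimes> a = a \<otimes> c [^] j" by (rule ca)
    show "cj c b = a [^] s \<otimes> c [^] l" using sl \<open>c [^] l = c [^] l0\<close> by simp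
  qed (use disjoint core_free in blast)+
  have "cj x c = x [^] k" using xc xk e_trivial by simp
  then show ?thesis unfolding x_eq by blast
qed

section \<open>Cyclic subgroups and cores in finite groups\<close>

context group
begin

lemma subgroup_nat_pow: "\<lbrakk>subgroup K G; y \<in> K\<rbrakk> \<Longrightarrow> y [^] (k::nat) \<in> K"
  by (induction k) (simp_all add: subgroup.one_closed subgroup.m_closed)

lemma generate_nat_pow:
  assumes "finite (carrier G)" "g \<in> carrier G"
  shows "generate G {g} = {g [^] k | k::nat. True}"
proof
  show "generate G {g} \<subseteq> {g [^] k | k::nat. True}"
  proof
    fix z assume "z \<in> generate G {g}"
    then obtain k :: int where k: "z = g [^] k" using generate_pow[OF assms(2)] by blast
    show "z \<in> {g [^] k | k::nat. True}"
    proof (cases k)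
      case (nonneg m)
      then show ?thesis using k by (auto simp: int_pow_int)
    next
      case (neg m)
      then show ?thesis using k inv_pow_nat[OF assms, of "Suc m"] by (auto simp only: int_pow_neg_int assms)
    qed
  qed
  show "{g [^] k | k::nat. True} \<subseteq> generate G {g}"
    using subgroup_nat_pow[OF generate_is_subgroup[of "{g}"]] assms(2) generate.incl[of g "{g}"] by auto
qed

lemma pow_mod_ord: "g \<in> carrier G \<Longrightarrow> g [^] (i mod ord g :: nat) = g [^] i"
proof -
  assume g: "g \<in> carrier G"
  have "g [^] i = g [^] (ord g * (i div ord g) + i mod ord g)" by simp
  also have "\<dots> = (g [^] ord g) [^] (i div ord g) \<otimes> g [^] (i mod ord g)"
    using g by (simp only: nat_pow_pow nat_pow_mult)
  finally show ?thesis using g by (simp add: pow_ord_eq_1)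
qed

lemma cj_inverse: "\<lbrakk>g \<in> carrier G; h \<in> carrier G\<rbrakk> \<Longrightarrow> cj (cj g h) (inv h) = g"
  and cj_inverse': "\<lbrakk>g \<in> carrier G; h \<in> carrier G\<rbrakk> \<Longrightarrow> cj (cj g (inv h)) h = g"
  by (simp_all add: cj_cj)

lemma core_iff:
  assumes "S \<subseteq> carrier G"
  shows "z \<in> subgroup_core G S \<longleftrightarrow> z \<in> carrier G \<and> (\<forall>g\<in>carrier G. cj z g \<in> S)"
proof
  assume z: "z \<in> subgroup_core G S"
  then have "z \<in> (\<lambda>s. cj s \<one>) ` S" unfolding subgroup_core_def by blast
  then have "z \<in> carrier G" using assms by auto
  moreover have "cj z g \<in> S" if "g \<in> carrier G" for g
  proof -
    have "z \<in> (\<lambda>s. cj s (inv g)) ` S" using z that unfolding subgroup_core_def by blast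
    then obtain s where "s \<in> S" "z = cj s (inv g)" by blast
    then show ?thesis using cj_inverse' assms that by auto
  qed
  ultimately show "z \<in> carrier G \<and> (\<forall>g\<in>carrier G. cj z g \<in> S)" by blast
next
  assume z: "z \<in> carrier G \<and> (\<forall>g\<in>carrier G. cj z g \<in> S)"
  show "z \<in> subgroup_core G S"
    unfolding subgroup_core_def
  proof
    fix g assume "g \<in> carrier G"
    then have "z = cj (cj z (inv g)) g" "cj z (inv g) \<in> S" using z cj_inverse' by auto
    then show "z \<in> (\<lambda>s. cj s g) ` S" by blast
  qed
qed

lemma core_subset: "S \<subseteq> carrier G \<Longrightarrow> subgroup_core G S \<subseteq> S"
proof
  fix z assume S: "S \<subseteq> carrier G" and "z \<in> subgroup_core G S"
  then have "z \<in> carrier G" "cj z \<one> \<in> S" using core_iff[OF S] by blast+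
  then show "z \<in> S" by simp
qed

lemma core_cj:
  assumes "S \<subseteq> carrier G" "z \<in> subgroup_core G S" "g \<in> carrier G"
  shows "cj z g \<in> subgroup_core G S"
  using assms by (auto simp: core_iff cj_cj)

lemma subgroup_core:
  assumes "subgroup S G" shows "subgroup (subgroup_core G S) G"
proof -
  note S = subgroup.subset[OF assms]
  show ?thesis
  proof (rule subgroupI)
    show "subgroup_core G S \<subseteq> carrier G" using core_iff[OF S] by blast
    have "\<one> \<in> subgroup_core G S" using subgroup.one_closed[OF assms] by (simp add: core_iff[OF S])
    then show "subgroup_core G S \<noteq> {}" by blast
  qed (use subgroup.m_closed[OF assms] subgroup.m_inv_closed[OF assms] in \<open>auto simp: core_iff[OF S] cj_mult cj_inv\<close>)
qed

text \<open>The generator is the smallest positive power of \<open>c\<close> in \<open>K\<close>, by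
  division with remainder.\<close>

lemma subgroup_of_powers:
  assumes "finite (carrier G)" "c \<in> carrier G" "subgroup K G" "K \<subseteq> {c [^] k | k::nat. True}"
  obtains z where "z \<in> K" "K = {z [^] k | k::nat. True}"
proof -
  define t where "t = (LEAST t::nat. t > 0 \<and> c [^] t \<in> K)"
  have "Coset.order G > 0 \<and> c [^] Coset.order G \<in> K"
    using assms subgroup.one_closed[OF assms(3)] by (simp add: order_gt_0_iff_finite pow_order_eq_1)
  then have t: "t > 0 \<and> c [^] t \<in> K" unfolding t_def by (rule LeastI)
  have least: "t \<le> i" if "i > 0" "c [^] i \<in> K" for i :: nat
    unfolding t_def using that by (intro Least_le) blast
  have powK: "(c [^] t) [^] k \<in> K" for k :: nat using subgroup_nat_pow[OF assms(3)] t by blast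
  have "\<exists>k::nat. y = (c [^] t) [^] k" if y_K: "y \<in> K" for y
  proof -
    obtain i :: nat where i: "y = c [^] i" using y_K assms(4) by blast
    have "i = t * (i div t) + i mod t" by simp
    then have y: "y = (c [^] t) [^] (i div t) \<otimes> c [^] (i mod t)"
      unfolding i using assms(2) by (simp only: nat_pow_pow nat_pow_mult)
    then have "c [^] (i mod t) = inv ((c [^] t) [^] (i div t)) \<otimes> y"
      using assms(2) by (simp add: inv_cancel)
    then have "c [^] (i mod t) \<in> K"
      using y_K powK subgroup.m_closed[OF assms(3)] subgroup.m_inv_closed[OF assms(3)] by simp
    then have "i mod t = 0" using least[of "i mod t"] t by (meson mod_less_divisor not_gr_zero not_le)
    then show ?thesis using y assms(2) by auto
  qed
  then have "K = {(c [^] t) [^] k | k::nat. True}" using powK by blast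
  with t that show ?thesis by blast
qed

end

section \<open>Normal forms in the product of a semidihedral and a cyclic group\<close>

locale semidihedral_product = group G for G (structure) +
  fixes n :: nat and S :: "'a set" and a b c :: 'a
  assumes n_ge: "n \<ge> 2" and finite_G: "finite (carrier G)"
    and sd: "semidihedral_subgroup G n S a b"
    and c_in [simp]: "c \<in> carrier G"
    and carrier_eq: "carrier G = S <#> generate G {c}"
    and inter: "S \<inter> generate G {c} = {\<one>}"
begin

lemma a_in [simp]: "a \<in> carrier G" and b_in [simp]: "b \<in> carrier G"
  and S_eq: "S = generate G {a, b}" and a_order: "a [^] (4 * n) = \<one>" and b_square: "b \<otimes> b = \<one>"
  and cj_a_b: "cj a b = a [^] (2 * n - 1)" and card_S: "card S = 8 * n"
  using sd unfolding semidihedral_subgroup_def by (auto simp: numeral_2_eq_2)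

lemma a_pow_b: "a [^] i \<otimes> b = b \<otimes> a [^] ((2 * n - 1) * i)" for i :: nat
proof -
  have "a [^] i \<otimes> b = b \<otimes> cj (a [^] i) b" by (simp add: group_simps)
  then show ?thesis by (simp add: cj_pow cj_a_b nat_pow_pow)
qed

lemma b_a_pow: "b \<otimes> a [^] i = a [^] ((2 * n - 1) * i) \<otimes> b" for i :: nat
proof -
  have inv_b: "inv b = b" using b_square by (intro inv_equality) simp_all
  have "b \<otimes> a [^] i = b \<otimes> a [^] i \<otimes> (b \<otimes> b)" by (simp add: b_square)
  also have "\<dots> = cj (a [^] i) b \<otimes> b" by (simp add: conj_by_def inv_b m_assoc)
  finally show ?thesis by (simp add: cj_pow cj_a_b nat_pow_pow)
qed

lemma b_pow: "b [^] (j::nat) = (if even j then \<one> else b)"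
  by (induction j) (auto simp: b_square)

text \<open>The semidihedral group is itself a product of two cyclic groups, which supplies the
  normal form a^i b^j.\<close>

sublocale sd: cyclic_product G a b
proof
  show "\<exists>(i'::nat) (j'::nat). b [^] j \<otimes> a [^] i = a [^] i' \<otimes> b [^] j'" for i j :: nat
  proof (cases "even j")
    case True
    then have "b [^] j \<otimes> a [^] i = a [^] i \<otimes> b [^] (0::nat)" by (simp add: b_pow)
    then show ?thesis by blast
  next
    case False
    then have "b [^] j \<otimes> a [^] i = a [^] ((2 * n - 1) * i) \<otimes> b [^] (1::nat)"
      using b_a_pow by (simp add: b_pow)
    then show ?thesis by blast
  qed
qed (simp_all add: finite_G)

lemma S_cases:
  assumes "g \<in> S" obtains i :: nat where "g = a [^] i \<or> g = a [^] i \<otimes> b"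
proof -
  have "S \<subseteq> sd.prods"
    unfolding S_eq using sd.a_pow_prods[of 1] sd.c_pow_prods[of 1]
    by (intro generate_subgroup_incl sd.subgroup_prods) simp
  then obtain i j :: nat where "g = a [^] i \<otimes> b [^] j" using assms sd.prodsE by blast
  with that[of i] show ?thesis by (auto simp: b_pow split: if_splits)
qed

lemma subgroup_S: "subgroup S G"
  unfolding S_eq by (rule generate_is_subgroup) simp

lemma a_pow_S: "a [^] (i::nat) \<in> S" and b_S: "b \<in> S"
  using subgroup_nat_pow[OF subgroup_S, of a] unfolding S_eq by (auto intro: generate.incl)

text \<open>\<open>S\<close> has at most 2 ord(a) elements and ord(a) divides 4n, so the order 8n
  forces equality.\<close>

lemma ord_a: "ord a = 4 * n"
proof -
  have pos: "ord a > 0" using ord_ge_1[OF finite_G a_in] by simp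
  have red: "a [^] i = a [^] (i mod ord a)" for i :: nat
    by (rule pow_mod_ord[OF a_in, symmetric]) 
  define F where "F = (\<lambda>i. a [^] i) ` {..<ord a} \<union> (\<lambda>i. a [^] i \<otimes> b) ` {..<ord a}"
  have "S \<subseteq> F"
  proof
    fix g assume "g \<in> S"
    then obtain i :: nat where "g = a [^] i \<or> g = a [^] i \<otimes> b" by (rule S_cases)
    then show "g \<in> F" unfolding F_def using red[of i] mod_less_divisor[OF pos, of i] by fastforce
  qed
  then have "card S \<le> card F" by (intro card_mono) (simp_all add: F_def)
  also have "\<dots> \<le> ord a + ord a"
    unfolding F_def by (rule order_trans[OF card_Un_le]) (intro add_mono card_image_le[THEN order_trans]; simp)
  finally have "4 * n \<le> ord a" using card_S by simp
  moreover have "ord a dvd 4 * n" using a_order by (simp add: pow_eq_id)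
  ultimately show ?thesis using n_ge by (simp add: dvd_imp_le le_antisym)
qed

lemma b_not_power: "b \<noteq> a [^] (i::nat)"
proof
  assume b: "b = a [^] i"
  have pos: "ord a > 0" using ord_ge_1[OF finite_G a_in] by simp
  have "S \<subseteq> (\<lambda>i. a [^] i) ` {..<ord a}"
  proof
    fix g assume "g \<in> S"
    then obtain k :: nat where "g = a [^] k \<or> g = a [^] k \<otimes> b" by (rule S_cases)
    then obtain k :: nat where "g = a [^] k" by (auto simp: b nat_pow_mult)
    then have "g = a [^] (k mod ord a)" using pow_mod_ord[OF a_in] by simp
    then show "g \<in> (\<lambda>i. a [^] i) ` {..<ord a}" using pos by auto
  qed
  then have "card S \<le> card ((\<lambda>i. a [^] i) ` {..<ord a})" by (intro card_mono) simp_all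
  also have "\<dots> \<le> ord a" using card_image_le[of "{..<ord a}"] by simp
  finally show False using card_S ord_a n_ge by simp
qed

abbreviation C :: "'a set" where "C \<equiv> generate G {c}"
abbreviation A :: "'a set" where "A \<equiv> generate G {a}"

lemma C_eq: "C = {c [^] k | k::nat. True}" and A_eq: "A = {a [^] k | k::nat. True}"
  using generate_nat_pow[OF finite_G] by simp_all

lemma subgroup_C: "subgroup C G"
  by (rule generate_is_subgroup) simp

lemma C_in: "C \<subseteq> carrier G"
  using subgroup.subset[OF subgroup_C] .

lemma C_commute: "\<lbrakk>y \<in> C; z \<in> C\<rbrakk> \<Longrightarrow> y \<otimes> z = z \<otimes> y"
  by (auto simp: C_eq nat_pow_comm)

lemma carrier_cases:
  assumes "g \<in> carrier G"
  obtains (even) i k :: nat where "g = a [^] i \<otimes> c [^] k"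
    | (odd) i k :: nat where "g = a [^] i \<otimes> b \<otimes> c [^] k"
proof -
  obtain y z where g: "y \<in> S" "z \<in> C" "g = y \<otimes> z"
    using assms unfolding carrier_eq set_mult_def by blast
  obtain k :: nat where "z = c [^] k" using g(2) unfolding C_eq by blast
  moreover obtain i :: nat where "y = a [^] i \<or> y = a [^] i \<otimes> b" using g(1) by (rule S_cases)
  ultimately show ?thesis using that g(3) by blast
qed

lemma S_C_trivial: "\<lbrakk>y \<in> S; y \<in> C\<rbrakk> \<Longrightarrow> y = \<one>"
  using inter by blast

lemma a_int_pow_S: "a [^] (i::int) \<in> S"
  using subgroup_int_pow_closed[OF subgroup_S] a_pow_S[of 1] by simp

section \<open>The centralizer of the core of \<langle>c\<rangle>\<close>

abbreviation K :: "'a set" where "K \<equiv> subgroup_core G C"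
abbreviation H :: "'a set" where "H \<equiv> centralizer G K"

lemma K_C: "K \<subseteq> C"
  by (rule core_subset[OF C_in])

lemma K_in: "z \<in> K \<Longrightarrow> z \<in> carrier G"
  using K_C C_in by blast

lemma H_iff: "h \<in> H \<longleftrightarrow> h \<in> carrier G \<and> (\<forall>z\<in>K. cj z h = z)"
  unfolding centralizer_def using K_in by (auto simp: cj_eq_iff)

lemma subgroup_H: "subgroup H G"
proof (rule subgroupI)
  show "H \<subseteq> carrier G" by (auto simp: H_iff)
  have "\<one> \<in> H" using K_in by (auto simp: H_iff)
  then show "H \<noteq> {}" by blast
  show "inv h \<in> H" if h: "h \<in> H" for h
  proof -
    have "cj z (inv h) = z" if z: "z \<in> K" for z
      using cj_inverse[of z h] K_in[OF z] h z by (simp add: H_iff)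
    then show ?thesis using h by (simp add: H_iff)
  qed
  show "h \<otimes> h' \<in> H" if "h \<in> H" "h' \<in> H" for h h'
    using that K_in by (auto simp: H_iff cj_cj[symmetric])
qed

text \<open>Automorphisms of the cyclic group \<open>K\<close> are power maps, so they commute.\<close>

lemma cj_K_commute:
  assumes "z \<in> K" "g \<in> carrier G" "h \<in> carrier G"
  shows "cj z (g \<otimes> h) = cj z (h \<otimes> g)"
proof -
  have "K \<subseteq> {c [^] k | k::nat. True}" using K_C unfolding C_eq .
  then obtain z0 where z0: "z0 \<in> K" "K = {z0 [^] k | k::nat. True}"
    by (rule subgroup_of_powers[OF finite_G c_in subgroup_core[OF subgroup_C]])
  have pow: "\<exists>p::nat. y = z0 [^] p" if "y \<in> K" for y
    using that z0(2) by auto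
  obtain p :: nat where p: "cj z0 g = z0 [^] p" using pow core_cj[OF C_in z0(1) assms(2)] by blast
  obtain q :: nat where q: "cj z0 h = z0 [^] q" using pow core_cj[OF C_in z0(1) assms(3)] by blast
  obtain r :: nat where r: "z = z0 [^] r" using pow assms(1) by blast
  note pqr = p q r
  have z0_in: "z0 \<in> carrier G" using z0(1) K_in by blast
  have "cj (cj z g) h = cj (cj z h) g"
    using assms z0_in by (simp add: pqr cj_pow nat_pow_pow mult_ac)
  then show ?thesis using assms K_in by (simp add: cj_cj)
qed

lemma c_H: "c \<in> H"
proof -
  have "z \<otimes> c = c \<otimes> z" if "z \<in> K" for z
    using that K_C C_commute[of z c] generate.incl[of c "{c}"] by blast
  then show ?thesis using K_in by (auto simp: H_iff cj_eq_iff)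
qed

text \<open>The products ab and ba act alike on \<open>K\<close>, and ab = b a^(2n-1); so
  \<open>a\<close> and a^(2n-1) act alike.\<close>

lemma commutator_H: "a [^] (2 * n - 2) \<in> H"
proof -
  have "cj z (a [^] (2 * n - 2)) = z" if z: "z \<in> K" for z
  proof -
    have zi: "z \<in> carrier G" using z K_in by blast
    have zb: "cj z b \<in> K" using core_cj[OF C_in z] by simp
    have zbb: "cj (cj z b) b = z" using zi by (simp add: cj_cj b_square)
    have "cj z a = cj (cj z b) (b \<otimes> a)" using zi by (simp add: cj_cj[symmetric] zbb)
    also have "\<dots> = cj (cj z b) (a \<otimes> b)" using cj_K_commute[OF zb] by simp
    also have "\<dots> = cj (cj z b) (b \<otimes> a [^] (2 * n - 1))" using a_pow_b[of 1] by simp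
    also have "\<dots> = cj z (a [^] (2 * n - 1))" using zi by (simp add: cj_cj[symmetric] zbb)
    also have "2 * n - 1 = Suc (2 * n - 2)" using n_ge by simp
    finally have "cj z a = cj (cj z (a [^] (2 * n - 2))) a" using zi by (simp add: cj_cj)
    then show ?thesis 
      using cj_inj[of z "cj z (a [^] (2 * n - 2))" a] zi by simp
  qed
  then show ?thesis by (simp add: H_iff)
qed

text \<open>The equation presents g as a combination of 2n - 2 and 4n, which puts a^g into the
  centralizer. The representatives a^i b^j with i < g and j < 2 then meet every coset.\<close>

lemma centralizer_bound:
  assumes g: "(2 * n - 2) * m = 4 * n * q + g" "g > 0"
  shows "generate G {a [^] g, c} \<subseteq> H" "subgroup_index G H \<le> g * 2"
proof -
  have "(a [^] (2 * n - 2)) [^] m \<in> H" by (rule subgroup_nat_pow[OF subgroup_H commutator_H])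
  also have "(a [^] (2 * n - 2)) [^] m = (a [^] (4 * n)) [^] q \<otimes> a [^] g"
    by (simp only: nat_pow_pow nat_pow_mult a_in g)
  finally have ag: "a [^] g \<in> H" by (simp add: a_order)
  show "generate G {a [^] g, c} \<subseteq> H"
    using ag c_H by (intro generate_subgroup_incl subgroup_H) simp
  define R where "R = (\<lambda>(i, j). H #> (a [^] i \<otimes> b [^] j)) ` ({..<g} \<times> {..<2::nat})"
  have "rcosets H \<subseteq> R"
  proof
    fix Y assume "Y \<in> rcosets H"
    then obtain y where y: "y \<in> carrier G" "Y = H #> y" unfolding RCOSETS_def by blast
    have "\<exists>(i::nat) (j::nat) (k::nat). y = a [^] i \<otimes> b [^] j \<otimes> c [^] k \<and> j < 2"
      using y(1)
    proof (cases rule: carrier_cases)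
      case (even i k)
      then show ?thesis by (intro exI[of _ i] exI[of _ 0] exI[of _ k]) simp
    next
      case (odd i k)
      then show ?thesis by (intro exI[of _ i] exI[of _ 1] exI[of _ k]) simp
    qed
    then obtain i j k :: nat where ijk: "y = a [^] i \<otimes> b [^] j \<otimes> c [^] k" "j < 2" by blast
    define y' where "y' = a [^] (i mod g) \<otimes> b [^] j"
    have y': "y' \<in> carrier G" by (simp add: y'_def)
    define h where "h = (a [^] g) [^] (i div g)"
    have h: "h \<in> H" unfolding h_def by (rule subgroup_nat_pow[OF subgroup_H ag])
    have ck: "c [^] k \<in> H" by (rule subgroup_nat_pow[OF subgroup_H c_H])
    have "i = g * (i div g) + i mod g" by simp
    then have "a [^] i = h \<otimes> a [^] (i mod g)"
      unfolding h_def by (simp only: nat_pow_pow nat_pow_mult a_in)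
    then have yy: "y = h \<otimes> y' \<otimes> c [^] k"
      using h by (simp add: ijk y'_def m_assoc H_iff)
    \<comment> \<open>Conjugation by \<open>y'\<close> preserves \<open>K\<close>, so the factor c^k
      between \<open>y'\<close> and its inverse acts trivially.\<close>
    have "y \<otimes> inv y' \<in> H"
    proof -
      have "cj z (h \<otimes> y' \<otimes> c [^] k \<otimes> inv y') = z" if z: "z \<in> K" for z
      proof -
        have zi: "z \<in> carrier G" using z K_in by blast
        have "cj z (h \<otimes> y' \<otimes> c [^] k \<otimes> inv y') = cj (cj (cj (cj z h) y') (c [^] k)) (inv y')"
          using zi y' h by (simp add: cj_cj H_iff m_assoc)
        also have "\<dots> = cj (cj (cj z y') (c [^] k)) (inv y')" using h z by (simp add: H_iff)
        also have "\<dots> = cj (cj z y') (inv y')"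
          using ck core_cj[OF C_in z y'] by (simp add: H_iff)
        also have "\<dots> = z" using zi y' by (rule cj_inverse)
        finally show ?thesis .
      qed
      then show ?thesis unfolding yy using h y' by (simp add: H_iff)
    qed
    then have "(y \<otimes> inv y') \<otimes> y' \<in> H #> y'" by (intro rcosI y' subgroup.subset[OF subgroup_H])
    then have "y \<in> H #> y'" using y(1) y' by (simp add: m_assoc)
    then have "H #> y' = H #> y" using repr_independence[OF _ y' subgroup_H] by blast
    then have "Y = H #> y'" using y(2) by simp
    moreover have "i mod g < g" using g(2) by simp
    ultimately show "Y \<in> R" unfolding R_def y'_def using ijk(2) by auto
  qed
  then have "card (rcosets H) \<le> card R" by (intro card_mono) (simp_all add: R_def)
  also have "\<dots> \<le> card ({..<g} \<times> {..<2::nat})" unfolding R_def by (rule card_image_le) simp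
  finally show "subgroup_index G H \<le> g * 2" by (simp add: subgroup_index_def)
qed

section \<open>Normality of \<langle>a^4\<rangle>\<close>

abbreviation a4 :: 'a where "a4 \<equiv> a [^] (4::nat)"

lemma int_pow_C: "z \<in> C \<Longrightarrow> z [^] (i::int) \<in> C"
  by (rule subgroup_int_pow_closed[OF subgroup_C])

text \<open>By the normal form, every conjugate of \<open>z\<close> is \<open>z\<close> or its
  conjugate under \<open>b\<close>, because powers of \<open>c\<close> centralize
  \<langle>c\<rangle>.\<close>

lemma K_I:
  assumes "z \<in> C" "z \<otimes> a = a \<otimes> z" "cj z b \<in> C" shows "z \<in> K"
proof -
  have z: "z \<in> carrier G" using assms(1) C_in by blast
  have za: "cj z (a [^] i) = z" for i :: nat
  proof -
    have "cj a z = a" using z assms(2) by (simp add: cj_eq_iff)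
    then have "cj (a [^] i) z = a [^] i" using z by (simp add: cj_pow)
    then show ?thesis using z by (simp add: cj_eq_iff)
  qed
  have Cc: "cj y (c [^] k) = y" if y: "y \<in> C" for y and k :: nat
  proof -
    have "c [^] k \<in> C" unfolding C_eq by blast
    then show ?thesis using C_commute[OF y] y C_in by (auto simp: cj_eq_iff)
  qed
  have "cj z g \<in> C" if "g \<in> carrier G" for g
    using that
  proof (cases rule: carrier_cases)
    case (even i k)
    have "cj z g = cj (cj z (a [^] i)) (c [^] k)" unfolding even using z by (simp add: cj_cj)
    then show ?thesis using assms(1) by (simp add: za Cc)
  next
    case (odd i k)
    have "cj z g = cj (cj (cj z (a [^] i)) b) (c [^] k)" unfolding odd using z by (simp add: cj_cj m_assoc)
    then show ?thesis using assms(3) by (simp add: za Cc)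
  qed
  then show ?thesis using z by (simp add: core_iff[OF C_in])
qed

text \<open>A subgroup containing \<open>a\<close>, inside \<open>\<langle>a\<rangle>\<langle>c\<rangle>\<close> and normalized by \<open>b\<close>, is a product
  \<open>\<langle>a\<rangle>\<langle>c\<^sub>1\<rangle>\<close> with \<open>c\<^sub>1 \<in> \<langle>c\<rangle>\<close>.  As \<open>\<langle>c\<rangle>\<close> is cyclic, a subgroup of \<open>\<langle>c\<^sub>1\<rangle>\<close> normalized by \<open>a\<close> and \<open>b\<close> is normal
  in the whole group, so the triviality of the core is inherited.\<close>

lemma fourth_power_normalized_by:
  assumes L: "subgroup L G" and aL: "a \<in> L" and bL: "\<And>y. y \<in> L \<Longrightarrow> cj y b \<in> L"
    and LAC: "L \<subseteq> A <#> C" and core: "K = {\<one>}" and h: "h \<in> L"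
  shows "\<exists>m::nat. cj a4 h = a4 [^] m"
proof -
  have apow: "a [^] (i::nat) \<in> L" for i by (rule subgroup_nat_pow[OF L aL])
  have "subgroup (C \<inter> L) G" by (rule subgroups_Inter_pair[OF subgroup_C L])
  moreover have "C \<inter> L \<subseteq> {c [^] k | k::nat. True}" unfolding C_eq by blast
  ultimately obtain c1 where c1: "c1 \<in> C \<inter> L" "C \<inter> L = {c1 [^] k | k::nat. True}"
    by (rule subgroup_of_powers[OF finite_G c_in])
  have c1_in: "c1 \<in> carrier G" using c1(1) C_in by blast
  have dec: "\<exists>(i::nat) (k::nat). y = a [^] i \<otimes> c1 [^] k" if y: "y \<in> L" for y
  proof -
    obtain i k :: nat where ik: "y = a [^] i \<otimes> c [^] k"
      using y LAC unfolding set_mult_def A_eq C_eq by blast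
    then have "c [^] k = inv (a [^] i) \<otimes> y" by (simp add: inv_cancel)
    then have "c [^] k \<in> L"
      using y apow subgroup.m_closed[OF L] subgroup.m_inv_closed[OF L] by simp
    then have "c [^] k \<in> C \<inter> L" unfolding C_eq by blast
    then obtain k' :: nat where "c [^] k = c1 [^] k'" unfolding c1(2) by blast
    with ik have "y = a [^] i \<otimes> c1 [^] k'" by simp
    then show ?thesis by blast
  qed
  have c1pow: "c1 [^] (k::nat) \<in> L" for k using subgroup_nat_pow[OF L] c1(1) by blast
  have cp: "cyclic_product G a c1"
  proof
    show "\<exists>(i'::nat) (j'::nat). c1 [^] j \<otimes> a [^] i = a [^] i' \<otimes> c1 [^] j'" for i j :: nat
      using dec subgroup.m_closed[OF L c1pow apow] by blast
  qed (simp_all add: finite_G c1_in)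
  have "\<exists>k::nat. cj a4 c1 = a4 [^] k"
  proof (rule fourth_power_normalized[OF cp b_in b_square _ cj_a_b ord_a])
    show "n > 0" using n_ge by simp
    have "cj c1 b \<in> L" using bL c1(1) by blast
    then show "cj c1 b \<in> cyclic_product.prods G a c1"
      unfolding cyclic_product.prods_def[OF cp] using dec by blast
    show "a [^] i = \<one>" if "a [^] i = c1 [^] i'" for i i' :: int
    proof (rule S_C_trivial[OF a_int_pow_S])
      show "a [^] i \<in> C" using that int_pow_C[of c1 i'] c1(1) by simp
    qed
    fix z :: int
    assume z: "c1 [^] z \<otimes> a = a \<otimes> c1 [^] z" "\<exists>z'::int. cj (c1 [^] z) b = c1 [^] z'"
    have C1: "c1 [^] z \<in> C" for z :: int using int_pow_C c1(1) by blast
    then have "c1 [^] z \<in> K" using K_I[OF C1 z(1)] z(2) C1 by auto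
    then show "c1 [^] z = \<one>" using core by blast
  qed
  then obtain k :: nat where k: "cj a4 c1 = a4 [^] k" by blast
  have cpow: "\<exists>m::nat. cj a4 (c1 [^] i) = a4 [^] m" for i :: nat
  proof (induction i)
    case 0
    have "cj a4 (c1 [^] (0::nat)) = a4 [^] (1::nat)" by simp
    then show ?case by blast
  next
    case (Suc i)
    then obtain m :: nat where m: "cj a4 (c1 [^] i) = a4 [^] m" by blast
    have "cj a4 (c1 [^] Suc i) = cj (cj a4 (c1 [^] i)) c1"
      using c1_in by (simp add: cj_cj)
    also have "\<dots> = (a4 [^] k) [^] m"
      unfolding m using c1_in k by (simp only: cj_pow nat_pow_closed a_in)
    also have "\<dots> = a4 [^] (k * m)" by (simp only: nat_pow_pow nat_pow_closed a_in mult.assoc)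
    finally show ?case by blast
  qed
  obtain i j :: nat where ij: "h = a [^] i \<otimes> c1 [^] j" using dec[OF h] by blast
  have "cj a4 (a [^] i) = a4" by (simp add: cj_eq_iff nat_pow_comm)
  then have "cj a4 h = cj a4 (c1 [^] j)"
    unfolding ij using c1_in by (simp add: cj_cj[symmetric])
  then show ?thesis using cpow by simp
qed

abbreviation A4 :: "'a set" where "A4 \<equiv> generate G {a4}"

lemma A4_eq: "A4 = {a4 [^] k | k::nat. True}"
  using generate_nat_pow[OF finite_G] by simp

lemma subgroup_A4: "subgroup A4 G"
  by (rule generate_is_subgroup) simp

lemma cj_A4:
  assumes "y \<in> A4" "h \<in> carrier G" "cj a4 h = a4 [^] (m::nat)"
  shows "cj y h \<in> A4"
proof -
  obtain k :: nat where "y = a4 [^] k" using assms(1) unfolding A4_eq by blast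
  then have "cj y h = (a4 [^] m) [^] k"
    using assms(2,3) by (simp only: cj_pow nat_pow_closed a_in)
  then have "cj y h = a4 [^] (m * k)" by (simp only: nat_pow_pow nat_pow_closed a_in mult.assoc)
  then show ?thesis unfolding A4_eq by blast
qed

lemma cj_A4_b: "y \<in> A4 \<Longrightarrow> cj y b \<in> A4"
proof (rule cj_A4)
  show "cj a4 b = a4 [^] (2 * n - 1)"
    by (simp add: cj_pow cj_a_b nat_pow_pow mult.commute)
qed simp_all

text \<open>\<open>M\<close> need not contain \<open>a\<close> or be normalized by \<open>b\<close>.
  The product of its core with \<langle>a\<rangle> does and is, and it still lies in
  \<langle>a\<rangle>\<langle>c\<rangle>; so \<open>fourth_power_normalized_by\<close> applies to
  that product.\<close>

lemma core_M_normal: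
  assumes M: "subgroup M G" "M \<subseteq> A <#> C" and core: "K = {\<one>}"
  shows "subgroup_core G M \<inter> A4 \<lhd> G\<lparr>carrier := subgroup_core G M\<rparr>"
proof -
  define N where "N = subgroup_core G M"
  have M_in: "M \<subseteq> carrier G" by (rule subgroup.subset[OF M(1)])
  have N: "subgroup N G" unfolding N_def by (rule subgroup_core[OF M(1)])
  have N_in: "N \<subseteq> carrier G" by (rule subgroup.subset[OF N])
  have NM: "N \<subseteq> M" unfolding N_def by (rule core_subset[OF M_in])
  have cjN: "cj y g \<in> N" if "y \<in> N" "g \<in> carrier G" for y g
    using core_cj[OF M_in] that unfolding N_def by blast
  have "N \<lhd> G"
  proof (rule normal_invI[OF N])
    fix g y assume g: "g \<in> carrier G" and y: "y \<in> N"
    then have "cj y (inv g) \<in> N" using cjN by simp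
    then show "g \<otimes> y \<otimes> inv g \<in> N" using g by (simp add: conj_by_def)
  qed
  define L where "L = N <#> A"
  have A: "subgroup A G" by (rule generate_is_subgroup) simp
  have L: "subgroup L G" unfolding L_def by (rule mult_norm_subgroup[OF \<open>N \<lhd> G\<close> A])
  have a_A: "a [^] (i::nat) \<in> A" for i unfolding A_eq by blast
  have NL: "N \<subseteq> L"
  proof
    fix y assume "y \<in> N"
    then have "y \<otimes> a [^] (0::nat) \<in> L" unfolding L_def set_mult_def using a_A[of 0] by blast
    then show "y \<in> L" using \<open>y \<in> N\<close> N_in by auto
  qed
  have aL: "a \<in> L"
    using subgroup.one_closed[OF N] a_A[of 1] unfolding L_def set_mult_def by force
  have bL: "cj y b \<in> L" if "y \<in> L" for y
  proof -
    obtain y1 i where y: "y1 \<in> N" "y = y1 \<otimes> a [^] (i::nat)"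
      using \<open>y \<in> L\<close> unfolding L_def set_mult_def A_eq by blast
    have "cj y b = cj y1 b \<otimes> a [^] ((2 * n - 1) * i)"
      using y N_in by (auto simp: cj_mult cj_pow cj_a_b nat_pow_pow)
    then show ?thesis using cjN[OF y(1) b_in] a_A unfolding L_def set_mult_def by blast
  qed
  \<comment> \<open>Moving a^i to the left replaces y1 by a conjugate, which stays in the core and
    hence in \<open>M\<close>.\<close>
  have LAC: "L \<subseteq> A <#> C"
  proof
    fix y assume "y \<in> L"
    then obtain y1 i where y: "y1 \<in> N" "y = y1 \<otimes> a [^] (i::nat)"
      unfolding L_def set_mult_def A_eq by blast
    have y1: "y1 \<in> carrier G" using y(1) N_in by blast
    have "cj y1 (a [^] i) \<in> A <#> C" using cjN[OF y(1), of "a [^] i"] NM M(2) by auto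
    then obtain p q :: nat where pq: "cj y1 (a [^] i) = a [^] p \<otimes> c [^] q"
      unfolding set_mult_def A_eq C_eq by blast
    have "y = a [^] i \<otimes> cj y1 (a [^] i)" using y(2) y1 by (simp add: group_simps)
    then have "y = a [^] (i + p) \<otimes> c [^] q"
      unfolding pq by (simp add: m_assoc flip: nat_pow_mult)
    then show "y \<in> A <#> C" unfolding set_mult_def A_eq C_eq by blast
  qed
  have sub: "subgroup (N \<inter> A4) (G\<lparr>carrier := N\<rparr>)"
    by (rule subgroup_incl[OF subgroups_Inter_pair[OF N subgroup_A4] N]) simp
  have "N \<inter> A4 \<lhd> G\<lparr>carrier := N\<rparr>"
  proof (rule group.normal_invI[OF subgroup.subgroup_is_group[OF N is_group] sub])
    fix g y assume "g \<in> carrier (G\<lparr>carrier := N\<rparr>)" and y: "y \<in> N \<inter> A4"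
    then have g: "g \<in> N" "g \<in> carrier G" using N_in by auto
    then have ig: "inv g \<in> N" by (simp add: subgroup.m_inv_closed[OF N])
    obtain m :: nat where "cj a4 (inv g) = a4 [^] m"
      using fourth_power_normalized_by[OF L aL bL LAC core] ig NL by blast
    then have "cj y (inv g) \<in> A4" using cj_A4 y g(2) by simp
    moreover have "cj y (inv g) \<in> N" using cjN y g(2) by simp
    moreover have "cj y (inv g) = g \<otimes> y \<otimes> inv g" using g(2) by (simp add: conj_by_def)
    ultimately show "g \<otimes>\<^bsub>G\<lparr>carrier := N\<rparr>\<^esub> y \<otimes>\<^bsub>G\<lparr>carrier := N\<rparr>\<^esub> inv\<^bsub>G\<lparr>carrier := N\<rparr>\<^esub> g \<in> N \<inter> A4"
      using m_inv_consistent[OF N g(1)] by simp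
  qed
  then show ?thesis unfolding N_def .
qed

text \<open>\<open>fourth_power_normalized_by\<close> applies to
  \<langle>a\<rangle>\<langle>c\<rangle> itself once \<open>b\<close> is seen to normalize
  it.\<close>

lemma A4_normal:
  assumes M: "subgroup (A <#> C) G" and core: "K = {\<one>}"
  shows "A4 \<lhd> G"
proof -
  define M where "M = A <#> C"
  have M_sub: "subgroup M G" using M by (simp add: M_def)
  have MI: "a [^] i \<otimes> c [^] k \<in> M" for i k :: nat
    unfolding M_def set_mult_def A_eq C_eq by blast
  have ME: "\<exists>(i::nat) (k::nat). y = a [^] i \<otimes> c [^] k" if "y \<in> M" for y
    using that unfolding M_def set_mult_def A_eq C_eq by blast
  have apow: "a [^] i \<in> M" and cpow: "c [^] i \<in> M" for i :: nat
    using MI[of i 0] MI[of 0 i] by simp_all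
  have a_M: "a \<in> M" and c_M: "c \<in> M" using apow[of 1] cpow[of 1] by simp_all
  have b_M: "b \<notin> M"
  proof
    assume "b \<in> M"
    then obtain i k :: nat where ik: "b = a [^] i \<otimes> c [^] k" using ME by blast
    then have "c [^] k = inv (a [^] i) \<otimes> b" by (simp add: inv_cancel)
    then have "c [^] k \<in> S"
      using a_pow_S b_S subgroup.m_closed[OF subgroup_S] subgroup.m_inv_closed[OF subgroup_S] by simp
    then have "c [^] k = \<one>" using S_C_trivial unfolding C_eq by blast
    then have "b = a [^] i" using ik by simp
    then show False using b_not_power by blast
  qed
  have inv_b: "inv b = b" using b_square by (intro inv_equality) simp_all
  have cb: "cj c b \<in> M"
  proof -
    have "cj c b \<in> carrier G" by simp
    then show ?thesis
    proof (cases rule: carrier_cases)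
      case (even i k)
      then show ?thesis using MI by simp
    next
      case (odd i k)
      \<comment> \<open>If c^b were a^i b c^k, solving for \<open>b\<close> would place it in
        M.\<close>
      have "c \<otimes> b = b \<otimes> cj c b" by (simp add: group_simps)
      also have "\<dots> = b \<otimes> (a [^] i \<otimes> b) \<otimes> c [^] k" unfolding odd by (simp add: m_assoc)
      also have "\<dots> = a [^] ((2 * n - 1) * i) \<otimes> c [^] k"
        unfolding a_pow_b by (simp add: m_assoc[symmetric] b_square)
      finally have "b = inv c \<otimes> (a [^] ((2 * n - 1) * i) \<otimes> c [^] k)"
        by (simp add: inv_solve_left)
      then have "b \<in> M"
        using MI c_M subgroup.m_closed[OF M_sub] subgroup.m_inv_closed[OF M_sub] by metis
      with b_M show ?thesis by blast
    qed
  qed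
  have bM: "cj y b \<in> M" if "y \<in> M" for y
  proof -
    obtain i k :: nat where y: "y = a [^] i \<otimes> c [^] k" using ME \<open>y \<in> M\<close> by blast
    have "cj y b = a [^] ((2 * n - 1) * i) \<otimes> cj c b [^] k"
      unfolding y by (simp add: cj_mult cj_pow cj_a_b nat_pow_pow)
    then show ?thesis
      using apow subgroup_nat_pow[OF M_sub cb] subgroup.m_closed[OF M_sub] by simp
  qed
  have A4_M: "cj y h \<in> A4" if "y \<in> A4" "h \<in> M" for y h
  proof -
    obtain m :: nat where "cj a4 h = a4 [^] m"
      using fourth_power_normalized_by[OF M_sub a_M bM _ core \<open>h \<in> M\<close>] by (auto simp: M_def)
    then show ?thesis using cj_A4 that subgroup.mem_carrier[OF M_sub] by blast
  qed
  have "cj y g \<in> A4" if y: "y \<in> A4" and g: "g \<in> carrier G" for y g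
    using g
  proof (cases rule: carrier_cases)
    case (even i k)
    then show ?thesis using A4_M[OF y] MI by simp
  next
    case (odd i k)
    have yi: "y \<in> carrier G" using y subgroup.mem_carrier[OF subgroup_A4] by blast
    have "cj y g = cj (cj (cj y (a [^] i)) b) (c [^] k)" unfolding odd using yi by (simp add: cj_cj m_assoc)
    then show ?thesis using A4_M cj_A4_b y apow cpow by simp
  qed
  then have "g \<otimes> y \<otimes> inv g \<in> A4" if "g \<in> carrier G" "y \<in> A4" for g y
    using that by (metis conj_by_def inv_closed inv_inv)
  then show ?thesis by (intro normal_invI subgroup_A4) blast
qed

lemma centralizer_odd:
  assumes "odd n"
  shows "generate G {a4, c} \<subseteq> H" "subgroup_index G H \<le> 8"
proof -
  \<comment> \<open>The multiplier stands for -2 modulo 4n, as -2(2n - 2) = 4 - 4n.\<close>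
  have *: "(2 * n - 2) * (4 * n - 2) = 4 * n * (2 * n - 3) + 4"
  proof -
    obtain m where "n = m + 2" using n_ge by (metis le_add_diff_inverse2)
    then show ?thesis by (simp add: algebra_simps)
  qed
  show "generate G {a4, c} \<subseteq> H" "subgroup_index G H \<le> 8"
    using centralizer_bound[OF *] by simp_all
qed

lemma centralizer_even:
  assumes "even n"
  shows "generate G {a [^] (2::nat), c} \<subseteq> H" "subgroup_index G H \<le> 4"
proof -
  \<comment> \<open>The product is 2n^2 - 4n + 2, and 4n divides 2n^2 for even n.\<close>
  have *: "(2 * n - 2) * (n - 1) = 4 * n * (n div 2 - 1) + 2"
  proof -
    obtain m where "n = 2 * m" using assms by (elim evenE)
    moreover obtain m' where "m = Suc m'" using n_ge \<open>n = 2 * m\<close> by (cases m) auto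
    ultimately show ?thesis by (simp add: algebra_simps)
  qed
  show "generate G {a [^] (2::nat), c} \<subseteq> H" "subgroup_index G H \<le> 4"
    using centralizer_bound[OF *] by simp_all
qed

end

theorem theorem1p2:
  fixes \<XX> :: "('a, 'r) monoid_scheme" (structure)
    and n m :: nat and G M :: "'a set" and a b c :: 'a
  assumes "n \<ge> 2" and "m \<ge> 2"
    and "group \<XX>" and "finite (carrier \<XX>)"
    and "semidihedral_subgroup \<XX> n G a b"
    and "c \<in> carrier \<XX>" and "group.ord \<XX> c = m"
    and "carrier \<XX> = G <#> generate \<XX> {c}"
    and "G \<inter> generate \<XX> {c} = {\<one>}"
    and "biggest_subgroup_between \<XX> (generate \<XX> {c}) (generate \<XX> {a} <#> generate \<XX> {c}) M"
  shows
    "(odd n \<longrightarrow>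
        generate \<XX> {a [^] (4::nat), c} \<subseteq> centralizer \<XX> (subgroup_core \<XX> (generate \<XX> {c})) \<and>
        subgroup_index \<XX> (centralizer \<XX> (subgroup_core \<XX> (generate \<XX> {c}))) \<le> 8) \<and>
     (even n \<longrightarrow>
        generate \<XX> {a [^] (2::nat), c} \<subseteq> centralizer \<XX> (subgroup_core \<XX> (generate \<XX> {c})) \<and>
        subgroup_index \<XX> (centralizer \<XX> (subgroup_core \<XX> (generate \<XX> {c}))) \<le> 4) \<and>
     (subgroup_core \<XX> (generate \<XX> {c}) = {\<one>} \<longrightarrow>
        subgroup_core \<XX> M \<inter> generate \<XX> {a [^] (4::nat)} \<lhd> \<XX>\<lparr>carrier := subgroup_core \<XX> M\<rparr>) \<and>
     (subgroup_core \<XX> (generate \<XX> {c}) = {\<one>} \<and> M = generate \<XX> {a} <#> generate \<XX> {c} \<longrightarrow>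
        generate \<XX> {a [^] (4::nat)} \<lhd> \<XX>)"
proof -
  interpret semidihedral_product \<XX> n G a b c
    using assms by (intro semidihedral_product.intro semidihedral_product_axioms.intro)
  have M: "subgroup M \<XX>" "M \<subseteq> generate \<XX> {a} <#> generate \<XX> {c}"
    using assms(10) unfolding biggest_subgroup_between_def by blast+
  show ?thesis
    using centralizer_odd centralizer_even core_M_normal[OF M] A4_normal M(1) by blast
qed

end
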